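(* Let $(\xi_i)_{i\in\mathbb{Z}}$ be i.i.d. centered random variables with finite second moment, $\mathbb{E}\xi_0^2>0$. Let $1/2<r<1$, let $l$ be a positive slowly varying function, and let $a_i=l(i+1)(1+i)^{-r}$ for $i\ge0$, $a_i=0$ for $i<0$ (with $a_0=1$). Let $X_k=\sum_{j=-\infty}^ka_{k-j}\xi_j$, $S_n=\sum_{k=1}^nX_k=\sum_{i\le n}b_{ni}\xi_i$ with $b_{ni}=a_{1-i}+\cdots+a_{n-i}$, and $\sigma_n^2=\mathbb{E}\xi_0^2\sum_{i\le n}b_{ni}^2$. (i) Assume that for a certain $t>2$ and a slowly varying function $h$, $\mathbb{P}(\xi_0\ge x)=h(x)/x^t$ as $x\to\infty$ (i.e. for all sufficiently large $x$). Then $$\mathbb{P}(S_n\ge x_n\sigma_n)=(1+o(1))\sum_{i\le n}\mathbb{P}(b_{ni}\xi_0\ge x_n\sigma_n)\quad\text{as } n\to\infty$$ for every sequence $x_n>c_1(\ln n)^{1/2}$ with a constant $c_1>(t-2)^{1/2}e^{t/2}(t+2)/2$. (ii) Assume that $\mathbb{E}|\xi_0|^p<\infty$ for a certain $p>2$. Then $$\mathbb{P}(S_n\ge x_n\sigma_n)=(1-\Phi(x_n))(1+o(1))\quad\text{as } n\to\infty$$ for every sequence with $x_n^2\le(p-2)\ln n$.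
   Context: $\Phi$ is the standard normal distribution function. A (measurable, eventually positive) function $h$ is slowly varying if $\lim_{x\to\infty}h(\lambda x)/h(x)=1$ for all $\lambda>0$. Each $o(1)$ denotes a sequence, which may depend on $(x_n)$ and on the underlying distribution, converging to $0$ as $n\to\infty$. *)

theory Defs
  imports "HOL-Probability.Probability"
begin

text \<open>Slow variation at infinity concerns functions on the positive half-line; the values of
  \<open>h\<close> at nonpositive arguments are irrelevant.\<close>

definition slowly_varying :: "(real \<Rightarrow> real) \<Rightarrow> bool" where
  "slowly_varying h \<longleftrightarrow>
     h \<in> borel_measurable (restrict_space borel {0<..}) \<and>
     (\<forall>\<^sub>F x in at_top. h x > 0) \<and>
     (\<forall>c>0. ((\<lambda>x. h (c * x) / h x) \<longlongrightarrow> 1) at_top)"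

definition coeff_a :: "(real \<Rightarrow> real) \<Rightarrow> real \<Rightarrow> int \<Rightarrow> real" where
  "coeff_a l r i =
     (if i < 0 then 0 else l (real_of_int i + 1) * (1 + real_of_int i) powr (- r))"

text \<open>The series \<open>\<Sum>j\<le>k. a (k - j) * \<xi> j\<close>, summed in the order \<open>j = k, k - 1, k - 2, \<dots>\<close>.
  It need not converge absolutely when \<open>a\<close> is only square-summable, so it is an ordered
  (almost surely convergent) series rather than an unordered sum.\<close>

definition linear_process :: "(int \<Rightarrow> real) \<Rightarrow> (int \<Rightarrow> 'a \<Rightarrow> real) \<Rightarrow> int \<Rightarrow> 'a \<Rightarrow> real" where
  "linear_process a \<xi> k \<omega> = (\<Sum>m::nat. a (int m) * \<xi> (k - int m) \<omega>)"

definition partial_sum :: "(int \<Rightarrow> real) \<Rightarrow> (int \<Rightarrow> 'a \<Rightarrow> real) \<Rightarrow> nat \<Rightarrow> 'a \<Rightarrow> real" where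
  "partial_sum a \<xi> n \<omega> = (\<Sum>k=1..n. linear_process a \<xi> (int k) \<omega>)"

definition coeff_b :: "(int \<Rightarrow> real) \<Rightarrow> nat \<Rightarrow> int \<Rightarrow> real" where
  "coeff_b a n i = (\<Sum>k=1..n. a (int k - i))"

definition sum_sd :: "'a measure \<Rightarrow> (int \<Rightarrow> real) \<Rightarrow> (int \<Rightarrow> 'a \<Rightarrow> real) \<Rightarrow> nat \<Rightarrow> real" where
  "sum_sd M a \<xi> n =
     sqrt ((LINT \<omega>|M. (\<xi> 0 \<omega>)\<^sup>2) * (\<Sum>\<^sub>\<infinity>i\<in>{..int n}. (coeff_b a n i)\<^sup>2))"

definition std_normal_cdf :: "real \<Rightarrow> real" where
  "std_normal_cdf = cdf std_normal_distribution"

end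

theory Submission
  imports Defs "HOL-Real_Asymp.Real_Asymp"
begin

text \<open>
  Write \<open>S\<close> for a finite weighted sum \<open>\<Sum>i\<in>F. c i * X i\<close> of standardised variables with
  \<open>\<Sum>i\<in>F. (c i)\<^sup>2 \<le> 1\<close>. Regular variation of the coefficients gives that all normalised weights are
  \<open>O(n powr (-1/2))\<close> and that at least \<open>n\<close> of them are of this exact order; the infinite sum is an
  almost sure limit of finite ones, so uniform estimates for \<open>S\<close> suffice.

  Moderate deviations: truncate each summand at \<open>1 / x\<close> from above. One large summand is too
  unlikely to matter, and for the truncated sum the indicator of \<open>[x, \<infinity>)\<close> is sandwiched between
  \<open>C\<^sup>2\<close> step functions, to which Lindeberg's replacement of the summands by Gaussian ones applies
  with all error terms weighted by \<open>exp (x * u)\<close>; this makes the total error a power of the maximal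
  weight times \<open>exp (- x\<^sup>2 / 2)\<close>, i.e. small relative to the Gaussian tail.

  Large deviations: above the threshold a Chernoff bound makes the sum truncated at \<open>x / 4\<close>
  negligible compared with \<open>\<Sum>i. P (c i * X i \<ge> x)\<close>, so exactly one summand has to be of order
  \<open>x\<close>, and the others only move it by \<open>o(x)\<close>, which regular variation absorbs.
\<close>

text \<open>The boundary \<open>x^2 = (p - 2) ln n\<close> shapes the moderate deviations. With
  weights of order \<open>n powr (-1/2)\<close>, Markov's inequality bounds the chance of a summand
  above \<open>1 / x\<close> by \<open>x powr p * n powr (1 - p / 2)\<close>, which there exceeds
  the Gaussian tail \<open>exp (- x^2 / 2) / x\<close> by a power of \<open>x\<close>. So a mere
  union bound over large summands fails. Summands above \<open>x / 2\<close> gain a factor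
  \<open>x powr (- 2 p)\<close>, and a summand between \<open>1 / x\<close> and \<open>x / 2\<close>
  also needs an independent remainder above \<open>x / 2\<close>. At the cut \<open>1 / x\<close>
  the tilt \<open>exp (x u)\<close> of one summand is bounded, so moments of order \<open>p\<close>
  control the replacement error. For large deviations, the variance term of the Chernoff exponent
  carries a factor \<open>exp q\<close> with \<open>q < t\<close>, which leads to
  \<open>exp (- exp (- t) x^2 / 2)\<close>. The jump term is about
  \<open>x powr (- t) * n powr (1 - t / 2)\<close>, so \<open>x^2\<close> is compared with multiples
  of \<open>exp t * (t - 2) * ln n\<close>: the hypothesis on \<open>c1\<close> supplies the
  multiple 4, finite sums are treated with 3, and the gap pays for moving the level.\<close>

section \<open>Regularly varying coefficients\<close>

text \<open>The uniform convergence theorem for slowly varying functions in additive form. If uniformity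
  fails along points \<open>s n + u n\<close>, the sets of shifts that are good for \<open>s n\<close> and for \<open>s n + u n\<close>
  both nearly exhaust an interval of length \<open>2\<close> inside one of length \<open>3\<close>, hence they meet.\<close>

lemma additive_uniform_convergence:
  fixes h :: "real \<Rightarrow> real"
  assumes h[measurable]: "h \<in> borel_measurable borel"
    and lim: "\<And>u. ((\<lambda>s. h (s + u) - h s) \<longlongrightarrow> 0) at_top"
    and e: "e > 0"
  shows "\<exists>S. \<forall>s\<ge>S. \<forall>u\<in>{0..1}. \<bar>h (s + u) - h s\<bar> < e"
proof (rule ccontr)
  assume "\<not> ?thesis"
  then have "\<forall>n::nat. \<exists>s u. s \<ge> real n \<and> u \<in> {0..1} \<and> \<bar>h (s + u) - h s\<bar> \<ge> e"
    by (meson linorder_not_less)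
  then obtain s u where s: "\<And>n. s n \<ge> real n" and u: "\<And>n. u n \<in> {0..1::real}"
    and big: "\<And>n. \<bar>h (s n + u n) - h (s n)\<bar> \<ge> e"
    by metis
  \<comment> \<open>Imposing the bound for all \<open>m \<ge> n\<close> makes the sets increase to
    \<open>{0..2}\<close>, so continuity of the measure pushes their measure above 3/2. A
    translation by \<open>u n \<le> 1\<close> stays inside \<open>{0..3}\<close>, where two disjoint
    sets of measure above 3/2 do not fit.\<close>
  define V where "V z n = {w\<in>{0..2::real}. \<forall>m\<ge>n. \<bar>h (z m + w) - h (z m)\<bar> < e / 2}"
    for z :: "nat \<Rightarrow> real" and n :: nat
  have Vm[measurable]: "V z n \<in> sets borel" for z n
    unfolding V_def by measurable
  have Vlim: "\<forall>\<^sub>F n in sequentially. measure lborel (V z n) > 3 / 2"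
    if z: "\<And>n. z n \<ge> real n" for z
  proof -
    have "filterlim z at_top sequentially"
      by (rule filterlim_at_top_mono[OF filterlim_real_sequentially]) (use z in auto)
    then have conv: "(\<lambda>m. h (z m + w) - h (z m)) \<longlonglongrightarrow> 0" for w
      by (rule filterlim_compose[OF lim])
    have U: "(\<Union>n. V z n) = {0..2}"
    proof (intro equalityI subsetI)
      fix w :: real assume w: "w \<in> {0..2}"
      have "\<forall>\<^sub>F m in sequentially. dist (h (z m + w) - h (z m)) 0 < e / 2"
        using tendstoD[OF conv, of "e/2" w] e by simp
      then obtain n where "\<forall>m\<ge>n. \<bar>h (z m + w) - h (z m)\<bar> < e / 2"
        by (auto simp: eventually_sequentially dist_real_def)
      with w show "w \<in> (\<Union>n. V z n)" by (auto simp: V_def)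
    qed (auto simp: V_def)
    have "(\<lambda>n. measure lborel (V z n)) \<longlonglongrightarrow> measure lborel (\<Union>n. V z n)"
    proof (rule Lim_measure_incseq)
      show "incseq (V z)" by (auto simp: incseq_def V_def)
      show "emeasure lborel (\<Union> (range (V z))) \<noteq> \<infinity>" by (simp add: U)
    qed auto
    then have "(\<lambda>n. measure lborel (V z n)) \<longlonglongrightarrow> 2" by (simp add: U)
    then show ?thesis by (rule order_tendstoD) simp
  qed
  have "\<forall>\<^sub>F n in sequentially. measure lborel (V s n) > 3 / 2 \<and>
      measure lborel (V (\<lambda>n. s n + u n) n) > 3 / 2"
    using u by (intro eventually_conj Vlim) (auto intro: add_increasing2 s)
  then obtain n where n: "measure lborel (V s n) > 3 / 2"
      "measure lborel (V (\<lambda>n. s n + u n) n) > 3 / 2"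
    by (auto simp: eventually_sequentially)
  define W where "W = (+) (- u n) -` V (\<lambda>n. s n + u n) n"
  have Wm[measurable]: "W \<in> sets borel"
    using measurable_sets_borel[of "(+) (- u n)" borel "V (\<lambda>n. s n + u n) n"] by (simp add: W_def)
  have "measure lborel W = measure (distr lborel borel ((+) (- u n))) (V (\<lambda>n. s n + u n) n)"
    by (subst measure_distr) (auto simp: W_def)
  then have W: "measure lborel W > 3 / 2" using n by (simp add: lborel_distr_plus)
  have sub: "V s n \<subseteq> {0..3}" "W \<subseteq> {0..3}"
    using u[of n] by (auto simp: V_def W_def)
  have I: "{0..3::real} \<in> fmeasurable lborel" by (intro fmeasurableI) auto
  have fin: "V s n \<in> fmeasurable lborel" "W \<in> fmeasurable lborel"
    using fmeasurableI2[OF I sub(1)] fmeasurableI2[OF I sub(2)] by auto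
  have "V s n \<inter> W = {}"
  proof (rule ccontr)
    assume "V s n \<inter> W \<noteq> {}"
    then obtain w where w: "w \<in> V s n" "w - u n \<in> V (\<lambda>n. s n + u n) n" by (auto simp: W_def)
    from w(1) have "\<bar>h (s n + w) - h (s n)\<bar> < e / 2" by (auto simp: V_def)
    moreover from w(2) have "\<bar>h (s n + u n + (w - u n)) - h (s n + u n)\<bar> < e / 2"
      unfolding V_def by blast
    then have "\<bar>h (s n + w) - h (s n + u n)\<bar> < e / 2" by (simp add: add.assoc)
    ultimately show False using big[of n] by linarith
  qed
  then have "measure lborel (V s n) + measure lborel W = measure lborel (V s n \<union> W)"
    using fin by (subst measure_Union) (auto simp: fmeasurable_def less_top)
  also have "\<dots> \<le> measure lborel {0..3::real}"
    using sub I by (intro measure_mono_fmeasurable) auto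
  finally show False using n W by simp
qed

text \<open>In the variable \<open>ln x\<close> a dilation by \<open>c\<close> is a translation by
  \<open>ln c\<close>, and \<open>c \<in> {1..2}\<close> gives \<open>ln c \<in> {0..1}\<close>, the
  shifts for which uniformity is available.\<close>

lemma slowly_varying_uniform:
  assumes l: "slowly_varying l" and pos: "\<And>x. x > 0 \<Longrightarrow> l x > 0" and k: "\<kappa> > 1"
  shows "\<exists>X\<ge>1. \<forall>x\<ge>X. \<forall>c\<in>{1..2}. l (c * x) \<le> \<kappa> * l x \<and> l x \<le> \<kappa> * l (c * x)"
proof -
  define h where "h s = ln (l (exp s))" for s
  have [measurable]: "l \<in> borel_measurable (restrict_space borel {0<..})"
    using l by (simp add: slowly_varying_def)
  have m: "(\<lambda>s. l (exp s)) \<in> borel_measurable borel"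
    by (rule measurable_compose[of exp borel "restrict_space borel {0<..}"])
       (auto intro!: measurable_restrict_space2)
  have lim: "((\<lambda>s. h (s + u) - h s) \<longlongrightarrow> 0) at_top" for u
  proof -
    have "((\<lambda>x. l (exp u * x) / l x) \<longlongrightarrow> 1) at_top"
      using l by (auto simp: slowly_varying_def)
    then have "((\<lambda>s. l (exp u * exp s) / l (exp s)) \<longlongrightarrow> 1) at_top"
      by (rule filterlim_compose[OF _ exp_at_top])
    then have "((\<lambda>s. ln (l (exp u * exp s) / l (exp s))) \<longlongrightarrow> ln 1) at_top"
      by (intro tendsto_ln) auto
    moreover have "ln (l (exp u * exp s) / l (exp s)) = h (s + u) - h s" for s
      using pos[of "exp s"] pos[of "exp u * exp s"] by (simp add: h_def ln_div exp_add mult.commute)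
    ultimately show ?thesis by simp
  qed
  have "h \<in> borel_measurable borel" unfolding h_def using m by measurable
  from additive_uniform_convergence[OF this lim, of "ln \<kappa>"] k
  obtain S where "\<forall>s\<ge>S. \<forall>u\<in>{0..1}. \<bar>h (s + u) - h s\<bar> < ln \<kappa>"
    by auto
  then have S: "\<bar>h (s + u) - h s\<bar> < ln \<kappa>" if "s \<ge> S" "u \<in> {0..1}" for s u
    using that by blast
  show ?thesis
  proof (intro exI[of _ "max 1 (exp S)"] conjI allI impI ballI)
    fix x c :: real assume x: "x \<ge> max 1 (exp S)" and c: "c \<in> {1..2}"
    have xp: "x > 0" using x by auto
    have "ln c \<le> ln (exp 1)" using c exp_ge_add_one_self[of 1] by (intro ln_mono) auto
    then have u: "ln c \<in> {0..1}" using c by auto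
    have s: "ln x \<ge> S" using x xp by (simp add: ln_ge_iff)
    have *: "\<bar>ln (l (c * x)) - ln (l x)\<bar> < ln \<kappa>"
      using S[OF s u] c xp by (simp add: h_def exp_add mult.commute)
    have p: "l (c * x) > 0" "l x > 0" using c xp by (auto intro!: pos)
    have "ln (l (c * x)) \<le> ln (\<kappa> * l x)" "ln (l x) \<le> ln (\<kappa> * l (c * x))"
      using * p k by (auto simp: ln_mult)
    then show "l (c * x) \<le> \<kappa> * l x" "l x \<le> \<kappa> * l (c * x)" using p k by auto
  qed auto
qed

text \<open>Going from \<open>x\<close> to \<open>y\<close> takes about \<open>log 2 (y / x)\<close>
  doublings, each costing at most a factor \<open>2 powr \<eta>\<close>, in total
  \<open>(y / x) powr \<eta>\<close>. The extra \<open>2 powr \<eta>\<close> pays for the last,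
  incomplete doubling.\<close>

lemma potter_bounds:
  assumes l: "slowly_varying l" and pos: "\<And>x. x > 0 \<Longrightarrow> l x > 0" and e: "\<eta> > 0"
  shows "\<exists>X\<ge>1. \<forall>x\<ge>X. \<forall>y\<ge>x. l y \<le> 2 powr \<eta> * (y / x) powr \<eta> * l x \<and>
                               l x \<le> 2 powr \<eta> * (y / x) powr \<eta> * l y"
proof -
  have "(2::real) powr \<eta> > 1" using e by simp
  then obtain X where X: "X \<ge> 1" and
    step: "\<And>x c. x \<ge> X \<Longrightarrow> c \<in> {1..2} \<Longrightarrow> l (c * x) \<le> 2 powr \<eta> * l x \<and> l x \<le> 2 powr \<eta> * l (c * x)"
    using slowly_varying_uniform[OF l pos, of "2 powr \<eta>"] by metis
  have main: "l y \<le> 2 powr \<eta> * (y / x) powr \<eta> * l x \<and> l x \<le> 2 powr \<eta> * (y / x) powr \<eta> * l y"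
    if "x \<ge> X" "y \<ge> x" "y \<le> 2 ^ k * x" for x y k
    using that
  proof (induction k arbitrary: y)
    case 0
    then have y: "y = x" by simp
    have "1 \<le> (2::real) powr \<eta>" using e by (intro ge_one_powr_ge_zero) auto
    moreover have "l x > 0" "x > 0" using 0 X by (auto intro!: pos)
    ultimately show ?case unfolding y by (auto)
  next
    case (Suc k)
    have xp: "x > 0" "y > 0" using Suc X by auto
    have lp: "l x > 0" "l y > 0" using xp pos by auto
    show ?case
    proof (cases "y \<le> 2 * x")
      case True
      have *: "l (y/x * x) \<le> 2 powr \<eta> * l x \<and> l x \<le> 2 powr \<eta> * l (y/x * x)"
        using True Suc xp by (intro step) (auto simp: field_simps)
      have "1 \<le> (y/x) powr \<eta>" using Suc xp e by (intro ge_one_powr_ge_zero) auto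
      then have "2 powr \<eta> * z \<le> 2 powr \<eta> * (y / x) powr \<eta> * z" if "z > 0" for z
        using that by simp
      with * lp xp show ?thesis by (smt (verit) nonzero_eq_divide_eq)
    next
      case False
      have y2: "y / 2 \<ge> x" "y / 2 > 0" using False xp by auto
      have IH: "l (y/2) \<le> 2 powr \<eta> * (y / 2 / x) powr \<eta> * l x"
           "l x \<le> 2 powr \<eta> * (y / 2 / x) powr \<eta> * l (y/2)"
        using Suc.IH[of "y/2"] y2 Suc.prems by auto
      have eq: "(y / 2 / x) powr \<eta> * 2 powr \<eta> = (y / x) powr \<eta>"
        using xp by (subst powr_mult[symmetric]) auto
      have st: "l y \<le> 2 powr \<eta> * l (y/2)" "l (y/2) \<le> 2 powr \<eta> * l y"
        using step[of "y/2" 2] y2 Suc.prems by auto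
      have "l y \<le> 2 powr \<eta> * (2 powr \<eta> * (y / 2 / x) powr \<eta> * l x)"
        using st(1) IH(1) by (smt (verit) mult_left_mono powr_ge_zero)
      moreover have "l x \<le> 2 powr \<eta> * (y / 2 / x) powr \<eta> * (2 powr \<eta> * l y)"
        using st(2) IH(2) by (smt (verit) mult_left_mono powr_ge_zero mult_nonneg_nonneg)
      ultimately show ?thesis unfolding eq[symmetric] by (simp add: mult_ac)
    qed
  qed
  show ?thesis
  proof (intro exI[of _ X] conjI X allI impI)
    fix x y assume xy: "X \<le> x" "x \<le> y"
    obtain k where "y / x < 2 ^ k" using real_arch_pow[of 2 "y/x"] by auto
    then have "y \<le> 2 ^ k * x" using xy X by (auto simp: field_simps)
    from main[OF xy this] show "l y \<le> 2 powr \<eta> * (y / x) powr \<eta> * l x"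
      "l x \<le> 2 powr \<eta> * (y / x) powr \<eta> * l y" by auto
  qed
qed

text \<open>Up to the threshold \<open>N\<close> there are only finitely many ratios
  \<open>l i / l j\<close>, all at most \<open>D\<close>; a pair with \<open>m < N < n\<close> is
  compared through \<open>l N\<close>. Validity from index 1 on is needed because whole blocks of
  coefficients are summed.\<close>

lemma potter_bounds_nat:
  assumes l: "slowly_varying l" and pos: "\<And>x. x > 0 \<Longrightarrow> l x > 0" and e: "\<eta> > 0"
  shows "\<exists>C\<ge>1. \<forall>m n. 1 \<le> m \<longrightarrow> m \<le> n \<longrightarrow>
    l (real n) \<le> C * (real n / real m) powr \<eta> * l (real m) \<and>
    l (real m) \<le> C * (real n / real m) powr \<eta> * l (real n)"
proof -
  obtain X where X: "X \<ge> 1" "\<And>x y. x \<ge> X \<Longrightarrow> y \<ge> x \<Longrightarrow> l y \<le> 2 powr \<eta> * (y / x) powr \<eta> * l x"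
     "\<And>x y. x \<ge> X \<Longrightarrow> y \<ge> x \<Longrightarrow> l x \<le> 2 powr \<eta> * (y / x) powr \<eta> * l y"
    using potter_bounds[OF l pos e] by blast
  define N where "N = nat \<lceil>X\<rceil>"
  have N: "real N \<ge> X" "N \<ge> 1" using X(1) by (auto simp: N_def) linarith
  define D where "D = 1 + (\<Sum>(i, j)\<in>{1..N}\<times>{1..N}. l i / l j)"
  have D: "l i \<le> D * l j" if "i \<in> {1..N}" "j \<in> {1..N}" for i j :: nat
  proof -
    have "(\<lambda>(i, j). l i / l j) (i, j) \<le> (\<Sum>(i, j)\<in>{1..N}\<times>{1..N}. l i / l j)"
      by (rule member_le_sum) (use that in \<open>auto intro!: divide_nonneg_nonneg less_imp_le[OF pos]\<close>)
    then have "l i / l j \<le> D" by (simp add: D_def)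
    then show ?thesis using pos[of j] that by (auto simp: field_simps)
  qed
  have D1: "D \<ge> 1" unfolding D_def
    by (auto intro!: sum_nonneg divide_nonneg_nonneg less_imp_le[OF pos])
  define C where "C = 2 powr \<eta> * D"
  have p1: "1 \<le> (2::real) powr \<eta>" using e by (intro ge_one_powr_ge_zero) auto
  have C1: "C \<ge> 1" "C \<ge> D" "C \<ge> 2 powr \<eta>"
    unfolding C_def using mult_mono[OF p1 D1] mult_mono[OF p1 order_refl[of D]]
      mult_mono[OF order_refl[of "2 powr \<eta>"] D1] D1 p1 by auto
  have "l n \<le> C * (n / m) powr \<eta> * l m \<and> l m \<le> C * (n / m) powr \<eta> * l n"
    if mn: "1 \<le> m" "m \<le> n" for m n :: nat
  proof -
    have lp: "l m > 0" "l n > 0" "l N > 0" using mn N by (auto intro!: pos)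
    have q1: "(n / m) powr \<eta> \<ge> 1" using mn e by (intro ge_one_powr_ge_zero) auto
    consider "m \<ge> N" | "n \<le> N" | "m < N" "N < n" using mn by linarith
    then show ?thesis
    proof cases
      case 1
      then have "l n \<le> 2 powr \<eta> * (n / m) powr \<eta> * l m" "l m \<le> 2 powr \<eta> * (n / m) powr \<eta> * l n"
        using N mn by (auto intro!: X)
      moreover have "2 powr \<eta> * (n / m) powr \<eta> * z \<le> C * (n / m) powr \<eta> * z" if "z > 0" for z
        using that C1(3) by (intro mult_right_mono) auto
      ultimately show ?thesis using lp by (meson order_trans)
    next
      case 2
      have "D * 1 * z \<le> C * (n / m) powr \<eta> * z" if "z > 0" for z
        using that C1 q1 D1 by (intro mult_right_mono mult_mono) auto
      moreover have "l n \<le> D * l m" "l m \<le> D * l n" using 2 mn by (auto intro!: D)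
      ultimately show ?thesis using lp by (smt (verit) mult.right_neutral)
    next
      case 3
      have a: "l n \<le> 2 powr \<eta> * (n / N) powr \<eta> * l N" "l N \<le> 2 powr \<eta> * (n / N) powr \<eta> * l n"
        using N 3 by (auto intro!: X)
      have b: "l m \<le> D * l N" "l N \<le> D * l m" using 3 mn by (auto intro!: D)
      have c: "(n / N) powr \<eta> \<le> (n / m) powr \<eta>"
        using 3 mn N e by (intro powr_mono2 divide_left_mono) auto
      have "l n \<le> 2 powr \<eta> * (n / N) powr \<eta> * (D * l m)"
        using b(2) by (intro order_trans[OF a(1)] mult_left_mono) auto
      also have "\<dots> \<le> 2 powr \<eta> * (n / m) powr \<eta> * (D * l m)"
        using c D1 lp by (intro mult_right_mono mult_left_mono) auto
      finally have 1: "l n \<le> C * (n / m) powr \<eta> * l m" by (simp add: C_def mult_ac)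
      have "l m \<le> D * (2 powr \<eta> * (n / N) powr \<eta> * l n)"
        using D1 by (intro order_trans[OF b(1)] mult_left_mono[OF a(2)]) auto
      also have "\<dots> \<le> D * (2 powr \<eta> * (n / m) powr \<eta> * l n)"
        using c D1 lp by (intro mult_right_mono mult_left_mono) auto
      finally have 2: "l m \<le> C * (n / m) powr \<eta> * l n" by (simp add: C_def mult_ac)
      show ?thesis by (rule conjI[OF 1 2])
    qed
  qed
  note bnd = this
  show ?thesis
    by (intro exI[of _ C] conjI allI impI; (rule C1(1) | rule bnd[THEN conjunct1] | rule bnd[THEN conjunct2] | simp))
qed

section \<open>Sums of powers, and the size of the block sums of the coefficients\<close>

lemma powr_diff_Suc:
  assumes "n \<ge> (1::nat)"
  shows "\<exists>z. real n < z \<and> z < real n + 1 \<and> (real n + 1) powr s - real n powr s = s * z powr (s - 1)"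
proof -
  have "\<exists>z>real n. z < real n + 1 \<and> (real n + 1) powr s - real n powr s = (real n + 1 - real n) * (s * z powr (s - 1))"
    using assms by (intro MVT2) (auto intro!: derivative_eq_intros simp: powr_diff)
  then show ?thesis by auto
qed

text \<open>Telescoping: by the mean value theorem each summand is at most the increment of
  \<open>m powr (1 - \<rho>) / (1 - \<rho>)\<close> that ends at it.\<close>

lemma sum_powr_le:
  assumes "0 < \<rho>" "\<rho> < 1"
  shows "(\<Sum>m=1..n. real m powr (- \<rho>)) \<le> real n powr (1 - \<rho>) / (1 - \<rho>)"
proof (induction n)
  case (Suc n)
  have "(1 - \<rho>) * real (Suc n) powr (- \<rho>) \<le> real (Suc n) powr (1 - \<rho>) - real n powr (1 - \<rho>)"
  proof (cases "n = 0")
    case False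
    then obtain z where z: "real n < z" "z < real n + 1"
      "(real n + 1) powr (1 - \<rho>) - real n powr (1 - \<rho>) = (1 - \<rho>) * z powr (- \<rho>)"
      using powr_diff_Suc[of n "1 - \<rho>"] by auto
    have "(real n + 1) powr (- \<rho>) \<le> z powr (- \<rho>)"
      using z assms by (intro powr_mono2') auto
    then show ?thesis using z(3) assms by (simp add: add.commute)
  qed (use assms in auto)
  then have "real (Suc n) powr (- \<rho>) \<le> (real (Suc n) powr (1 - \<rho>) - real n powr (1 - \<rho>)) / (1 - \<rho>)"
    using assms by (simp add: field_simps)
  with Suc.IH show ?case by (simp add: diff_divide_distrib)
qed auto

text \<open>Telescoping with the decreasing primitive; discarding its value at the far end makes the
  bound uniform in \<open>N\<close>.\<close>

lemma sum_powr_tail_le: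
  assumes "\<theta> > 1" "n \<ge> (1::nat)"
  shows "(\<Sum>m=n+1..N. real m powr (- \<theta>)) \<le> real n powr (1 - \<theta>) / (\<theta> - 1)"
proof -
  have "(\<Sum>m=n+1..n+k. real m powr (- \<theta>)) \<le> (real n powr (1 - \<theta>) - real (n + k) powr (1 - \<theta>)) / (\<theta> - 1)" for k
  proof (induction k)
    case (Suc k)
    obtain z where z: "real (n+k) < z" "z < real (n+k) + 1"
      "(real (n+k) + 1) powr (1 - \<theta>) - real (n+k) powr (1 - \<theta>) = (1 - \<theta>) * z powr (- \<theta>)"
      using powr_diff_Suc[of "n+k" "1 - \<theta>"] assms by auto
    have "(real (n+k) + 1) powr (- \<theta>) \<le> z powr (- \<theta>)"
      using z assms by (intro powr_mono2') auto
    then have "(\<theta> - 1) * (real (n+k) + 1) powr (- \<theta>) \<le> (\<theta> - 1) * z powr (- \<theta>)"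
      using assms by (intro mult_left_mono) auto
    then have "real (n + Suc k) powr (- \<theta>) \<le> (real (n+k) powr (1 - \<theta>) - real (n + Suc k) powr (1 - \<theta>)) / (\<theta> - 1)"
      using z(3) assms by (simp add: field_simps)
    with Suc.IH show ?case by (simp add: diff_divide_distrib)
  qed auto
  from this[of "N - n"] have *: "(\<Sum>m=n+1..n+(N-n). real m powr (- \<theta>)) \<le> real n powr (1 - \<theta>) / (\<theta> - 1)"
    using assms by (smt (verit) divide_right_mono powr_ge_zero)
  show ?thesis
  proof (cases "n \<le> N")
    case False
    then have "{n+1..N} = {}" by auto
    then have "(\<Sum>m=n+1..N. real m powr (- \<theta>)) = 0" by (simp only: sum.empty)
    then show ?thesis using assms by (simp del: sum.cl_ivl_Suc)
  qed (use * in simp)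
qed

text \<open>Regular variation enters only through these Potter bounds. The exponent
  \<open>\<rho> < 1\<close> lets a block of \<open>n\<close> coefficients sum to order
  \<open>n * \<alpha> n\<close>; the exponent \<open>\<theta> > 1 / 2\<close> makes the squares
  summable. \<open>\<alpha>\<close> is indexed from 1, in accordance with
  \<open>l (i + 1) * (1 + i) powr (- r)\<close>.\<close>

locale regular_coeffs =
  fixes \<alpha> :: "nat \<Rightarrow> real" and C \<rho> \<theta> :: real and a :: "int \<Rightarrow> real"
  assumes C: "C \<ge> 1" and rho: "0 < \<rho>" "\<rho> < 1" and theta: "\<theta> > 1 / 2"
    and pos: "\<And>m. m \<ge> 1 \<Longrightarrow> \<alpha> m > 0"
    and up: "\<And>m n. 1 \<le> m \<Longrightarrow> m \<le> n \<Longrightarrow> \<alpha> m \<le> C * (n / m) powr \<rho> * \<alpha> n"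
    and down: "\<And>m n. 1 \<le> m \<Longrightarrow> m \<le> n \<Longrightarrow> \<alpha> n \<le> C * (m / n) powr \<theta> * \<alpha> m"
    and a_neg: "\<And>i. i < 0 \<Longrightarrow> a i = 0" and a_nn: "\<And>i. i \<ge> 0 \<Longrightarrow> a i = \<alpha> (nat (i + 1))"
begin

lemma summable_a_square: "summable (\<lambda>m. (a (int m))\<^sup>2)"
proof (rule summable_comparison_test)
  show "summable (\<lambda>m. (C * \<alpha> 1)\<^sup>2 * real (Suc m) powr (- 2 * \<theta>))"
    using theta by (intro summable_mult) (simp add: summable_Suc_iff[of "\<lambda>m. real m powr (- 2 * \<theta>)", simplified] summable_real_powr_iff)
  have "norm ((a (int m))\<^sup>2) \<le> (C * \<alpha> 1)\<^sup>2 * real (Suc m) powr (- 2 * \<theta>)" for m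
  proof -
    have am: "a (int m) = \<alpha> (Suc m)" by (simp add: a_nn nat_add_distrib)
    have "a (int m) \<le> C * (1 / real (Suc m)) powr \<theta> * \<alpha> 1"
      using down[of 1 "Suc m"] am by simp
    then have "(a (int m))\<^sup>2 \<le> (C * (1 / real (Suc m)) powr \<theta> * \<alpha> 1)\<^sup>2"
      using am pos[of "Suc m"] by (intro power_mono) auto
    also have "\<dots> = (C * \<alpha> 1)\<^sup>2 * ((1 / real (Suc m)) powr \<theta>)\<^sup>2" by (simp add: power_mult_distrib)
    also have "((1 / real (Suc m)) powr \<theta>)\<^sup>2 = real (Suc m) powr (- 2 * \<theta>)"
      by (simp add: powr_divide powr_power power_divide powr_minus_divide mult.commute)
    finally show ?thesis by simp
  qed
  then show "\<exists>N. \<forall>n\<ge>N. norm ((a (int n))\<^sup>2) \<le> (C * \<alpha> 1)\<^sup>2 * real (Suc n) powr (- 2 * \<theta>)" by blast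
qed

lemma a_nonneg: "a i \<ge> 0"
  by (cases "i < 0") (auto simp: a_neg a_nn intro!: less_imp_le[OF pos])

definition K1 where "K1 = C + C / (1 - \<rho>)"

lemma K1_pos: "K1 \<ge> 1" using C rho by (auto simp: K1_def intro: add_increasing2)

lemma coeff_b_nonneg: "coeff_b a n i \<ge> 0"
  unfolding coeff_b_def by (auto intro!: sum_nonneg a_nonneg)

text \<open>Of the \<open>n\<close> coefficients in a block, the zero ones and those with lag at
  least \<open>n\<close> are bounded by \<open>C * \<alpha> n\<close> each. The others, collected in
  \<open>S\<close>, are at most \<open>C * (n / m) powr \<rho> * \<alpha> n\<close> with distinct
  \<open>m \<le> n\<close>, and add up to at most \<open>C * n * \<alpha> n / (1 - \<rho>)\<close>.
  These are the two terms of \<open>K1\<close>.\<close>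

lemma coeff_b_le:
  assumes n: "n \<ge> 1"
  shows "coeff_b a n i \<le> K1 * real n * \<alpha> n"
proof -
  define S where "S = {k\<in>{1..n}. 0 \<le> int k - i \<and> int k - i < int n}"
  define g where "g k = nat (int k - i + 1)" for k
  have "a (int k - i) \<le> C * \<alpha> n + (if k \<in> S then C * \<alpha> n * real n powr \<rho> * real (g k) powr (- \<rho>) else 0)"
    if "k \<in> {1..n}" for k
  proof -
    have an: "\<alpha> n > 0" using pos n by auto
    consider "int k - i < 0" | "k \<in> S" | "int k - i \<ge> int n" using \<open>k \<in> {1..n}\<close> unfolding S_def by force
    then show ?thesis
    proof cases
      case 1 then show ?thesis using C an by (auto simp: a_neg S_def)
    next
      case 2
      then have "a (int k - i) \<le> C * (n / g k) powr \<rho> * \<alpha> n"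
        using up[of "g k" n] by (auto simp: S_def g_def a_nn)
      also have "(n / g k) powr \<rho> = real n powr \<rho> * real (g k) powr (- \<rho>)"
        by (simp add: powr_divide powr_minus_divide)
      finally show ?thesis using 2 C an by (simp add: mult_ac add_increasing)
    next
      case 3
      then have "a (int k - i) \<le> C * (n / g k) powr \<theta> * \<alpha> n"
        using down[of n "g k"] n by (simp add: g_def a_nn)
      also have "(n / g k) powr \<theta> \<le> 1"
        using 3 theta by (intro powr_le1) (auto simp: g_def)
      then have "C * (n / g k) powr \<theta> * \<alpha> n \<le> C * 1 * \<alpha> n"
        using C an by (intro mult_right_mono mult_left_mono) auto
      finally show ?thesis using 3 by (auto simp: S_def)
    qed
  qed
  then have "coeff_b a n i \<le> (\<Sum>k=1..n. C * \<alpha> n + (if k \<in> S then C * \<alpha> n * real n powr \<rho> * real (g k) powr (- \<rho>) else 0))"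
    unfolding coeff_b_def by (intro sum_mono)
  also have "\<dots> = real n * (C * \<alpha> n) + (\<Sum>k\<in>S. C * \<alpha> n * real n powr \<rho> * real (g k) powr (- \<rho>))"
  proof -
    have "{1..n} \<inter> S = S" by (auto simp: S_def)
    then show ?thesis by (simp add: sum.distrib sum.inter_restrict[symmetric])
  qed
  also have "(\<Sum>k\<in>S. C * \<alpha> n * real n powr \<rho> * real (g k) powr (- \<rho>)) = C * \<alpha> n * real n powr \<rho> * (\<Sum>k\<in>S. real (g k) powr (- \<rho>))"
    by (simp add: sum_distrib_left)
  also have "(\<Sum>k\<in>S. real (g k) powr (- \<rho>)) = (\<Sum>m\<in>g`S. real m powr (- \<rho>))"
    by (subst sum.reindex) (auto simp: g_def S_def inj_on_def)
  also have "\<dots> \<le> (\<Sum>m=1..n. real m powr (- \<rho>))"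
    by (intro sum_mono2) (auto simp: g_def S_def)
  also have "\<dots> \<le> real n powr (1 - \<rho>) / (1 - \<rho>)" by (rule sum_powr_le[OF rho])
  finally have "coeff_b a n i \<le> real n * (C * \<alpha> n) + C * \<alpha> n * real n powr \<rho> * (real n powr (1 - \<rho>) / (1 - \<rho>))"
    using C pos[of n] n by (simp add: mult_left_mono)
  also have "real n powr \<rho> * (real n powr (1 - \<rho>) / (1 - \<rho>)) = real n / (1 - \<rho>)"
    using n by (simp add: powr_add[symmetric])
  then have "C * \<alpha> n * real n powr \<rho> * (real n powr (1 - \<rho>) / (1 - \<rho>)) = C * \<alpha> n * (real n / (1 - \<rho>))"
    by (simp only: mult.assoc)
  finally show ?thesis by (simp add: K1_def algebra_simps)
qed

text \<open>For these \<open>i\<close> every index \<open>m = k - i + 1\<close> lies between 1 and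
  \<open>2 * n + 1 \<le> 3 * n\<close>. Beyond \<open>n\<close> the loss is
  \<open>(m / n) powr \<rho> \<le> m / n \<le> 3\<close>; up to \<open>n\<close> it is only the
  constant \<open>C\<close>.\<close>

lemma coeff_b_ge:
  assumes n: "n \<ge> 1" and i: "- int n \<le> i" "i \<le> 0"
  shows "coeff_b a n i \<ge> real n * \<alpha> n / (3 * C)"
proof -
  have "a (int k - i) \<ge> \<alpha> n / (3 * C)" if k: "k \<in> {1..n}" for k
  proof -
    define m where "m = nat (int k - i + 1)"
    have m: "1 \<le> m" "m \<le> 3 * n" and am: "a (int k - i) = \<alpha> m" using k i by (auto simp: m_def a_nn)
    have ap: "\<alpha> m > 0" using pos m by auto
    have "\<alpha> n \<le> 3 * C * \<alpha> m"
    proof (cases "m \<le> n")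
      case True
      have "(m / n) powr \<theta> \<le> 1" using True n theta by (intro powr_le1) auto
      then have "C * (m / n) powr \<theta> * \<alpha> m \<le> 3 * C * \<alpha> m"
        using C ap by (intro mult_right_mono) (auto simp: mult_left_le)
      with down[of m n] True m show ?thesis by linarith
    next
      case False
      have "(m / n) powr \<rho> \<le> (m / n) powr 1" using False n rho by (intro powr_mono) auto
      also have "\<dots> \<le> 3" using False n m by (auto simp: field_simps)
      finally have "C * (m / n) powr \<rho> * \<alpha> m \<le> C * 3 * \<alpha> m"
        using C ap by (intro mult_right_mono mult_left_mono) auto
      with up[of n m] False n show ?thesis by (simp add: mult_ac)
    qed
    then show ?thesis using C am by (simp add: field_simps)
  qed
  then have "(\<Sum>k=1..n. \<alpha> n / (3 * C)) \<le> coeff_b a n i" unfolding coeff_b_def by (intro sum_mono)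
  then show ?thesis by simp
qed

lemma coeff_b_tail_le:
  assumes n: "n \<ge> 1" and j: "j \<ge> n"
  shows "coeff_b a n (- int j) \<le> real n * \<alpha> n * C * (n / j) powr \<theta>"
proof -
  have "a (int k - (- int j)) \<le> \<alpha> n * C * (n / j) powr \<theta>" if k: "k \<in> {1..n}" for k
  proof -
    have "a (int k - (- int j)) = \<alpha> (k + j + 1)" by (simp add: a_nn nat_add_distrib)
    also have "\<dots> \<le> C * (n / real (k + j + 1)) powr \<theta> * \<alpha> n" using j n by (intro down) auto
    also have "\<dots> \<le> C * (n / j) powr \<theta> * \<alpha> n"
      using C pos[OF n] theta n j by (intro mult_right_mono mult_left_mono powr_mono2 divide_left_mono) auto
    finally show ?thesis by (simp add: mult_ac)
  qed
  then have "coeff_b a n (- int j) \<le> (\<Sum>k=1..n. \<alpha> n * C * (n / j) powr \<theta>)"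
    unfolding coeff_b_def by (intro sum_mono)
  then show ?thesis by (simp add: mult_ac)
qed

text \<open>The \<open>2 * n + 1 \<le> 3 * n\<close> indices between \<open>- n\<close> and
  \<open>n\<close> are covered by the uniform bound. Further left the block sums decay like
  \<open>(n / j) powr \<theta>\<close>, with summable squares because
  \<open>2 * \<theta> > 1\<close>. Both parts have the same order in \<open>n\<close>.\<close>

lemma sum_coeff_b_square_le:
  assumes n: "n \<ge> 1" and F: "finite F" "F \<subseteq> {..int n}"
  shows "(\<Sum>i\<in>F. (coeff_b a n i)\<^sup>2) \<le> (3 * K1\<^sup>2 + C\<^sup>2 / (2 * \<theta> - 1)) * real n ^ 3 * (\<alpha> n)\<^sup>2"
proof -
  have an: "\<alpha> n > 0" using pos n by auto
  define F1 where "F1 = F \<inter> {- int n..int n}"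
  define F2 where "F2 = F \<inter> {..- int n - 1}"
  have F12: "F = F1 \<union> F2" "F1 \<inter> F2 = {}" "finite F1" "finite F2" using F by (auto simp: F1_def F2_def)
  have "(\<Sum>i\<in>F1. (coeff_b a n i)\<^sup>2) \<le> (\<Sum>i\<in>F1. (K1 * real n * \<alpha> n)\<^sup>2)"
    by (intro sum_mono power_mono coeff_b_le[OF n] coeff_b_nonneg)
  also have "\<dots> \<le> (\<Sum>i\<in>{- int n..int n}. (K1 * real n * \<alpha> n)\<^sup>2)"
    by (intro sum_mono2) (auto simp: F1_def)
  also have "\<dots> = real (2 * n + 1) * (K1 * real n * \<alpha> n)\<^sup>2" by (simp add: nat_add_distrib)
  also have "\<dots> \<le> real (3 * n) * (K1 * real n * \<alpha> n)\<^sup>2" using n by (intro mult_right_mono) auto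
  finally have 1: "(\<Sum>i\<in>F1. (coeff_b a n i)\<^sup>2) \<le> real (3 * n) * (K1 * real n * \<alpha> n)\<^sup>2" .
  define F3 where "F3 = (\<lambda>i. nat (- i)) ` (F2)"
  obtain N where N: "F3 \<subseteq> {..N}" using F12(4) unfolding F3_def by (meson finite_imageI finite_nat_set_iff_bounded_le subset_eq atMost_iff)
  have F3: "F3 \<subseteq> {n+1..N}" using N unfolding F3_def F2_def by auto
  have "(\<Sum>i\<in>F2. (coeff_b a n i)\<^sup>2) = (\<Sum>j\<in>F3. (coeff_b a n (- int j))\<^sup>2)"
    unfolding F3_def by (subst sum.reindex) (auto simp: inj_on_def F2_def intro!: sum.cong)
  also have "\<dots> \<le> (\<Sum>j=n+1..N. (real n * \<alpha> n * C)\<^sup>2 * (real n powr (2 * \<theta>) * real j powr (- (2 * \<theta>))))"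
  proof -
    have "(coeff_b a n (- int j))\<^sup>2 \<le> (real n * \<alpha> n * C)\<^sup>2 * (real n powr (2 * \<theta>) * real j powr (- (2 * \<theta>)))"
      if jn: "j \<in> {n+1..N}" for j
    proof -
      have "(coeff_b a n (- int j))\<^sup>2 \<le> (real n * \<alpha> n * C * (n / j) powr \<theta>)\<^sup>2"
        using jn n by (intro power_mono coeff_b_tail_le coeff_b_nonneg) auto
      also have "\<dots> = (real n * \<alpha> n * C)\<^sup>2 * ((n / j) powr \<theta>)\<^sup>2" by (simp add: power_mult_distrib)
      also have "((n / j) powr \<theta>)\<^sup>2 = (n / j) powr (2 * \<theta>)" using n jn
        by (simp add: power2_eq_square powr_add[symmetric])
      also have "\<dots> = real n powr (2 * \<theta>) * real j powr (- (2 * \<theta>))"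
        by (simp add: powr_divide powr_minus_divide)
      finally show ?thesis .
    qed
    then have "(\<Sum>j=n+1..N. (coeff_b a n (- int j))\<^sup>2) \<le>
       (\<Sum>j=n+1..N. (real n * \<alpha> n * C)\<^sup>2 * (real n powr (2 * \<theta>) * real j powr (- (2 * \<theta>))))"
      by (rule sum_mono)
    moreover have "(\<Sum>j\<in>F3. (coeff_b a n (- int j))\<^sup>2) \<le> (\<Sum>j=n+1..N. (coeff_b a n (- int j))\<^sup>2)"
      using F3 by (intro sum_mono2) auto
    ultimately show ?thesis by linarith
  qed
  also have "\<dots> = (real n * \<alpha> n * C)\<^sup>2 * real n powr (2 * \<theta>) * (\<Sum>j=n+1..N. real j powr (- (2 * \<theta>)))"
    by (simp add: sum_distrib_left mult.assoc)
  also have "\<dots> \<le> (real n * \<alpha> n * C)\<^sup>2 * real n powr (2 * \<theta>) * (real n powr (1 - 2 * \<theta>) / (2 * \<theta> - 1))"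
    using theta n by (intro mult_left_mono sum_powr_tail_le) auto
  also have "\<dots> = (real n * \<alpha> n * C)\<^sup>2 * (real n powr (2 * \<theta>) * real n powr (1 - 2 * \<theta>)) / (2 * \<theta> - 1)"
    by simp
  also have "real n powr (2 * \<theta>) * real n powr (1 - 2 * \<theta>) = real n" using n by (simp add: powr_add[symmetric])
  finally have 2: "(\<Sum>i\<in>F2. (coeff_b a n i)\<^sup>2) \<le> (real n * \<alpha> n * C)\<^sup>2 * real n / (2 * \<theta> - 1)" .
  have "(\<Sum>i\<in>F. (coeff_b a n i)\<^sup>2) = (\<Sum>i\<in>F1. (coeff_b a n i)\<^sup>2) + (\<Sum>i\<in>F2. (coeff_b a n i)\<^sup>2)"
    using F12 by (metis sum.union_disjoint)
  also have "\<dots> \<le> real (3 * n) * (K1 * real n * \<alpha> n)\<^sup>2 + (real n * \<alpha> n * C)\<^sup>2 * real n / (2 * \<theta> - 1)"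
    using 1 2 by (rule add_mono)
  also have "\<dots> = (3 * K1\<^sup>2 + C\<^sup>2 / (2 * \<theta> - 1)) * real n ^ 3 * (\<alpha> n)\<^sup>2"
    by (simp add: distrib_right distrib_left power_mult_distrib power2_eq_square power3_eq_cube mult_ac)
  finally show ?thesis .
qed

text \<open>The sum of squares is of exact order \<open>n ^ 3 * (\<alpha> n)\<^sup>2\<close>, while
  a block sum is at most, and for indices in \<open>{- int n..0}\<close> also at least, a constant
  multiple of \<open>n * \<alpha> n\<close>. The quotient is thus of order
  \<open>n powr (-1/2)\<close>.\<close>

lemma normalised_coeff_b:
  "\<exists>K\<ge>1. \<forall>n\<ge>1. (\<lambda>i. (coeff_b a n i)\<^sup>2) summable_on {..int n} \<and>
     (\<Sum>\<^sub>\<infinity>i\<in>{..int n}. (coeff_b a n i)\<^sup>2) > 0 \<and>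
     (\<forall>i. sqrt (real n) * coeff_b a n i \<le> K * sqrt (\<Sum>\<^sub>\<infinity>i\<in>{..int n}. (coeff_b a n i)\<^sup>2)) \<and>
     (\<forall>i\<in>{- int n..0}. sqrt (\<Sum>\<^sub>\<infinity>i\<in>{..int n}. (coeff_b a n i)\<^sup>2) \<le> K * (sqrt (real n) * coeff_b a n i))"
proof -
  define K2 where "K2 = 3 * K1\<^sup>2 + C\<^sup>2 / (2 * \<theta> - 1)"
  define K where "K = max 1 (max (K1 * (3 * C)) (sqrt K2 * (3 * C)))"
  have K2: "K2 \<ge> 0" using theta by (simp add: K2_def)
  have K: "K \<ge> 1" "K1 * (3 * C) \<le> K" "sqrt K2 * (3 * C) \<le> K" by (auto simp: K_def)
  show ?thesis
  proof (rule exI[of _ K], intro conjI allI impI ballI K(1))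
    fix n :: nat assume n: "1 \<le> n"
    let ?b = "\<lambda>i. (coeff_b a n i)\<^sup>2"
    let ?B = "\<Sum>\<^sub>\<infinity>i\<in>{..int n}. ?b i"
    have an: "\<alpha> n > 0" using pos n by auto
    show sm: "?b summable_on {..int n}"
      using sum_coeff_b_square_le[OF n]
      by (intro nonneg_bdd_above_summable_on bdd_aboveI2[where M="K2 * real n ^ 3 * (\<alpha> n)\<^sup>2"])
         (auto simp: K2_def)
    have up: "?B \<le> K2 * real n ^ 3 * (\<alpha> n)\<^sup>2"
      using sum_coeff_b_square_le[OF n] by (intro infsum_le_finite_sums[OF sm]) (auto simp: K2_def)
    \<comment> \<open>The half-open range \<open>{- int n<..0}\<close> has exactly \<open>n\<close>
      elements, each subject to the lower bound for block sums.\<close>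
    have "real n * (real n * \<alpha> n / (3 * C))\<^sup>2 \<le> (\<Sum>i\<in>{- int n<..0}. (real n * \<alpha> n / (3 * C))\<^sup>2)" by simp
    also have "\<dots> \<le> (\<Sum>i\<in>{- int n<..0}. ?b i)"
      using C an n by (intro sum_mono power_mono coeff_b_ge) auto
    also have "\<dots> \<le> ?B" by (intro finite_sum_le_infsum sm) auto
    finally have lo: "real n * (real n * \<alpha> n / (3 * C))\<^sup>2 \<le> ?B" .
    moreover have "real n * (real n * \<alpha> n / (3 * C))\<^sup>2 > 0" using n an C by simp
    ultimately show "?B > 0" by linarith
    have "sqrt (real n * (real n * \<alpha> n / (3 * C))\<^sup>2) \<le> sqrt ?B" using lo by (rule real_sqrt_le_mono)
    also have "sqrt (real n * (real n * \<alpha> n / (3 * C))\<^sup>2) = sqrt (real n) * (real n * \<alpha> n) / (3 * C)"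
      using n an C by (simp add: real_sqrt_mult)
    finally have lo': "sqrt (real n) * (real n * \<alpha> n) \<le> 3 * C * sqrt ?B"
      using C by (simp add: field_simps)
    have "sqrt ?B \<le> sqrt (K2 * real n ^ 3 * (\<alpha> n)\<^sup>2)" using up by (rule real_sqrt_le_mono)
    also have "K2 * real n ^ 3 * (\<alpha> n)\<^sup>2 = K2 * (real n * (real n * \<alpha> n)\<^sup>2)"
      by (simp add: power2_eq_square power3_eq_cube mult_ac)
    also have "sqrt \<dots> = sqrt K2 * (sqrt (real n) * (real n * \<alpha> n))"
      using an by (simp add: real_sqrt_mult)
    finally have up': "sqrt ?B \<le> sqrt K2 * (sqrt (real n) * (real n * \<alpha> n))" .
    fix i
    have "sqrt (real n) * coeff_b a n i \<le> K1 * (sqrt (real n) * (real n * \<alpha> n))"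
      using mult_left_mono[OF coeff_b_le[OF n, of i], of "sqrt (real n)"] by (simp add: mult_ac)
    also have "\<dots> \<le> K1 * (3 * C * sqrt ?B)" using lo' K1_pos by (intro mult_left_mono) auto
    also have "\<dots> \<le> K * sqrt ?B"
      using mult_right_mono[OF K(2), of "sqrt ?B"] \<open>?B > 0\<close> by (simp add: mult_ac)
    finally show "sqrt (real n) * coeff_b a n i \<le> K * sqrt ?B" .
    assume i: "i \<in> {- int n..0}"
    have "real n * \<alpha> n \<le> 3 * C * coeff_b a n i"
      using coeff_b_ge[OF n, of i] i C by (simp add: field_simps)
    then have "sqrt K2 * (sqrt (real n) * (real n * \<alpha> n)) \<le> sqrt K2 * (sqrt (real n) * (3 * C * coeff_b a n i))"
      using K2 by (intro mult_left_mono) auto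
    also have "\<dots> \<le> K * (sqrt (real n) * coeff_b a n i)"
      using mult_right_mono[OF K(3), of "sqrt (real n) * coeff_b a n i"] coeff_b_nonneg
      by (simp add: mult_ac)
    finally show "sqrt ?B \<le> K * (sqrt (real n) * coeff_b a n i)" using up' by linarith
  qed
qed

end

text \<open>\<open>\<eta>\<close> uses at most half of the distance from \<open>r\<close> to 1 and
  to 1/2: \<open>r + \<eta> \<le> (1 + r) / 2 < 1\<close> and
  \<open>r - \<eta> \<ge> (r + 1 / 2) / 2 > 1 / 2\<close>, so the slowly varying factor cannot spoil
  either exponent.\<close>

lemma regular_coeffs_coeff_a:
  assumes l: "slowly_varying l" and pos: "\<And>x. x > 0 \<Longrightarrow> l x > 0" and r: "1 / 2 < r" "r < 1"
  obtains C where "regular_coeffs (\<lambda>m. l m * m powr (- r)) C ((1 + r) / 2) ((r + 1 / 2) / 2) (coeff_a l r)"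
proof -
  define \<eta> where "\<eta> = min ((1 - r) / 2) ((r - 1 / 2) / 2)"
  have eta: "\<eta> > 0" "\<eta> \<le> (1 - r) / 2" "\<eta> \<le> (r - 1 / 2) / 2" using r unfolding \<eta>_def by (auto simp: min_def)
  obtain C where C: "C \<ge> 1" and
    bnd: "\<And>m n. 1 \<le> m \<Longrightarrow> m \<le> n \<Longrightarrow> l (real n) \<le> C * (real n / real m) powr \<eta> * l (real m)"
    "\<And>m n. 1 \<le> m \<Longrightarrow> m \<le> n \<Longrightarrow> l (real m) \<le> C * (real n / real m) powr \<eta> * l (real n)"
    using potter_bounds_nat[OF l pos eta(1)] by blast
  have "regular_coeffs (\<lambda>m. l m * m powr (- r)) C ((1 + r) / 2) ((r + 1 / 2) / 2) (coeff_a l r)"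
  proof
    show "C \<ge> 1" by (rule C)
    show "0 < (1 + r) / 2" "(1 + r) / 2 < 1" "1 / 2 < (r + 1 / 2) / 2" using r by auto
    show "0 < l m * m powr (- r)" if "m \<ge> 1" for m :: nat using that by (auto intro!: mult_pos_pos pos)
    show "coeff_a l r i = 0" if "i < 0" for i using that by (simp add: coeff_a_def)
    show "coeff_a l r i = l (nat (i + 1)) * nat (i + 1) powr (- r)" if "i \<ge> 0" for i
      using that by (simp add: coeff_a_def of_nat_nat add.commute)
    fix m n :: nat assume mn: "1 \<le> m" "m \<le> n"
    have q: "real n / real m \<ge> 1" using mn by auto
    have lp: "l m > 0" "l n > 0" using mn by (auto intro!: pos)
    have mr: "real m powr (- r) = (n / m) powr r * real n powr (- r)"
      using mn by (simp add: powr_divide powr_minus_divide)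
    have "l m * m powr (- r) \<le> (C * (n / m) powr \<eta> * l n) * ((n / m) powr r * real n powr (- r))"
      unfolding mr using bnd(2)[OF mn] by (intro mult_right_mono) auto
    also have "\<dots> = C * ((n / m) powr (\<eta> + r)) * (l n * real n powr (- r))"
      by (simp add: powr_add mult_ac)
    also have "\<dots> \<le> C * ((n / m) powr ((1 + r) / 2)) * (l n * real n powr (- r))"
      using C lp q eta by (intro mult_right_mono mult_left_mono powr_mono) auto
    finally show "l m * m powr (- r) \<le> C * (n / m) powr ((1 + r) / 2) * (l n * n powr (- r))" .
    have nr: "real n powr (- r) = (n / m) powr (- r) * real m powr (- r)"
      using mn by (simp add: powr_divide powr_minus_divide)
    have "l n * n powr (- r) \<le> (C * (n / m) powr \<eta> * l m) * ((n / m) powr (- r) * real m powr (- r))"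
      unfolding nr using bnd(1)[OF mn] by (intro mult_right_mono) auto
    also have "\<dots> = C * ((n / m) powr (\<eta> - r)) * (l m * real m powr (- r))"
      by (simp add: powr_diff powr_minus_divide mult_ac)
    also have "\<eta> - r \<le> - ((r + 1 / 2) / 2)" using eta(3) by (simp add: field_simps)
    then have "C * ((n / m) powr (\<eta> - r)) * (l m * real m powr (- r)) \<le>
        C * ((n / m) powr (- ((r + 1 / 2) / 2))) * (l m * real m powr (- r))"
      using C lp q by (intro mult_right_mono mult_left_mono powr_mono) auto
    also have "(n / m) powr (- ((r + 1 / 2) / 2)) = (m / n) powr ((r + 1 / 2) / 2)"
      using mn by (simp add: powr_minus powr_divide)
    finally show "l n * n powr (- r) \<le> C * (m / n) powr ((r + 1 / 2) / 2) * (l m * m powr (- r))" .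
  qed
  then show ?thesis by (rule that)
qed

section \<open>Almost sure convergence of the linear process\<close>

text \<open>The common law \<open>\<mu>\<close> is a parameter so that moment bounds become
  integrals over the line, independent of the index and of the underlying space.\<close>

locale iid_std = prob_space M for M :: "'a measure" +
  fixes X :: "'i \<Rightarrow> 'a \<Rightarrow> real" and \<mu> :: "real measure"
  assumes indep: "indep_vars (\<lambda>_. borel) X UNIV"
    and law: "\<And>i. distr M borel (X i) = \<mu>"
    and sq_integrable: "integrable \<mu> (\<lambda>x. x\<^sup>2)"
    and mean: "(LINT x|\<mu>. x) = 0"
    and var: "(LINT x|\<mu>. x\<^sup>2) = 1"
begin

lemma rv[measurable]: "X i \<in> borel_measurable M"
  using indep by (auto simp: indep_vars_def)

lemma sets_mu[measurable_cong]: "sets \<mu> = sets borel"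
  unfolding law[of undefined, symmetric] by simp

lemma prob_space_mu: "prob_space \<mu>"
  unfolding law[of undefined, symmetric] by (rule prob_space_distr) simp

sublocale mu: prob_space \<mu> by (rule prob_space_mu)

lemma expectation_law:
  fixes f :: "real \<Rightarrow> real"
  assumes [measurable]: "f \<in> borel_measurable borel"
  shows "(LINT \<omega>|M. f (X i \<omega>)) = (LINT x|\<mu>. f x)"
  unfolding law[of i, symmetric] by (subst integral_distr) auto

lemma integrable_law:
  fixes f :: "real \<Rightarrow> real"
  assumes [measurable]: "f \<in> borel_measurable borel"
  shows "integrable M (\<lambda>\<omega>. f (X i \<omega>)) \<longleftrightarrow> integrable \<mu> f"
  unfolding law[of i, symmetric] by (subst integrable_distr_eq) auto

lemma prob_law:
  assumes "A \<in> sets borel"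
  shows "\<P>(\<omega> in M. X i \<omega> \<in> A) = measure \<mu> A"
  unfolding law[of i, symmetric] using assms
  by (subst measure_distr) (auto intro!: arg_cong[where f=prob])

lemma integrable_id: "integrable \<mu> (\<lambda>x. x)"
  by (rule mu.square_integrable_imp_integrable[OF _ sq_integrable]) simp

lemma X_moments:
  shows "integrable M (X j)" "expectation (X j) = 0"
    "integrable M (\<lambda>\<omega>. (X j \<omega>)\<^sup>2)" "expectation (\<lambda>\<omega>. (X j \<omega>)\<^sup>2) = 1"
proof -
  show "integrable M (X j)" by (subst integrable_law) (simp_all add: integrable_id)
  show "expectation (X j) = 0" by (subst expectation_law) (simp_all add: mean)
  show "integrable M (\<lambda>\<omega>. (X j \<omega>)\<^sup>2)" by (subst integrable_law) (simp_all add: sq_integrable)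
  show "expectation (\<lambda>\<omega>. (X j \<omega>)\<^sup>2) = 1" by (subst expectation_law) (simp_all add: var)
qed

definition S :: "('i \<Rightarrow> real) \<Rightarrow> 'i set \<Rightarrow> 'a \<Rightarrow> real" where
  "S c F \<omega> = (\<Sum>i\<in>F. c i * X i \<omega>)"

lemma S_measurable[measurable]: "S c F \<in> borel_measurable M"
  unfolding S_def by measurable

lemma indep_term_sum:
  assumes F: "finite F" "j \<notin> F" and f: "\<And>i. f i \<in> borel_measurable borel"
  shows "indep_var borel (\<lambda>\<omega>. f j (X j \<omega>) :: real) borel (\<lambda>\<omega>. \<Sum>i\<in>F. f i (X i \<omega>))"
  by (rule indep_vars_sum[OF F, of "\<lambda>i \<omega>. f i (X i \<omega>)"])
     (rule indep_vars_compose2[OF indep_vars_subset[OF indep]], use f in auto)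

lemma S_moments:
  assumes "finite F"
  shows "integrable M (S c F)" "integrable M (\<lambda>\<omega>. (S c F \<omega>)\<^sup>2)"
    "expectation (S c F) = 0" "expectation (\<lambda>\<omega>. (S c F \<omega>)\<^sup>2) = (\<Sum>i\<in>F. (c i)\<^sup>2)"
  using assms
proof (induction F)
  case empty
  { case 1 show ?case by (simp add: S_def[abs_def]) next
    case 2 show ?case by (simp add: S_def[abs_def]) next
    case 3 show ?case by (simp add: S_def[abs_def]) next
    case 4 show ?case by (simp add: S_def[abs_def]) }
next
  case (insert j F)
  have S: "S c (insert j F) = (\<lambda>\<omega>. c j * X j \<omega> + S c F \<omega>)"
    using insert by (auto simp: S_def)
  have X: "integrable M (X j)" "expectation (X j) = 0"
    "integrable M (\<lambda>\<omega>. (X j \<omega>)\<^sup>2)" "expectation (\<lambda>\<omega>. (X j \<omega>)\<^sup>2) = 1"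
    by (rule X_moments)+
  have ind: "indep_var borel (\<lambda>\<omega>. c j * X j \<omega>) borel (S c F)"
    unfolding S_def[abs_def] using insert by (intro indep_term_sum[where f="\<lambda>i x. c i * x"]) auto
  have i: "integrable M (\<lambda>\<omega>. (c j * X j \<omega>) * S c F \<omega>)"
    and e: "expectation (\<lambda>\<omega>. (c j * X j \<omega>) * S c F \<omega>) = 0"
    using indep_var_integrable[OF ind] indep_var_lebesgue_integral[OF ind] insert X by auto
  have sq: "(S c (insert j F) \<omega>)\<^sup>2 = (c j)\<^sup>2 * (X j \<omega>)\<^sup>2 + 2 * ((c j * X j \<omega>) * S c F \<omega>) + (S c F \<omega>)\<^sup>2" for \<omega>
    unfolding S by (simp add: power2_eq_square algebra_simps)
  { case 1 show ?case unfolding S using insert X by auto next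
    case 2 show ?case unfolding sq using insert X i by auto next
    case 3 show ?case unfolding S using insert X by auto next
    case 4 show ?case unfolding sq using insert X i e by auto }
qed

lemma S_chebyshev:
  assumes F: "finite F" and a: "a > 0"
  shows "\<P>(\<omega> in M. \<bar>S c F \<omega>\<bar> \<ge> a) \<le> (\<Sum>i\<in>F. (c i)\<^sup>2) / a\<^sup>2"
  using Chebyshev_inequality[of "S c F" a] S_moments[OF F, of c] a by simp

lemma S_diff:
  assumes "finite F" "G \<subseteq> F"
  shows "S c F \<omega> - S c G \<omega> = S c (F - G) \<omega>"
  unfolding S_def using assms by (simp add: sum_diff finite_subset)

text \<open>Phrased for blocks of variables rather than for two sums, because a first-passage event
  involves several partial sums of one block at once.\<close>

lemma indep_restrict_events:
  assumes AB: "A \<inter> B = {}" and P: "Measurable.pred (PiM A (\<lambda>_. borel)) P" and Q: "Measurable.pred (PiM B (\<lambda>_. borel)) Q"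
  shows "\<P>(\<omega> in M. P (restrict (\<lambda>i. X i \<omega>) A) \<and> Q (restrict (\<lambda>i. X i \<omega>) B)) =
    \<P>(\<omega> in M. P (restrict (\<lambda>i. X i \<omega>) A)) * \<P>(\<omega> in M. Q (restrict (\<lambda>i. X i \<omega>) B))"
proof -
  note ind = indep_var_restrict[OF indep AB]
  let ?PA = "PiM A (\<lambda>_. borel) :: ('i \<Rightarrow> real) measure" and ?PB = "PiM B (\<lambda>_. borel) :: ('i \<Rightarrow> real) measure"
  have s: "{f \<in> space ?PA. P f} \<in> sets ?PA" "{f \<in> space ?PB. Q f} \<in> sets ?PB"
    using P Q by measurable
  have sp: "restrict (\<lambda>i. X i \<omega>) A \<in> space ?PA" "restrict (\<lambda>i. X i \<omega>) B \<in> space ?PB" for \<omega>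
    by (auto simp: space_PiM)
  have "prob ((\<lambda>x. (restrict (\<lambda>i. X i x) A, restrict (\<lambda>i. X i x) B)) -` ({f \<in> space ?PA. P f} \<times> {f \<in> space ?PB. Q f}) \<inter> space M)
     = prob ((\<lambda>x. restrict (\<lambda>i. X i x) A) -` {f \<in> space ?PA. P f} \<inter> space M) *
       prob ((\<lambda>x. restrict (\<lambda>i. X i x) B) -` {f \<in> space ?PB. Q f} \<inter> space M)"
    by (rule indep_varD[OF ind s]) auto
  then show ?thesis
    using sp by (simp add: vimage_def Int_def conj_commute)
qed

text \<open>When the right-hand side is below \<open>1\<close>, each of the remaining increments is small with
  probability at least \<open>1/2\<close>, so a first large partial sum forces the last one to be large.\<close>

lemma ottaviani:
  fixes g :: "nat \<Rightarrow> 'i"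
  assumes g: "inj g" and e: "\<epsilon> > 0"
  shows "\<P>(\<omega> in M. \<exists>j\<le>N. \<bar>S c (g ` {m..<m + j}) \<omega>\<bar> \<ge> 2 * \<epsilon>) \<le> 2 * (\<Sum>i=m..<m + N. (c (g i))\<^sup>2) / \<epsilon>\<^sup>2"
proof -
  define V where "V = (\<Sum>i=m..<m + N. (c (g i))\<^sup>2)"
  define R where "R j = g ` {m..<m + j}" for j
  have Rfin: "finite (R j)" for j by (simp add: R_def)
  have Rmono: "R i \<subseteq> R j" if "i \<le> j" for i j using that by (auto simp: R_def)
  have cheb: "\<P>(\<omega> in M. \<bar>S c (R N - R j) \<omega>\<bar> \<ge> \<epsilon>) \<le> V / \<epsilon>\<^sup>2" for j
  proof -
    have "\<P>(\<omega> in M. \<bar>S c (R N - R j) \<omega>\<bar> \<ge> \<epsilon>) \<le> (\<Sum>i\<in>R N - R j. (c i)\<^sup>2) / \<epsilon>\<^sup>2"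
      using Rfin by (intro S_chebyshev e) auto
    also have "(\<Sum>i\<in>R N - R j. (c i)\<^sup>2) \<le> (\<Sum>i\<in>R N. (c i)\<^sup>2)" using Rfin by (intro sum_mono2) auto
    also have "\<dots> = V" unfolding R_def V_def
      by (subst sum.reindex) (auto intro: inj_on_subset[OF g])
    finally show ?thesis using e by (simp add: divide_right_mono)
  qed
  show ?thesis
  proof (cases "V / \<epsilon>\<^sup>2 \<ge> 1 / 2")
    \<comment> \<open>Here the claimed bound is at least 1.\<close>
    case True
    then have "1 \<le> 2 * V / \<epsilon>\<^sup>2" by (simp add: mult.commute)
    then show ?thesis unfolding V_def by (meson order_trans prob_le_1)
  next
    case False
    define A where "A j = {\<omega> \<in> space M. \<bar>S c (R j) \<omega>\<bar> \<ge> 2 * \<epsilon> \<and> (\<forall>i<j. \<bar>S c (R i) \<omega>\<bar> < 2 * \<epsilon>)}" for j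
    define B where "B j = {\<omega> \<in> space M. \<bar>S c (R N - R j) \<omega>\<bar> < \<epsilon>}" for j
    have [measurable]: "A j \<in> sets M" "B j \<in> sets M" for j unfolding A_def B_def by measurable
    have PB: "prob (B j) \<ge> 1 / 2" for j
    proof -
      have "prob (B j) = 1 - \<P>(\<omega> in M. \<bar>S c (R N - R j) \<omega>\<bar> \<ge> \<epsilon>)"
        unfolding B_def by (subst prob_neg[symmetric]) (auto simp: not_le)
      then show ?thesis using cheb[of j] False by linarith
    qed
    have ind: "prob (A j \<inter> B j) = prob (A j) * prob (B j)" if "j \<le> N" for j
    proof -
      let ?P = "\<lambda>f. \<bar>\<Sum>i\<in>R j. c i * f i\<bar> \<ge> 2 * \<epsilon> \<and> (\<forall>k<j. \<bar>\<Sum>i\<in>R k. c i * f i\<bar> < 2 * \<epsilon>)"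
      let ?Q = "\<lambda>f. \<bar>\<Sum>i\<in>R N - R j. c i * f i\<bar> < \<epsilon>"
      have "Measurable.pred (PiM (R j) (\<lambda>_. borel)) (\<lambda>f. \<bar>\<Sum>i\<in>R k. c i * f i\<bar> < 2 * \<epsilon>)" if "k < j" for k
      proof -
        have "(\<lambda>f. \<Sum>i\<in>R k. c i * f i) \<in> borel_measurable (PiM (R j) (\<lambda>_. borel))"
          using Rmono[of k j] that
          by (intro borel_measurable_sum borel_measurable_times borel_measurable_const measurable_component_singleton) auto
        then show ?thesis by measurable
      qed
      then have P: "Measurable.pred (PiM (R j) (\<lambda>_. borel)) ?P" by measurable
      have Q: "Measurable.pred (PiM (R N - R j) (\<lambda>_. borel)) ?Q" by measurable
      have r: "(\<Sum>i\<in>G. c i * restrict (\<lambda>i. X i \<omega>) H i) = S c G \<omega>" if "G \<subseteq> H" for G H \<omega>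
        unfolding S_def using that by (intro sum.cong) auto
      have eA: "?P (restrict (\<lambda>i. X i \<omega>) (R j)) \<longleftrightarrow> \<bar>S c (R j) \<omega>\<bar> \<ge> 2 * \<epsilon> \<and> (\<forall>i<j. \<bar>S c (R i) \<omega>\<bar> < 2 * \<epsilon>)" for \<omega>
      proof -
        have "(\<Sum>i\<in>R k. c i * restrict (\<lambda>i. X i \<omega>) (R j) i) = S c (R k) \<omega>" if "k < j" for k
          using that by (intro r Rmono) simp
        then show ?thesis
          unfolding r[OF order_refl] by (intro conj_cong refl all_cong1 imp_cong) (simp only:)
      qed
      show ?thesis
      proof -
        have AB: "A j \<inter> B j = {\<omega> \<in> space M. (\<bar>S c (R j) \<omega>\<bar> \<ge> 2 * \<epsilon> \<and> (\<forall>i<j. \<bar>S c (R i) \<omega>\<bar> < 2 * \<epsilon>)) \<and>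
            \<bar>S c (R N - R j) \<omega>\<bar> < \<epsilon>}"
          unfolding A_def B_def by blast
        have "R j \<inter> (R N - R j) = {}" by blast
        from indep_restrict_events[OF this P Q] show ?thesis
          unfolding eA unfolding r[OF order_refl] AB unfolding A_def B_def .
      qed
    qed
    have disj: "disjoint_family_on (\<lambda>j. A j) {..N}"
      unfolding disjoint_family_on_def A_def by (auto simp: not_le) (metis linorder_neqE_nat not_less)
    have UA: "{\<omega> \<in> space M. \<exists>j\<le>N. \<bar>S c (R j) \<omega>\<bar> \<ge> 2 * \<epsilon>} = (\<Union>j\<le>N. A j)"
    proof (intro equalityI subsetI)
      fix \<omega> assume w: "\<omega> \<in> {\<omega> \<in> space M. \<exists>j\<le>N. \<bar>S c (R j) \<omega>\<bar> \<ge> 2 * \<epsilon>}"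
      define j where "j = (LEAST j. \<bar>S c (R j) \<omega>\<bar> \<ge> 2 * \<epsilon>)"
      have 1: "\<bar>S c (R j) \<omega>\<bar> \<ge> 2 * \<epsilon>" unfolding j_def using w by (auto intro: LeastI)
      have "j \<le> N" unfolding j_def using w by (auto intro: order_trans[OF Least_le])
      moreover have "\<forall>i<j. \<bar>S c (R i) \<omega>\<bar> < 2 * \<epsilon>" unfolding j_def using not_less_Least by force
      ultimately show "\<omega> \<in> (\<Union>j\<le>N. A j)" using 1 w by (auto simp: A_def)
    qed (auto simp: A_def)
    have sub: "(\<Union>j\<le>N. A j \<inter> B j) \<subseteq> {\<omega> \<in> space M. \<bar>S c (R N) \<omega>\<bar> \<ge> \<epsilon>}"
    proof safe
      fix j \<omega> assume j: "j \<le> N" and w: "\<omega> \<in> A j" "\<omega> \<in> B j"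
      have "S c (R N) \<omega> = S c (R j) \<omega> + S c (R N - R j) \<omega>"
        using S_diff[OF Rfin Rmono[OF j], of c \<omega>] by simp
      then show "\<epsilon> \<le> \<bar>S c (R N) \<omega>\<bar>" using w by (auto simp: A_def B_def)
    qed (auto simp: A_def)
    have "prob (\<Union>j\<le>N. A j) = (\<Sum>j\<le>N. prob (A j))"
      using disj by (intro finite_measure_finite_Union) auto
    also have "\<dots> \<le> (\<Sum>j\<le>N. 2 * prob (A j \<inter> B j))"
    proof (intro sum_mono)
      fix j assume "j \<in> {..N}"
      then have "prob (A j) * (1/2) \<le> prob (A j \<inter> B j)" using mult_left_mono[OF PB[of j], of "prob (A j)"] ind[of j] by simp
      then show "prob (A j) \<le> 2 * prob (A j \<inter> B j)" by simp
    qed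
    also have "\<dots> = 2 * prob (\<Union>j\<le>N. A j \<inter> B j)"
      using disj by (subst finite_measure_finite_Union) (auto simp: disjoint_family_on_def sum_distrib_left)
    also have "\<dots> \<le> 2 * \<P>(\<omega> in M. \<bar>S c (R N) \<omega>\<bar> \<ge> \<epsilon>)"
      by (intro mult_left_mono finite_measure_mono sub) auto
    also have "\<dots> \<le> 2 * (V / \<epsilon>\<^sup>2)" using cheb[of 0] by (simp add: R_def)
    finally show ?thesis using UA by (simp add: R_def V_def)
  qed
qed

text \<open>Kolmogorov's convergence criterion. The event \<open>Bd\<close> that the blocks started
  at every \<open>m\<close> become large is bounded, for each \<open>m\<close>, by the maximal
  inequality in terms of the variance beyond \<open>m\<close>, which tends to 0; hence it is null,
  and the Cauchy criterion applies.\<close>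

lemma AE_summable:
  fixes g :: "nat \<Rightarrow> 'i"
  assumes g: "inj g" and c: "summable (\<lambda>k. (c (g k))\<^sup>2)"
  shows "AE \<omega> in M. summable (\<lambda>k. c (g k) * X (g k) \<omega>)"
proof -
  define T where "T m j \<omega> = S c (g ` {m..<m + j}) \<omega>" for m j \<omega>
  have T: "T m j \<omega> = (\<Sum>k=m..<m + j. c (g k) * X (g k) \<omega>)" for m j \<omega>
    unfolding T_def S_def by (subst sum.reindex) (auto intro: inj_on_subset[OF g])
  have [measurable]: "T m j \<in> borel_measurable M" for m j unfolding T_def by measurable
  have "AE \<omega> in M. \<exists>m. \<forall>j. \<bar>T m j \<omega>\<bar> < 2 * \<epsilon>" if e: "\<epsilon> > 0" for \<epsilon>
  proof -
    define Bd where "Bd = {\<omega> \<in> space M. \<forall>m. \<exists>j. \<bar>T m j \<omega>\<bar> \<ge> 2 * \<epsilon>}"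
    have [measurable]: "Bd \<in> sets M" unfolding Bd_def by measurable
    have bnd: "prob Bd \<le> 2 * (\<Sum>i. (c (g (i + m)))\<^sup>2) / \<epsilon>\<^sup>2" for m
    proof -
      define E where "E N = {\<omega> \<in> space M. \<exists>j\<le>N. \<bar>T m j \<omega>\<bar> \<ge> 2 * \<epsilon>}" for N
      have [measurable]: "E N \<in> sets M" for N unfolding E_def by measurable
      have sm: "summable (\<lambda>i. (c (g (i + m)))\<^sup>2)" using summable_ignore_initial_segment[OF c, of m] by simp
      have "prob (E N) \<le> 2 * (\<Sum>i. (c (g (i + m)))\<^sup>2) / \<epsilon>\<^sup>2" for N
      proof -
        have "prob (E N) \<le> 2 * (\<Sum>i=m..<m + N. (c (g i))\<^sup>2) / \<epsilon>\<^sup>2"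
          unfolding E_def T_def by (rule ottaviani[OF g e])
        also have "(\<Sum>i=m..<m + N. (c (g i))\<^sup>2) = (\<Sum>i<N. (c (g (i + m)))\<^sup>2)"
          using sum.shift_bounds_nat_ivl[of "\<lambda>i. (c (g i))\<^sup>2" 0 m N]
          by (simp add: add.commute atLeast0LessThan)
        also have "\<dots> \<le> (\<Sum>i. (c (g (i + m)))\<^sup>2)" by (intro sum_le_suminf sm) auto
        finally show ?thesis using e by (simp add: divide_right_mono)
      qed
      moreover have "(\<lambda>N. prob (E N)) \<longlonglongrightarrow> prob (\<Union>N. E N)"
        by (intro finite_Lim_measure_incseq) (auto simp: incseq_def E_def intro: order_trans)
      ultimately have "prob (\<Union>N. E N) \<le> 2 * (\<Sum>i. (c (g (i + m)))\<^sup>2) / \<epsilon>\<^sup>2"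
        by (intro LIMSEQ_le_const2) auto
      moreover have "prob Bd \<le> prob (\<Union>N. E N)"
        by (intro finite_measure_mono) (auto simp: Bd_def E_def, meson order_refl)
      ultimately show ?thesis by linarith
    qed
    have "(\<lambda>m. 2 * (\<Sum>i. (c (g (i + m)))\<^sup>2) / \<epsilon>\<^sup>2) \<longlonglongrightarrow> 2 * 0 / \<epsilon>\<^sup>2"
      using e by (intro tendsto_intros suminf_exist_split2[OF c]) auto
    then have "prob Bd \<le> 0" using bnd by (intro LIMSEQ_le_const) auto
    then have "prob Bd = 0" by (simp add: measure_le_0_iff)
    then have "AE \<omega> in M. \<omega> \<notin> Bd" by (intro AE_not_in) (auto simp: null_sets_def emeasure_eq_measure)
    then show ?thesis using AE_space by eventually_elim (auto simp: Bd_def not_le)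
  qed
  then have "AE \<omega> in M. \<forall>n. \<exists>m. \<forall>j. \<bar>T m j \<omega>\<bar> < 2 * inverse (real (Suc n))"
    by (subst AE_all_countable) auto
  then show ?thesis
  proof eventually_elim
    case (elim \<omega>)
    show ?case
    proof (rule summable_Cauchy[THEN iffD2], intro allI impI)
      fix e :: real assume e: "e > 0"
      \<comment> \<open>A block from \<open>i\<close> to \<open>j\<close> is a difference of two
        blocks started at \<open>m\<close>, each below \<open>2 * (e / 4)\<close>.\<close>
      obtain n where n: "inverse (real (Suc n)) < e / 4" using reals_Archimedean[of "e / 4"] e by auto
      obtain m where m: "\<And>j. \<bar>T m j \<omega>\<bar> < 2 * inverse (real (Suc n))" using elim by blast
      have "norm (\<Sum>k=i..<j. c (g k) * X (g k) \<omega>) < e" if i: "i \<ge> m" for i j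
      proof (cases "i \<le> j")
        case True
        have "(\<Sum>k=i..<j. c (g k) * X (g k) \<omega>) = T m (j - m) \<omega> - T m (i - m) \<omega>"
          unfolding T using i True sum_diff_nat_ivl[of m i j "\<lambda>k. c (g k) * X (g k) \<omega>"] by simp
        then show ?thesis using m[of "j - m"] m[of "i - m"] n unfolding real_norm_def by linarith
      qed (use e in auto)
      then show "\<exists>N. \<forall>m\<ge>N. \<forall>n. norm (sum (\<lambda>k. c (g k) * X (g k) \<omega>) {m..<n}) < e" by blast
    qed
  qed
qed

end

section \<open>Tail probabilities of almost sure limits, and the linear process as such a
  limit\<close>

lemma (in prob_space) AE_tendsto_imp_prob_tendsto:
  fixes Y :: "nat \<Rightarrow> 'a \<Rightarrow> real"
  assumes [measurable]: "\<And>n. Y n \<in> borel_measurable M" "L \<in> borel_measurable M"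
    and lim: "AE \<omega> in M. (\<lambda>n. Y n \<omega>) \<longlonglongrightarrow> L \<omega>" and d: "\<delta> > 0"
  shows "(\<lambda>n. \<P>(\<omega> in M. \<bar>Y n \<omega> - L \<omega>\<bar> \<ge> \<delta>)) \<longlonglongrightarrow> 0"
proof -
  let ?I = "\<lambda>n \<omega>. indicator {\<omega> \<in> space M. \<bar>Y n \<omega> - L \<omega>\<bar> \<ge> \<delta>} \<omega> :: real"
  have "(\<lambda>n. LINT \<omega>|M. ?I n \<omega>) \<longlonglongrightarrow> (LINT \<omega>|M. (0::real))"
  proof (rule integral_dominated_convergence[where w="\<lambda>_. 1"])
    show "AE \<omega> in M. (\<lambda>n. ?I n \<omega>) \<longlonglongrightarrow> 0"
      using lim
    proof eventually_elim
      case (elim \<omega>)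
      then have "\<forall>\<^sub>F n in sequentially. dist (Y n \<omega>) (L \<omega>) < \<delta>" using d by (rule tendstoD)
      then have "\<forall>\<^sub>F n in sequentially. ?I n \<omega> = 0"
        by eventually_elim (auto simp: dist_real_def)
      then show ?case by (rule tendsto_eventually)
    qed
  qed auto
  then show ?thesis by simp
qed

text \<open>Shifting the level by \<open>\<delta>\<close> avoids any continuity assumption on the
  law of the limit and makes one index \<open>n\<close> serve all levels \<open>x\<close> at
  once.\<close>

lemma (in prob_space) AE_tendsto_prob_sandwich:
  fixes Y :: "nat \<Rightarrow> 'a \<Rightarrow> real"
  assumes m[measurable]: "\<And>n. Y n \<in> borel_measurable M" "L \<in> borel_measurable M"
    and lim: "AE \<omega> in M. (\<lambda>n. Y n \<omega>) \<longlonglongrightarrow> L \<omega>" and d: "\<delta> > 0" and e: "\<epsilon> > 0"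
  shows "\<forall>\<^sub>F n in sequentially. \<forall>x. \<P>(\<omega> in M. L \<omega> \<ge> x) \<le> \<P>(\<omega> in M. Y n \<omega> \<ge> x - \<delta>) + \<epsilon> \<and>
     \<P>(\<omega> in M. Y n \<omega> \<ge> x + \<delta>) - \<epsilon> \<le> \<P>(\<omega> in M. L \<omega> \<ge> x)"
  using order_tendstoD(2)[OF AE_tendsto_imp_prob_tendsto[OF m lim d] e]
proof eventually_elim
  case (elim n)
  let ?D = "{\<omega> \<in> space M. \<bar>Y n \<omega> - L \<omega>\<bar> \<ge> \<delta>}"
  show ?case
  proof (intro allI conjI)
    fix x
    have "\<P>(\<omega> in M. L \<omega> \<ge> x) \<le> prob ({\<omega> \<in> space M. Y n \<omega> \<ge> x - \<delta>} \<union> ?D)"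
      by (intro finite_measure_mono) auto
    also have "\<dots> \<le> \<P>(\<omega> in M. Y n \<omega> \<ge> x - \<delta>) + prob ?D" by (rule measure_Un_le) auto
    finally show "\<P>(\<omega> in M. L \<omega> \<ge> x) \<le> \<P>(\<omega> in M. Y n \<omega> \<ge> x - \<delta>) + \<epsilon>" using elim by linarith
    have "\<P>(\<omega> in M. Y n \<omega> \<ge> x + \<delta>) \<le> prob ({\<omega> \<in> space M. L \<omega> \<ge> x} \<union> ?D)"
      by (intro finite_measure_mono) auto
    also have "\<dots> \<le> \<P>(\<omega> in M. L \<omega> \<ge> x) + prob ?D" by (rule measure_Un_le) auto
    finally show "\<P>(\<omega> in M. Y n \<omega> \<ge> x + \<delta>) - \<epsilon> \<le> \<P>(\<omega> in M. L \<omega> \<ge> x)" using elim by linarith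
  qed
qed

lemma partial_sum_measurable[measurable]:
  assumes [measurable]: "\<And>i. \<xi> i \<in> borel_measurable M"
  shows "partial_sum a \<xi> n \<in> borel_measurable M"
  unfolding partial_sum_def[abs_def] linear_process_def[abs_def] by measurable

text \<open>Cutting the noise at \<open>- K\<close> truncates the series at time \<open>k\<close>
  after exactly \<open>K + k\<close> terms, so the weighted sum is a finite sum of partial sums of
  convergent series. The factor \<open>s\<close> lets the statement serve both the standardised and
  the original noise.\<close>

lemma AE_partial_sum_limit:
  fixes X :: "int \<Rightarrow> 'a \<Rightarrow> real"
  assumes "iid_std M X \<mu>"
    and a: "\<And>i. i < 0 \<Longrightarrow> a i = 0" "summable (\<lambda>m. (a (int m))\<^sup>2)"
  shows "AE \<omega> in M. (\<lambda>K. \<Sum>i\<in>{- int K<..int n}. coeff_b a n i * (s * X i \<omega>)) \<longlonglongrightarrow>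
    partial_sum a (\<lambda>i \<omega>. s * X i \<omega>) n \<omega>"
proof -
  interpret iid_std M X \<mu> by fact
  have "AE \<omega> in M. \<forall>k\<in>{1..n}. summable (\<lambda>m. a (int m) * X (int k - int m) \<omega>)"
  proof (intro AE_finite_allI)
    fix k assume "k \<in> {1..n}"
    have "AE \<omega> in M. summable (\<lambda>m. (\<lambda>i. a (int k - i)) (int k - int m) * X (int k - int m) \<omega>)"
      using a(2) by (intro AE_summable) (auto simp: inj_def)
    then show "AE \<omega> in M. summable (\<lambda>m. a (int m) * X (int k - int m) \<omega>)" by simp
  qed auto
  then show ?thesis
  proof eventually_elim
    case (elim \<omega>)
    have eq: "(\<Sum>i\<in>{- int K<..int n}. coeff_b a n i * (s * X i \<omega>)) =
        (\<Sum>k=1..n. \<Sum>m<K + k. a (int m) * (s * X (int k - int m) \<omega>))" for K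
    proof -
      have "(\<Sum>i\<in>{- int K<..int n}. a (int k - i) * (s * X i \<omega>)) = (\<Sum>m<K + k. a (int m) * (s * X (int k - int m) \<omega>))"
        if k: "k \<in> {1..n}" for k
      proof -
        have "(\<Sum>i\<in>{- int K<..int n}. a (int k - i) * (s * X i \<omega>)) = (\<Sum>i\<in>{- int K<..int k}. a (int k - i) * (s * X i \<omega>))"
          using k by (intro sum.mono_neutral_right) (auto simp: a)
        also have "\<dots> = (\<Sum>m<K + k. a (int m) * (s * X (int k - int m) \<omega>))"
          by (rule sum.reindex_bij_witness[where i="\<lambda>m. int k - int m" and j="\<lambda>i. nat (int k - i)"]) auto
        finally show ?thesis .
      qed
      then have "(\<Sum>k=1..n. \<Sum>m<K + k. a (int m) * (s * X (int k - int m) \<omega>)) =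
          (\<Sum>k=1..n. \<Sum>i\<in>{- int K<..int n}. a (int k - i) * (s * X i \<omega>))" by (intro sum.cong) auto
      also have "\<dots> = (\<Sum>i\<in>{- int K<..int n}. coeff_b a n i * (s * X i \<omega>))"
        by (subst sum.swap) (simp add: coeff_b_def sum_distrib_right)
      finally show ?thesis by simp
    qed
    show ?case
      unfolding eq partial_sum_def linear_process_def
    proof (intro tendsto_sum)
      fix k assume k: "k \<in> {1..n}"
      then have "(\<lambda>K. \<Sum>m<K. a (int m) * (s * X (int k - int m) \<omega>)) \<longlonglongrightarrow> (\<Sum>m. a (int m) * (s * X (int k - int m) \<omega>))"
        using elim summable_mult[of "\<lambda>m. a (int m) * X (int k - int m) \<omega>" s]
        by (intro summable_LIMSEQ) (simp add: mult.left_commute)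
      then show "(\<lambda>K. \<Sum>m<K + k. a (int m) * (s * X (int k - int m) \<omega>)) \<longlonglongrightarrow> (\<Sum>m. a (int m) * (s * X (int k - int m) \<omega>))"
        by (rule LIMSEQ_ignore_initial_segment)
    qed
  qed
qed

section \<open>Gaussian tails\<close>

abbreviation "gauss \<equiv> std_normal_distribution"

lemma prob_space_gauss: "prob_space gauss"
  using real_dist_normal_dist by (simp add: real_distribution_def)

interpretation gauss: prob_space gauss by (rule prob_space_gauss)

definition Q :: "real \<Rightarrow> real" where "Q x = measure gauss {x..}"

lemma measure_gauss_interval:
  assumes [measurable]: "A \<in> sets borel"
  shows "measure gauss A = (LINT u:A|lborel. std_normal_density u)"
proof -
  have "measure gauss A = (LINT u|gauss. indicator A u)" by simp
  also have "\<dots> = (LINT u|lborel. std_normal_density u * indicator A u)"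
    by (intro integral_real_density) auto
  finally show ?thesis by (simp add: set_lebesgue_integral_def mult.commute)
qed

lemma gauss_singleton: "measure gauss {x} = 0"
  by (simp add: measure_def emeasure_density nn_integral_indicator_singleton' mult.commute)

lemma Q_eq: "1 - std_normal_cdf x = Q x"
proof -
  have "{x..} = insert x {x<..}" by auto
  then have "Q x + std_normal_cdf x = measure gauss {x<..} + measure gauss {..x}"
    unfolding Q_def std_normal_cdf_def cdf_def
    using gauss.finite_measure_Union[of "{x}" "{x<..}"] gauss_singleton[of x]
    by simp
  also have "\<dots> = measure gauss ({x<..} \<union> {..x})"
    by (subst gauss.finite_measure_Union) auto
  also have "{x<..} \<union> {..x} = space gauss" by auto
  finally show ?thesis using gauss.prob_space by simp
qed

lemma Q_antimono: "x \<le> y \<Longrightarrow> Q y \<le> Q x"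
  unfolding Q_def by (intro gauss.finite_measure_mono) auto

lemma Q_diff:
  assumes "h \<ge> 0"
  shows "Q (x - h) - Q x = (LINT u:{x - h..<x}|lborel. std_normal_density u)"
proof -
  have "Q (x - h) = measure gauss {x - h..<x} + Q x"
    unfolding Q_def using assms
    by (subst gauss.finite_measure_Union[symmetric]) (auto intro!: arg_cong[where f="measure gauss"])
  then show ?thesis by (simp add: measure_gauss_interval)
qed

lemma integrable_interval:
  "integrable lborel f \<Longrightarrow> set_integrable lborel {a..<b::real} (f :: real \<Rightarrow> real)"
  "set_integrable lborel {a..<b::real} (\<lambda>_. c :: real)"
  unfolding set_integrable_def
  by (rule integrable_mult_indicator) (auto intro!: integrable_real_indicator emeasure_bounded_finite bounded_subset[OF bounded_closed_interval[of a b]])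

text \<open>For \<open>x \<ge> 0\<close> the interval satisfies
  \<open>- u^2 \<le> - x^2 + 2 * x * h\<close>: if \<open>x \<ge> h\<close> because
  \<open>u \<ge> x - h\<close>, otherwise because the right-hand side is nonnegative. For negative
  \<open>x\<close> the density bound 1 is enough, whence \<open>max x 0\<close>.\<close>

lemma Q_diff_le:
  assumes h: "h \<ge> 0"
  shows "Q (x - h) - Q x \<le> h * exp (- (max x 0)\<^sup>2 / 2 + max x 0 * h)"
proof -
  let ?c = "exp (- (max x 0)\<^sup>2 / 2 + max x 0 * h)"
  have b: "std_normal_density u \<le> ?c" if "u \<in> {x - h..<x}" for u
  proof -
    have "- u\<^sup>2 \<le> - (max x 0)\<^sup>2 + 2 * max x 0 * h"
    proof (cases "x \<ge> 0")
      case True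
      show ?thesis
      proof (cases "x \<ge> h")
        case 2: True
        have "(x - h)\<^sup>2 \<le> u\<^sup>2" using 2 that by (intro power_mono) auto
        moreover have "(x - h)\<^sup>2 \<ge> x\<^sup>2 - 2 * x * h" by (simp add: power2_eq_square algebra_simps)
        ultimately show ?thesis using True by simp
      next
        case False
        have "x * x \<le> x * (2 * h)" using False True by (intro mult_left_mono) auto
        moreover have "0 \<le> u\<^sup>2" by simp
        ultimately have "- u\<^sup>2 \<le> - x\<^sup>2 + 2 * x * h" unfolding power2_eq_square by linarith
        then show ?thesis using True by simp
      qed
    qed auto
    then have "- u\<^sup>2 / 2 \<le> - (max x 0)\<^sup>2 / 2 + max x 0 * h" by simp
    moreover have "1 / sqrt (2 * pi) \<le> 1" using pi_ge_two by (simp add: divide_le_eq_1)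
    ultimately have "1 / sqrt (2 * pi) * exp (- u\<^sup>2 / 2) \<le> 1 * ?c" by (intro mult_mono) auto
    then show ?thesis by (simp add: std_normal_density_def)
  qed
  have "Q (x - h) - Q x \<le> (LINT u:{x - h..<x}|lborel. ?c)"
    unfolding Q_diff[OF h] using b
    by (intro set_integral_mono integrable_interval integrable_normal_density) auto
  also have "\<dots> = h * ?c" using h by (simp add: set_integral_const)
  finally show ?thesis .
qed

definition "kQ = exp (- 3 / 2) / sqrt (2 * pi)"

lemma kQ_pos: "kQ > 0" by (simp add: kQ_def)

text \<open>The density is integrated over an interval of length \<open>1 / max 1 x\<close> to the
  right of \<open>max x 0\<close>, on which \<open>u^2\<close> grows by at most
  \<open>2 + 1\<close>. This 3 is the source of \<open>exp (- 3 / 2)\<close> in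
  \<open>kQ\<close>.\<close>

lemma Q_ge: "Q x \<ge> kQ * exp (- (max x 0)\<^sup>2 / 2) / max 1 x"
proof -
  define y where "y = max x 0"
  define L where "L = max 1 x"
  have L: "L \<ge> 1" "y \<le> L" "y \<ge> 0" by (auto simp: L_def y_def)
  \<comment> \<open>The left end \<open>y + 1/L - 1/L\<close> stays unsimplified so that the
    interval has the shape required by \<open>Q_diff\<close>.\<close>
  have b: "std_normal_density u \<ge> kQ * exp (- y\<^sup>2 / 2)" if "u \<in> {y + 1/L - 1/L..<y + 1/L}" for u
  proof -
    have "u\<^sup>2 \<le> (y + 1/L)\<^sup>2" using that L by (intro power_mono) auto
    also have "\<dots> = y\<^sup>2 + 2 * (y / L) + (1/L)\<^sup>2" by (simp add: power2_sum)
    also have "\<dots> \<le> y\<^sup>2 + 2 * 1 + 1"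
      using L power_le_one[of "1/L" 2] by (intro add_mono mult_left_mono) (auto simp: divide_le_eq_1)
    finally have "- 3 / 2 + (- y\<^sup>2 / 2) \<le> - u\<^sup>2 / 2" by simp
    then have "exp (- 3 / 2) * exp (- y\<^sup>2 / 2) \<le> exp (- u\<^sup>2 / 2)" by (simp flip: exp_add)
    then show ?thesis unfolding kQ_def std_normal_density_def by (simp add: divide_right_mono)
  qed
  have "kQ * exp (- y\<^sup>2 / 2) / L = (LINT u:{y + 1/L - 1/L..<y + 1/L}|lborel. kQ * exp (- y\<^sup>2 / 2))"
    using L by (simp add: set_integral_const)
  also have "\<dots> \<le> (LINT u:{y + 1/L - 1/L..<y + 1/L}|lborel. std_normal_density u)"
    using b by (intro set_integral_mono integrable_interval integrable_normal_density) auto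
  also have "\<dots> = Q (y + 1/L - 1/L) - Q (y + 1/L)" using L by (intro Q_diff[symmetric]) auto
  also have "\<dots> \<le> Q y" by (simp add: Q_def)
  also have "\<dots> \<le> Q x" by (intro Q_antimono) (simp add: y_def)
  finally show ?thesis by (simp add: y_def L_def)
qed

lemma Q_pos: "Q x > 0"
  using Q_ge[of x] kQ_pos
  by (smt (verit) divide_pos_pos exp_gt_zero mult_pos_pos)

lemma gauss_exp:
  shows "integrable gauss (\<lambda>z. exp (t * z))" "(LINT z|gauss. exp (t * z)) = exp (t\<^sup>2 / 2)"
proof -
  have eq: "std_normal_density z * exp (t * z) = exp (t\<^sup>2 / 2) * normal_density t 1 z" for z
  proof -
    have "- z\<^sup>2 / 2 + t * z = t\<^sup>2 / 2 + (- (z - t)\<^sup>2 / 2)" by (simp add: power2_eq_square field_simps)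
    then have "exp (- z\<^sup>2 / 2) * exp (t * z) = exp (t\<^sup>2 / 2) * exp (- (z - t)\<^sup>2 / 2)"
      by (simp flip: exp_add)
    then show ?thesis by (simp add: std_normal_density_def normal_density_def)
  qed
  show "integrable gauss (\<lambda>z. exp (t * z))"
    by (subst integrable_real_density) (auto simp: eq)
  show "(LINT z|gauss. exp (t * z)) = exp (t\<^sup>2 / 2)"
    by (subst integral_real_density) (auto simp: eq)
qed

text \<open>A single integrable function that dominates
  \<open>|z| powr q * exp (L * max (c * z) 0)\<close> for all \<open>q\<close> between 2 and 3 and
  all \<open>c\<close>, \<open>L\<close> with \<open>L * c \<le> 1\<close>. The number 28 is
  \<open>1 + 27\<close>, from \<open>(|z| / 3) ^ 3 \<le> exp |z|\<close>.\<close>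

lemma gauss_abs_moment: "integrable gauss (\<lambda>z. (1 + \<bar>z\<bar> ^ 3) * exp \<bar>z\<bar>)"
proof (rule Bochner_Integration.integrable_bound)
  show "integrable gauss (\<lambda>z. 28 * (exp (2 * z) + exp (- 2 * z)))"
    by (intro integrable_mult_right Bochner_Integration.integrable_add gauss_exp(1))
  have "norm ((1 + \<bar>z\<bar> ^ 3) * exp \<bar>z\<bar>) \<le> norm (28 * (exp (2 * z) + exp (- 2 * z)))" for z :: real
  proof -
    have "(\<bar>z\<bar> / 3) ^ 3 \<le> exp (\<bar>z\<bar> / 3) ^ 3"
      by (intro power_mono order_trans[OF _ exp_ge_add_one_self]) auto
    also have "\<dots> = exp \<bar>z\<bar>" by (simp flip: exp_of_nat_mult)
    finally have "\<bar>z\<bar> ^ 3 / 27 \<le> exp \<bar>z\<bar>" by (simp add: power_divide)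
    then have "1 + \<bar>z\<bar> ^ 3 \<le> 28 * exp \<bar>z\<bar>"
      using exp_ge_add_one_self[of "\<bar>z\<bar>"] abs_ge_zero[of z] by linarith
    then have "(1 + \<bar>z\<bar> ^ 3) * exp \<bar>z\<bar> \<le> 28 * exp \<bar>z\<bar> * exp \<bar>z\<bar>" by (intro mult_right_mono) auto
    also have "\<dots> = 28 * exp (2 * \<bar>z\<bar>)" by (simp flip: exp_add)
    also have "\<dots> \<le> 28 * (exp (2 * z) + exp (- 2 * z))" by (auto simp: abs_if)
    finally show ?thesis by (simp add: abs_mult)
  qed
  then show "AE z in gauss. norm ((1 + \<bar>z\<bar> ^ 3) * exp \<bar>z\<bar>) \<le> norm (28 * (exp (2 * z) + exp (- 2 * z)))" by simp
qed simp

lemma gauss_moments: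
  "integrable gauss (\<lambda>z. z)" "integrable gauss (\<lambda>z. z\<^sup>2)"
  "(LINT z|gauss. z) = 0" "(LINT z|gauss. z\<^sup>2) = 1"
  using integrable_std_normal_distribution_moment[of 1] integral_std_normal_distribution_moment_odd[of 1]
    std_normal_distribution_even_moments[of 1] by auto

text \<open>Lets the Gaussian variables that replace the summands merge into one whose variance is
  the sum. Vanishing factors are treated apart because a normal density needs a positive standard
  deviation.\<close>

lemma gauss_convolution:
  fixes f :: "real \<Rightarrow> real"
  assumes f[measurable]: "f \<in> borel_measurable borel" and bdd: "\<And>x. \<bar>f x\<bar> \<le> B" and cs: "c \<ge> 0" "s \<ge> 0"
  shows "(LINT w|gauss. LINT z|gauss. f (u + c * w + s * z)) = (LINT z|gauss. f (u + sqrt (c\<^sup>2 + s\<^sup>2) * z))"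
proof (cases "c = 0 \<or> s = 0")
  case True
  then show ?thesis using cs by (auto simp: gauss.prob_space[simplified])
next
  case False
  then have cs: "c > 0" "s > 0" using cs by auto
  interpret P: pair_prob_space gauss gauss ..
  let ?P = "gauss \<Otimes>\<^sub>M gauss"
  have [measurable_cong]: "sets ?P = sets (borel \<Otimes>\<^sub>M borel)" by (intro sets_pair_measure_cong) auto
  have d1: "distr ?P borel fst = gauss"
  proof -
    have "distr ?P borel fst = distr ?P gauss fst" by (intro distr_cong) auto
    then show ?thesis using gauss.distr_pair_fst by simp
  qed
  have d2: "distr ?P borel snd = gauss"
  proof (rule measure_eqI)
    fix A assume "A \<in> sets (distr ?P borel snd)"
    then have A: "A \<in> sets borel" by simp
    have "emeasure (distr ?P borel snd) A = emeasure ?P (space gauss \<times> A)"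
      using A by (subst emeasure_distr) (auto intro!: arg_cong2[where f=emeasure] simp: space_pair_measure)
    also have "\<dots> = emeasure gauss A"
      using A gauss.emeasure_space_1 by (subst gauss.emeasure_pair_measure_Times) auto
    finally show "emeasure (distr ?P borel snd) A = emeasure gauss A" .
  qed simp
  have mfs: "fst \<in> borel_measurable ?P" "snd \<in> borel_measurable ?P" by measurable
  have "sets (borel \<Otimes>\<^sub>M borel) = sets ?P" by (intro sets_pair_measure_cong) auto
  then have d3: "distr ?P (borel \<Otimes>\<^sub>M borel) (\<lambda>x. (fst x, snd x)) = ?P"
    unfolding prod.collapse by (rule distr_id2)
  have "P.indep_var borel fst borel snd"
    unfolding P.indep_var_distribution_eq d1 d2 d3 using mfs by blast
  then have "P.indep_var borel ((\<lambda>x. c * x) \<circ> fst) borel ((\<lambda>x. s * x) \<circ> snd)"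
    by (rule P.indep_var_compose) measurable
  then have ind: "P.indep_var borel (\<lambda>x. c * fst x) borel (\<lambda>x. s * snd x)"
    unfolding comp_def .
  have D: "distributed ?P lborel (\<lambda>x. k * g x) (normal_density 0 k)"
    if g: "g \<in> borel_measurable ?P" "distr ?P borel g = gauss" and k: "k > 0" for g k
  proof -
    have "distributed ?P lborel g std_normal_density"
    proof -
      have "distr ?P lborel g = distr ?P borel g" by (intro distr_cong) auto
      then show ?thesis unfolding distributed_def g(2) using g(1) by (intro conjI) simp_all
    qed
    from P.normal_density_affine[OF this, of k 0] show ?thesis using k by simp
  qed
  have "distributed ?P lborel (\<lambda>x. c * fst x + s * snd x) (normal_density 0 (sqrt (c\<^sup>2 + s\<^sup>2)))"
    using P.add_indep_normal[OF ind cs D[OF mfs(1) d1 cs(1)] D[OF mfs(2) d2 cs(2)]] by simp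
  then have "(LINT x|?P. f (u + (c * fst x + s * snd x))) =
      (LINT x|lborel. normal_density 0 (sqrt (c\<^sup>2 + s\<^sup>2)) x * f (u + x))"
    by (subst distributed_integral[where g="\<lambda>x. f (u + x)", symmetric]) auto
  moreover have "distributed ?P lborel (\<lambda>x. sqrt (c\<^sup>2 + s\<^sup>2) * fst x) (normal_density 0 (sqrt (c\<^sup>2 + s\<^sup>2)))"
    using cs by (intro D mfs d1) (auto intro: add_pos_pos)
  then have "(LINT x|?P. f (u + sqrt (c\<^sup>2 + s\<^sup>2) * fst x)) =
      (LINT x|lborel. normal_density 0 (sqrt (c\<^sup>2 + s\<^sup>2)) x * f (u + x))"
    by (subst distributed_integral[where g="\<lambda>x. f (u + x)", symmetric]) auto
  moreover have "(LINT x|?P. f (u + sqrt (c\<^sup>2 + s\<^sup>2) * fst x)) = (LINT z|gauss. f (u + sqrt (c\<^sup>2 + s\<^sup>2) * z))"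
    by (subst d1[symmetric], subst integral_distr) auto
  moreover have "(LINT x|?P. f (u + (c * fst x + s * snd x))) = (LINT w|gauss. LINT z|gauss. f (u + c * w + s * z))"
  proof -
    have "integrable ?P (\<lambda>x. f (u + (c * fst x + s * snd x)))"
      by (rule P.integrable_const_bound[where B=B]) (use bdd in auto)
    then have "integrable ?P (\<lambda>(w, z). f (u + (c * w + s * z)))" by (simp add: case_prod_unfold)
    from P.integral_fst'[OF this] show ?thesis by (simp add: case_prod_unfold add.assoc)
  qed
  ultimately show ?thesis by simp
qed

section \<open>Lindeberg replacement with exponential weights\<close>

text \<open>\<open>spl\<close> is an integrated quadratic B-spline: a step from \<open>0\<close> (for \<open>v \<le> 0\<close>) to \<open>1\<close> (for
  \<open>v \<ge> 3\<close>), with derivatives \<open>spl1\<close> and \<open>spl2\<close>.\<close>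

definition cub :: "real \<Rightarrow> real" where "cub v = (max v 0) ^ 3"
definition spl :: "real \<Rightarrow> real" where
  "spl v = (cub v - 3 * cub (v - 1) + 3 * cub (v - 2) - cub (v - 3)) / 6"
definition spl1 :: "real \<Rightarrow> real" where
  "spl1 v = ((max v 0)\<^sup>2 - 3 * (max (v - 1) 0)\<^sup>2 + 3 * (max (v - 2) 0)\<^sup>2 - (max (v - 3) 0)\<^sup>2) / 2"
definition spl2 :: "real \<Rightarrow> real" where
  "spl2 v = max v 0 - 3 * max (v - 1) 0 + 3 * max (v - 2) 0 - max (v - 3) 0"

lemma spl_measurable[measurable]:
  "spl \<in> borel_measurable borel" "spl1 \<in> borel_measurable borel" "spl2 \<in> borel_measurable borel"
  unfolding spl_def[abs_def] spl1_def[abs_def] spl2_def[abs_def] cub_def[abs_def] by measurable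

text \<open>On the positive side the remainder is exactly \<open>t ^ 3\<close>. If 0 separates
  \<open>v\<close> from \<open>v + t\<close>, both have modulus at most \<open>|t|\<close>, which
  bounds the mismatch.\<close>

lemma cub_taylor: "\<bar>cub (v + t) - cub v - t * (3 * (max v 0)\<^sup>2) - t\<^sup>2 / 2 * (6 * max v 0)\<bar> \<le> \<bar>t\<bar> ^ 3"
proof -
  consider "v \<ge> 0" "v + t \<ge> 0" | "v \<ge> 0" "v + t < 0" | "v < 0" "v + t \<ge> 0" | "v < 0" "v + t < 0" by linarith
  then show ?thesis
  proof cases
    case 1
    then have "cub (v + t) - cub v - t * (3 * (max v 0)\<^sup>2) - t\<^sup>2 / 2 * (6 * max v 0) = t ^ 3"
      by (simp add: cub_def power3_eq_cube power2_eq_square algebra_simps)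
    then show ?thesis by (simp add: power_abs)
  next
    case 2
    then have eq: "cub (v + t) - cub v - t * (3 * (max v 0)\<^sup>2) - t\<^sup>2 / 2 * (6 * max v 0) = (- v - t) ^ 3 - (- t) ^ 3"
      by (simp add: cub_def power3_eq_cube power2_eq_square algebra_simps)
    have "(- v - t) ^ 3 \<le> (- t) ^ 3" "0 \<le> (- v - t) ^ 3" using 2 by (auto intro!: zero_le_power power_mono[of "- v - t" "- t" 3, simplified])
    moreover have "\<bar>t\<bar> ^ 3 = (- t) ^ 3" using 2 by (simp add: abs_if)
    ultimately show ?thesis unfolding eq by linarith
  next
    case 3
    then have "cub (v + t) - cub v - t * (3 * (max v 0)\<^sup>2) - t\<^sup>2 / 2 * (6 * max v 0) = (v + t) ^ 3"
      by (simp add: cub_def)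
    moreover have "\<bar>(v + t) ^ 3\<bar> \<le> \<bar>t\<bar> ^ 3" using 3 by (simp add: power_abs[symmetric] power_mono)
    ultimately show ?thesis by simp
  qed (simp add: cub_def)
qed

lemma spl_taylor: "\<bar>spl (v + t) - spl v - t * spl1 v - t\<^sup>2 / 2 * spl2 v\<bar> \<le> 2 * \<bar>t\<bar> ^ 3"
proof -
  define R where "R w = cub (w + t) - cub w - t * (3 * (max w 0)\<^sup>2) - t\<^sup>2 / 2 * (6 * max w 0)" for w
  have e: "v + t - 1 = v - 1 + t" "v + t - 2 = v - 2 + t" "v + t - 3 = v - 3 + t" by auto
  have "spl (v + t) - spl v - t * spl1 v - t\<^sup>2 / 2 * spl2 v = (R v - 3 * R (v - 1) + 3 * R (v - 2) - R (v - 3)) / 6"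
    unfolding spl_def spl1_def spl2_def R_def e by (simp add: field_simps)
  moreover have "\<bar>R w\<bar> \<le> \<bar>t\<bar> ^ 3" for w unfolding R_def by (rule cub_taylor)
  then have "\<bar>R v\<bar> \<le> \<bar>t\<bar> ^ 3" "\<bar>R (v-1)\<bar> \<le> \<bar>t\<bar> ^ 3" "\<bar>R (v-2)\<bar> \<le> \<bar>t\<bar> ^ 3" "\<bar>R (v-3)\<bar> \<le> \<bar>t\<bar> ^ 3" by auto
  moreover have "\<bar>(a - 3 * b + 3 * c - d) / 6\<bar> \<le> 2 * k"
    if "\<bar>a\<bar> \<le> k" "\<bar>b\<bar> \<le> k" "\<bar>c\<bar> \<le> k" "\<bar>d\<bar> \<le> k" for a b c d k :: real
  proof -
    have "k \<ge> 0" using that(1) by linarith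
    with that have "\<bar>a - 3 * b + 3 * c - d\<bar> \<le> 12 * k" by linarith
    then show ?thesis by simp
  qed
  ultimately show ?thesis by presburger
qed

lemma spl_zero: "v \<le> 0 \<Longrightarrow> spl v = 0" "v \<le> 0 \<Longrightarrow> spl1 v = 0" "v \<le> 0 \<Longrightarrow> spl2 v = 0"
  by (auto simp: spl_def spl1_def spl2_def cub_def)

lemma spl_one: "v \<ge> 3 \<Longrightarrow> spl v = 1" "v \<ge> 3 \<Longrightarrow> spl1 v = 0" "v \<ge> 3 \<Longrightarrow> spl2 v = 0"
  by (auto simp: spl_def spl1_def spl2_def cub_def power3_eq_cube power2_eq_square algebra_simps)

lemma spl2_bounds: "\<bar>spl2 v\<bar> \<le> 1"
  by (auto simp: spl2_def max_def)

lemma spl1_bounds: "\<bar>spl1 v\<bar> \<le> 1"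
proof -
  consider "v \<le> 0 \<or> v \<ge> 3" | "0 \<le> v" "v \<le> 1" | "1 \<le> v" "v \<le> 2" | "2 \<le> v" "v \<le> 3" by linarith
  then show ?thesis
  proof cases
    case 2
    then have "spl1 v = v\<^sup>2 / 2" by (simp add: spl1_def)
    then show ?thesis using power_le_one[OF 2, of 2] zero_le_power[OF 2(1), of 2] by linarith
  next
    case 3
    then have "spl1 v = 3 / 4 - (v - 3 / 2)\<^sup>2" by (simp add: spl1_def power2_eq_square field_simps)
    moreover have "\<bar>v - 3 / 2\<bar>\<^sup>2 \<le> (1/2)\<^sup>2" using 3 by (intro power_mono) (linarith, simp)
    then have "(v - 3 / 2)\<^sup>2 \<le> 1 / 4" by (simp add: power_divide)
    ultimately show ?thesis using zero_le_power2[of "v - 3 / 2"] by linarith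
  next
    case 4
    then have "spl1 v = (3 - v)\<^sup>2 / 2" by (simp add: spl1_def power2_eq_square field_simps)
    moreover have "(3 - v)\<^sup>2 \<le> 1" using 4 by (intro power_le_one) auto
    ultimately show ?thesis using zero_le_power2[of "3 - v"] by linarith
  qed (auto simp: spl_zero spl_one)
qed

lemma spl_bounds: "0 \<le> spl v" "spl v \<le> 1"
proof -
  have "0 \<le> spl v \<and> spl v \<le> 1"
  proof -
    consider "v \<le> 0 \<or> v \<ge> 3" | "0 \<le> v" "v \<le> 1" | "1 \<le> v" "v \<le> 2" | "2 \<le> v" "v \<le> 3" by linarith
    then show ?thesis
    proof cases
      case 2
      then have "spl v = v ^ 3 / 6" by (simp add: spl_def cub_def)
      then show ?thesis using power_le_one[OF 2, of 3] zero_le_power[OF 2(1), of 3] by (intro conjI; linarith)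
    next
      case 3
      then have "spl v = 1 / 2 + (v - 3 / 2) * (3 / 4 - (v - 3 / 2)\<^sup>2 / 3)"
        by (simp add: spl_def cub_def power3_eq_cube power2_eq_square field_simps)
      moreover have "\<bar>v - 3 / 2\<bar> * \<bar>3 / 4 - (v - 3 / 2)\<^sup>2 / 3\<bar> \<le> 1/2 * 1"
      proof (intro mult_mono)
        have "\<bar>v - 3 / 2\<bar>\<^sup>2 \<le> (1/2)\<^sup>2" using 3 by (intro power_mono) (linarith, simp)
        then have "(v - 3 / 2)\<^sup>2 \<le> 1 / 4" by (simp add: power_divide)
        then show "\<bar>3 / 4 - (v - 3 / 2)\<^sup>2 / 3\<bar> \<le> 1" using zero_le_power2[of "v - 3 / 2"] by linarith
      qed (use 3 in linarith, simp_all)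
      ultimately show ?thesis unfolding abs_mult[symmetric] abs_le_iff by (intro conjI; linarith)
    next
      case 4
      then have "spl v = 1 - (3 - v) ^ 3 / 6" by (simp add: spl_def cub_def power3_eq_cube field_simps)
      moreover have "(3 - v) ^ 3 \<le> 1" "0 \<le> (3 - v) ^ 3" using 4 by (auto intro!: power_le_one)
      ultimately show ?thesis by simp
    qed (auto simp: spl_zero spl_one)
  qed
  then show "0 \<le> spl v" "spl v \<le> 1" by auto
qed

text \<open>Interpolation: for \<open>|t| \<le> 1\<close> the cubic remainder is at most a multiple
  of \<open>|t| powr q\<close>; for larger \<open>|t|\<close> boundedness of the step and of its
  derivatives suffices. Hence moments of order \<open>q\<close> will do.\<close>

lemma spl_remainder:
  assumes q: "2 \<le> q" "q \<le> 3"
  shows "\<bar>spl (v + t) - spl v - t * spl1 v - t\<^sup>2 / 2 * spl2 v\<bar> \<le> 3 * \<bar>t\<bar> powr q"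
proof (cases "\<bar>t\<bar> \<le> 1")
  case True
  have "\<bar>t\<bar> ^ 3 \<le> \<bar>t\<bar> powr q"
    using True q powr_mono'[of q 3 "\<bar>t\<bar>"] by (cases "t = 0") (auto simp: powr_numeral)
  then have "2 * \<bar>t\<bar> ^ 3 \<le> 3 * \<bar>t\<bar> powr q" by (smt (verit) powr_ge_zero)
  with spl_taylor[of v t] show ?thesis by linarith
next
  case False
  have a: "\<bar>t\<bar> \<le> \<bar>t\<bar> powr q" "t\<^sup>2 \<le> \<bar>t\<bar> powr q" "1 \<le> \<bar>t\<bar> powr q"
    using False q powr_mono[of 1 q "\<bar>t\<bar>"] powr_mono[of 2 q "\<bar>t\<bar>"] by (auto simp: ge_one_powr_ge_zero)
  have "\<bar>t * spl1 v\<bar> \<le> \<bar>t\<bar>" "\<bar>t\<^sup>2 * spl2 v\<bar> \<le> t\<^sup>2"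
    unfolding abs_mult using spl1_bounds[of v] spl2_bounds[of v] by (auto simp: mult_left_le)
  then have "\<bar>spl (v + t) - spl v - t * spl1 v - t\<^sup>2 / 2 * spl2 v\<bar> \<le> 1 + \<bar>t\<bar> + t\<^sup>2 / 2"
    using spl_bounds[of v] spl_bounds[of "v + t"] by (simp only: times_divide_eq_left)
  with a show ?thesis by linarith
qed

text \<open>A second order expansion whose coefficients and remainder carry the weight \<open>exp (L * u)\<close>.
  Unlike differentiability, this property is inherited by Gaussian averages by mere integration.\<close>

definition exp_taylor :: "real \<Rightarrow> real \<Rightarrow> real \<Rightarrow> (real \<Rightarrow> real) \<Rightarrow> bool" where
  "exp_taylor L q B f \<longleftrightarrow> f \<in> borel_measurable borel \<and> (\<forall>u. \<bar>f u\<bar> \<le> 1) \<and>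
    (\<exists>f1\<in>borel_measurable borel. \<exists>f2\<in>borel_measurable borel. \<forall>u.
      \<bar>f1 u\<bar> \<le> B * exp (L * u) \<and> \<bar>f2 u\<bar> \<le> B * exp (L * u) \<and>
      (\<forall>t. \<bar>f (u + t) - f u - t * f1 u - t\<^sup>2 / 2 * f2 u\<bar> \<le> B * exp (L * u) * (\<bar>t\<bar> powr q * exp (L * max t 0))))"

text \<open>The expansion error vanishes unless \<open>u + max t 0 > x\<close>, and then the factor
  \<open>exp (L * (u + max t 0 - x)) \<ge> 1\<close> can be inserted for free. Since
  \<open>h \<le> 1\<close>, the power \<open>1 / h ^ 3\<close> covers all powers of
  \<open>1 / h\<close> caused by rescaling.\<close>

lemma exp_taylor_spline:
  assumes q: "2 \<le> q" "q \<le> 3" and h: "0 < h" "h \<le> 1" and L: "L \<ge> 0"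
  shows "exp_taylor L q (3 / h ^ 3 * exp (- L * x)) (\<lambda>u. spl ((u - x) / h))"
  unfolding exp_taylor_def
proof (intro conjI allI bexI)
  show "(\<lambda>u. spl ((u - x) / h)) \<in> borel_measurable borel" by measurable
  show "(\<lambda>u. spl2 ((u - x) / h) / h\<^sup>2) \<in> borel_measurable borel" by measurable
  show "(\<lambda>u. spl1 ((u - x) / h) / h) \<in> borel_measurable borel" by measurable
  show "\<bar>spl ((u - x) / h)\<bar> \<le> 1" for u using spl_bounds[of "(u - x) / h"] by auto
  have ee: "3 / h ^ 3 * exp (- L * x) * exp (L * u) = 3 / h ^ 3 * exp (L * (u - x))" for u
    by (simp add: exp_diff exp_minus field_simps)
  have hh: "h ^ 3 \<le> h" "h ^ 3 \<le> h\<^sup>2" using h power_decreasing[of 1 3 h] power_decreasing[of 2 3 h] by auto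
  show "\<bar>spl1 ((u - x) / h) / h\<bar> \<le> 3 / h ^ 3 * exp (- L * x) * exp (L * u)" for u
  proof (cases "u \<le> x")
    case False
    have "\<bar>spl1 ((u - x) / h)\<bar> / h \<le> 1 / h ^ 3" using spl1_bounds h hh by (intro frac_le) auto
    also have "\<dots> \<le> 3 / h ^ 3 * 1" using h by (simp add: divide_right_mono)
    also have "\<dots> \<le> 3 / h ^ 3 * exp (L * (u - x))" using False L h by (intro mult_left_mono) auto
    finally show ?thesis unfolding ee using h by simp
  qed (use h in \<open>simp add: spl_zero divide_le_0_iff\<close>)
  show "\<bar>spl2 ((u - x) / h) / h\<^sup>2\<bar> \<le> 3 / h ^ 3 * exp (- L * x) * exp (L * u)" for u
  proof (cases "u \<le> x")
    case False
    have "\<bar>spl2 ((u - x) / h)\<bar> / h\<^sup>2 \<le> 1 / h ^ 3" using spl2_bounds h hh by (intro frac_le) auto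
    also have "\<dots> \<le> 3 / h ^ 3 * 1" using h by (simp add: divide_right_mono)
    also have "\<dots> \<le> 3 / h ^ 3 * exp (L * (u - x))" using False L h by (intro mult_left_mono) auto
    finally show ?thesis unfolding ee using h by simp
  qed (use h in \<open>simp add: spl_zero divide_le_0_iff\<close>)
  fix u t
  have eq: "(u + t - x) / h = (u - x) / h + t / h" "t * (spl1 ((u - x) / h) / h) = t / h * spl1 ((u - x) / h)"
    "t\<^sup>2 / 2 * (spl2 ((u - x) / h) / h\<^sup>2) = (t / h)\<^sup>2 / 2 * spl2 ((u - x) / h)"
    using h by (auto simp: field_simps power2_eq_square)
  show "\<bar>spl ((u + t - x) / h) - spl ((u - x) / h) - t * (spl1 ((u - x) / h) / h) - t\<^sup>2 / 2 * (spl2 ((u - x) / h) / h\<^sup>2)\<bar>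
       \<le> 3 / h ^ 3 * exp (- L * x) * exp (L * u) * (\<bar>t\<bar> powr q * exp (L * max t 0))"
  proof (cases "u + max t 0 \<le> x")
    case True
    then have "(u - x) / h \<le> 0" "(u + t - x) / h \<le> 0" using h by (auto simp: divide_le_0_iff)
    then show ?thesis using h by (simp add: spl_zero)
  next
    case False
    have "\<bar>spl ((u + t - x) / h) - spl ((u - x) / h) - t * (spl1 ((u - x) / h) / h) - t\<^sup>2 / 2 * (spl2 ((u - x) / h) / h\<^sup>2)\<bar>
       \<le> 3 * \<bar>t / h\<bar> powr q" unfolding eq by (rule spl_remainder[OF q])
    also have "\<bar>t / h\<bar> powr q = \<bar>t\<bar> powr q / h powr q" using h by (simp add: powr_divide)
    also have "\<dots> \<le> \<bar>t\<bar> powr q / h ^ 3"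
      using h q powr_mono'[of q 3 h] by (intro divide_left_mono) (auto simp: powr_numeral)
    finally have "\<bar>spl ((u + t - x) / h) - spl ((u - x) / h) - t * (spl1 ((u - x) / h) / h) - t\<^sup>2 / 2 * (spl2 ((u - x) / h) / h\<^sup>2)\<bar>
       \<le> 3 / h ^ 3 * \<bar>t\<bar> powr q * 1" by simp
    also have "\<dots> \<le> 3 / h ^ 3 * \<bar>t\<bar> powr q * exp (L * (u + max t 0 - x))"
      using False L h by (intro mult_left_mono) auto
    also have "exp (L * (u + max t 0 - x)) = exp (- L * x) * exp (L * u) * exp (L * max t 0)"
      by (simp add: exp_diff exp_add exp_minus field_simps)
    finally show ?thesis by (simp add: mult_ac)
  qed
qed

text \<open>The weight \<open>exp (L * (u + s * z))\<close> integrates to \<open>exp (L * u)\<close>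
  times the Gaussian moment generating function at \<open>L * s\<close>; this is the only change in
  the constant.\<close>

lemma exp_taylor_gauss_average:
  assumes f: "exp_taylor L q B f" and B: "B \<ge> 0"
  shows "exp_taylor L q (B * exp (L\<^sup>2 * s\<^sup>2 / 2)) (\<lambda>u. LINT z|gauss. f (u + s * z))"
proof -
  obtain f1 f2 where [measurable]: "f \<in> borel_measurable borel" "f1 \<in> borel_measurable borel" "f2 \<in> borel_measurable borel"
    and b: "\<And>u. \<bar>f u\<bar> \<le> 1" "\<And>u. \<bar>f1 u\<bar> \<le> B * exp (L * u)" "\<And>u. \<bar>f2 u\<bar> \<le> B * exp (L * u)"
    and T: "\<And>u t. \<bar>f (u + t) - f u - t * f1 u - t\<^sup>2 / 2 * f2 u\<bar> \<le> B * exp (L * u) * (\<bar>t\<bar> powr q * exp (L * max t 0))"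
    using f unfolding exp_taylor_def by blast
  have i: "integrable gauss (\<lambda>z. f (u + s * z))" for u
    by (rule gauss.integrable_const_bound[where B=1]) (use b in auto)
  have E: "exp (L * (u + s * z)) = exp (L * u) * exp ((L * s) * z)" for u z
    by (simp add: exp_add[symmetric] algebra_simps)
  have Ei: "integrable gauss (\<lambda>z. k * exp (L * (u + s * z)))" for u k
    unfolding E by (intro integrable_mult_right gauss_exp)
  have EI: "(LINT z|gauss. k * exp (L * (u + s * z))) = k * exp (L * u) * exp (L\<^sup>2 * s\<^sup>2 / 2)" for k u
    unfolding E by (simp add: gauss_exp power_mult_distrib)
  have i1: "integrable gauss (\<lambda>z. g (u + s * z))"
    and n1: "\<bar>LINT z|gauss. g (u + s * z)\<bar> \<le> B * exp (L\<^sup>2 * s\<^sup>2 / 2) * exp (L * u)"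
    if [measurable]: "g \<in> borel_measurable borel" and g: "\<And>u. \<bar>g u\<bar> \<le> B * exp (L * u)" for g u
  proof -
    show *: "integrable gauss (\<lambda>z. g (u + s * z))"
      by (rule Bochner_Integration.integrable_bound[OF Ei[of B u]]) (use g B in \<open>auto simp: abs_mult\<close>)
    have "\<bar>LINT z|gauss. g (u + s * z)\<bar> \<le> (LINT z|gauss. B * exp (L * (u + s * z)))"
      by (rule order_trans[OF integral_norm_bound[of gauss "\<lambda>z. g (u + s * z)", unfolded real_norm_def] integral_mono[OF _ Ei]])
         (use g * in auto)
    then show "\<bar>LINT z|gauss. g (u + s * z)\<bar> \<le> B * exp (L\<^sup>2 * s\<^sup>2 / 2) * exp (L * u)"
      unfolding EI by (simp add: mult_ac)
  qed
  note j1 = i1[of f1, OF _ b(2), simplified] and j2 = i1[of f2, OF _ b(3), simplified]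
  show ?thesis
    unfolding exp_taylor_def
  proof (intro conjI allI bexI)
    show "(\<lambda>u. LINT z|gauss. f (u + s * z)) \<in> borel_measurable borel" by measurable
    show "(\<lambda>u. LINT z|gauss. f2 (u + s * z)) \<in> borel_measurable borel" by measurable
    show "(\<lambda>u. LINT z|gauss. f1 (u + s * z)) \<in> borel_measurable borel" by measurable
    show "\<bar>LINT z|gauss. f (u + s * z)\<bar> \<le> 1" for u
      using gauss.integral_le_const[OF i[of u], of 1] gauss.integral_ge_const[OF i[of u], of "-1"] b(1)
      by (auto simp: abs_le_iff minus_le_iff)
    show "\<bar>LINT z|gauss. f1 (u + s * z)\<bar> \<le> B * exp (L\<^sup>2 * s\<^sup>2 / 2) * exp (L * u)" for u
      by (rule n1) (use b in auto)
    show "\<bar>LINT z|gauss. f2 (u + s * z)\<bar> \<le> B * exp (L\<^sup>2 * s\<^sup>2 / 2) * exp (L * u)" for u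
      by (rule n1) (use b in auto)
    fix u t
    let ?R = "\<bar>t\<bar> powr q * exp (L * max t 0)"
    let ?D = "\<lambda>z. f (u + s * z + t) - f (u + s * z) - t * f1 (u + s * z) - t\<^sup>2 / 2 * f2 (u + s * z)"
    have c: "u + t + s * z = u + s * z + t" for z by simp
    have D: "(LINT z|gauss. f (u + t + s * z)) - (LINT z|gauss. f (u + s * z)) - t * (LINT z|gauss. f1 (u + s * z)) -
        t\<^sup>2 / 2 * (LINT z|gauss. f2 (u + s * z)) = (LINT z|gauss. ?D z)"
      using i[of u] i[of "u + t"] j1[of u] j2[of u] unfolding c by simp
    have "\<bar>LINT z|gauss. ?D z\<bar> \<le> (LINT z|gauss. B * ?R * exp (L * (u + s * z)))"
    proof (rule order_trans[OF integral_norm_bound[of gauss ?D, unfolded real_norm_def] integral_mono[OF _ Ei]])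
      show "integrable gauss (\<lambda>z. \<bar>?D z\<bar>)"
        using i[of u] i[of "u + t"] j1[of u] j2[of u] unfolding c by (intro integrable_abs) auto
      show "\<bar>?D z\<bar> \<le> B * ?R * exp (L * (u + s * z))" for z
        using T[of "u + s * z" t] by (simp add: mult_ac)
    qed
    also have "\<dots> = B * exp (L\<^sup>2 * s\<^sup>2 / 2) * exp (L * u) * ?R"
      unfolding EI by (simp add: mult_ac)
    finally show "\<bar>(LINT z|gauss. f (u + t + s * z)) - (LINT z|gauss. f (u + s * z)) - t * (LINT z|gauss. f1 (u + s * z)) -
        t\<^sup>2 / 2 * (LINT z|gauss. f2 (u + s * z))\<bar> \<le> B * exp (L\<^sup>2 * s\<^sup>2 / 2) * exp (L * u) * ?R"
      unfolding D .
  qed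
qed

text \<open>Both expectations are expanded at the same \<open>u\<close> with the same coefficients,
  so only the discrepancies of the first two moments and the two remainders survive. The moments are
  not assumed equal, because truncation disturbs them.\<close>

lemma exp_taylor_compare:
  assumes f: "exp_taylor L q B f" and B: "B \<ge> 0"
    and P: "prob_space P" and Y[measurable]: "Y \<in> borel_measurable P"
      "integrable P Y" "integrable P (\<lambda>w. (Y w)\<^sup>2)" "integrable P (\<lambda>w. \<bar>Y w\<bar> powr q * exp (L * max (Y w) 0))"
    and P': "prob_space P'" and Y'[measurable]: "Y' \<in> borel_measurable P'"
      "integrable P' Y'" "integrable P' (\<lambda>w. (Y' w)\<^sup>2)" "integrable P' (\<lambda>w. \<bar>Y' w\<bar> powr q * exp (L * max (Y' w) 0))"
  shows "\<bar>(LINT w|P. f (u + Y w)) - (LINT w|P'. f (u + Y' w))\<bar> \<le> B * exp (L * u) *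
    (\<bar>(LINT w|P. Y w) - (LINT w|P'. Y' w)\<bar> + \<bar>(LINT w|P. (Y w)\<^sup>2) - (LINT w|P'. (Y' w)\<^sup>2)\<bar> / 2 +
      (LINT w|P. \<bar>Y w\<bar> powr q * exp (L * max (Y w) 0)) + (LINT w|P'. \<bar>Y' w\<bar> powr q * exp (L * max (Y' w) 0)))"
proof -
  obtain f1 f2 where [measurable]: "f \<in> borel_measurable borel"
    and b: "\<And>u. \<bar>f u\<bar> \<le> 1" "\<And>u. \<bar>f1 u\<bar> \<le> B * exp (L * u)" "\<And>u. \<bar>f2 u\<bar> \<le> B * exp (L * u)"
    and T: "\<And>u t. \<bar>f (u + t) - f u - t * f1 u - t\<^sup>2 / 2 * f2 u\<bar> \<le> B * exp (L * u) * (\<bar>t\<bar> powr q * exp (L * max t 0))"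
    using f unfolding exp_taylor_def by blast
  have one: "\<bar>(LINT w|P. f (u + Y w)) - (f u + f1 u * (LINT w|P. Y w) + f2 u / 2 * (LINT w|P. (Y w)\<^sup>2))\<bar>
      \<le> B * exp (L * u) * (LINT w|P. \<bar>Y w\<bar> powr q * exp (L * max (Y w) 0))"
    if P: "prob_space P" and Y[measurable]: "Y \<in> borel_measurable P" and i:
      "integrable P Y" "integrable P (\<lambda>w. (Y w)\<^sup>2)" "integrable P (\<lambda>w. \<bar>Y w\<bar> powr q * exp (L * max (Y w) 0))"
    for P :: "'x measure" and Y
  proof -
    interpret prob_space P by fact
    have i0: "integrable P (\<lambda>w. f (u + Y w))"
      by (rule integrable_const_bound[where B=1]) (use b in auto)
    let ?D = "\<lambda>w. f (u + Y w) - f u - Y w * f1 u - (Y w)\<^sup>2 / 2 * f2 u"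
    have iD: "integrable P ?D" using i0 i by auto
    have D: "(LINT w|P. f (u + Y w)) - (f u + f1 u * (LINT w|P. Y w) + f2 u / 2 * (LINT w|P. (Y w)\<^sup>2)) = (LINT w|P. ?D w)"
      using i0 i by (simp add: prob_space)
    have "\<bar>LINT w|P. ?D w\<bar> \<le> (LINT w|P. B * exp (L * u) * (\<bar>Y w\<bar> powr q * exp (L * max (Y w) 0)))"
      using T iD i by (intro order_trans[OF integral_norm_bound[of P ?D, unfolded real_norm_def] integral_mono]) auto
    then show ?thesis unfolding D by simp
  qed
  note A = one[OF P Y] and A' = one[OF P' Y']
  let ?m = "(LINT w|P. Y w) - (LINT w|P'. Y' w)" and ?v = "(LINT w|P. (Y w)\<^sup>2) - (LINT w|P'. (Y' w)\<^sup>2)"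
  have "\<bar>f1 u * ?m\<bar> \<le> B * exp (L * u) * \<bar>?m\<bar>" "\<bar>f2 u / 2 * ?v\<bar> \<le> B * exp (L * u) * (\<bar>?v\<bar> / 2)"
    unfolding abs_mult using b by (auto intro!: mult_right_mono)
  with A A' show ?thesis unfolding distrib_left right_diff_distrib by linarith
qed

context prob_space
begin

lemma indep_expectation:
  fixes h :: "real \<Rightarrow> real \<Rightarrow> real"
  assumes ind: "indep_var borel Y borel Z" and [measurable]: "(\<lambda>(y, z). h y z) \<in> borel_measurable (borel \<Otimes>\<^sub>M borel)"
    and bdd: "\<And>y z. \<bar>h y z\<bar> \<le> B"
  shows "expectation (\<lambda>\<omega>. h (Y \<omega>) (Z \<omega>)) = (LINT y|distr M borel Y. expectation (\<lambda>\<omega>. h y (Z \<omega>)))"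
proof -
  have [measurable]: "Y \<in> borel_measurable M" "Z \<in> borel_measurable M"
    using indep_var_rv1[OF ind] indep_var_rv2[OF ind] by auto
  interpret DY: prob_space "distr M borel Y" by (rule prob_space_distr) simp
  interpret DZ: prob_space "distr M borel Z" by (rule prob_space_distr) simp
  interpret P: pair_prob_space "distr M borel Y" "distr M borel Z" ..
  have "expectation (\<lambda>\<omega>. h (Y \<omega>) (Z \<omega>)) = (LINT p|distr M (borel \<Otimes>\<^sub>M borel) (\<lambda>\<omega>. (Y \<omega>, Z \<omega>)). (\<lambda>(y, z). h y z) p)"
    by (subst integral_distr) auto
  also have "\<dots> = (LINT p|(distr M borel Y \<Otimes>\<^sub>M distr M borel Z). (\<lambda>(y, z). h y z) p)"
    using ind by (simp add: indep_var_distribution_eq)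
  also have "\<dots> = (LINT y|distr M borel Y. LINT z|distr M borel Z. h y z)"
  proof -
    have "integrable (distr M borel Y \<Otimes>\<^sub>M distr M borel Z) (\<lambda>(y, z). h y z)"
      by (rule P.integrable_const_bound[where B=B]) (use bdd in auto)
    from P.integral_fst'[OF this] show ?thesis by simp
  qed
  also have "(\<lambda>y. LINT z|distr M borel Z. h y z) = (\<lambda>y. expectation (\<lambda>\<omega>. h y (Z \<omega>)))"
    by (intro ext integral_distr) auto
  finally show ?thesis .
qed

end

context iid_std
begin

text \<open>Induction on \<open>F\<close>, removing the summand \<open>j\<close>. The sum over the
  rest is replaced by its Gaussian counterpart at the random starting point
  \<open>u + g j y\<close>, then \<open>g j\<close> itself is replaced. The exponential weight makes
  the first error grow by \<open>exp (L * g j y)\<close>, whose mean is controlled by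
  \<open>e j\<close>, so the factors multiply up to
  \<open>exp (L^2 * \<Sum>c^2 / 2 + \<Sum>e)\<close>.\<close>

lemma lindeberg_exp:
  assumes F: "finite F" and q: "2 \<le> q" and L: "L \<ge> 0"
    and g[measurable]: "\<And>i. g i \<in> borel_measurable borel"
    and c: "\<And>i. i \<in> F \<Longrightarrow> c i \<ge> 0"
    and gi: "\<And>i. i \<in> F \<Longrightarrow> integrable \<mu> (g i)" "\<And>i. i \<in> F \<Longrightarrow> integrable \<mu> (\<lambda>x. (g i x)\<^sup>2)"
      "\<And>i. i \<in> F \<Longrightarrow> integrable \<mu> (\<lambda>x. \<bar>g i x\<bar> powr q * exp (L * max (g i x) 0))"
      "\<And>i. i \<in> F \<Longrightarrow> integrable \<mu> (\<lambda>x. exp (L * g i x))"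
    and ci: "\<And>i. i \<in> F \<Longrightarrow> integrable gauss (\<lambda>z. \<bar>c i * z\<bar> powr q * exp (L * max (c i * z) 0))"
    and d: "\<And>i. i \<in> F \<Longrightarrow> \<bar>LINT x|\<mu>. g i x\<bar> + \<bar>(LINT x|\<mu>. (g i x)\<^sup>2) - (c i)\<^sup>2\<bar> / 2 +
      (LINT x|\<mu>. \<bar>g i x\<bar> powr q * exp (L * max (g i x) 0)) +
      (LINT z|gauss. \<bar>c i * z\<bar> powr q * exp (L * max (c i * z) 0)) \<le> d i"
    and e: "\<And>i. i \<in> F \<Longrightarrow> (LINT x|\<mu>. exp (L * g i x)) \<le> exp (L\<^sup>2 * (c i)\<^sup>2 / 2 + e i)"
    and e0: "\<And>i. i \<in> F \<Longrightarrow> e i \<ge> 0"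
    and f: "exp_taylor L q B f" and B: "B \<ge> 0"
  shows "\<bar>expectation (\<lambda>\<omega>. f (u + (\<Sum>i\<in>F. g i (X i \<omega>)))) - (LINT z|gauss. f (u + sqrt (\<Sum>i\<in>F. (c i)\<^sup>2) * z))\<bar>
    \<le> B * exp (L * u) * exp (L\<^sup>2 * (\<Sum>i\<in>F. (c i)\<^sup>2) / 2 + (\<Sum>i\<in>F. e i)) * (\<Sum>i\<in>F. d i)"
  using F c gi ci d e e0
proof (induction F arbitrary: u)
  case empty
  then show ?case by (simp add: prob_space gauss.prob_space[simplified])
next
  case (insert j F)
  have fm[measurable]: "f \<in> borel_measurable borel" and fb: "\<And>u. \<bar>f u\<bar> \<le> 1"
    using f unfolding exp_taylor_def by auto
  define s where "s = sqrt (\<Sum>i\<in>F. (c i)\<^sup>2)"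
  have s: "s \<ge> 0" "s\<^sup>2 = (\<Sum>i\<in>F. (c i)\<^sup>2)" by (auto simp: s_def sum_nonneg)
  define K where "K = exp (L\<^sup>2 * (\<Sum>i\<in>F. (c i)\<^sup>2) / 2 + (\<Sum>i\<in>F. e i)) * (\<Sum>i\<in>F. d i)"
  define Gf where "Gf v = (LINT z|gauss. f (v + s * z))" for v
  have Gf: "exp_taylor L q (B * exp (L\<^sup>2 * s\<^sup>2 / 2)) Gf"
    unfolding Gf_def by (rule exp_taylor_gauss_average[OF f B])
  have Gm[measurable]: "Gf \<in> borel_measurable borel" and Gb: "\<And>u. \<bar>Gf u\<bar> \<le> 1"
    using Gf unfolding exp_taylor_def by auto
  define Ef where "Ef v = expectation (\<lambda>\<omega>. f (v + (\<Sum>i\<in>F. g i (X i \<omega>))))" for v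
  have Em[measurable]: "Ef \<in> borel_measurable borel" unfolding Ef_def by measurable
  have IH: "\<bar>Ef v - Gf v\<bar> \<le> B * exp (L * v) * K" for v
    using insert.IH[of v] insert.prems unfolding Ef_def Gf_def s_def K_def by (simp add: mult.assoc)
  have Eb: "\<bar>Ef v\<bar> \<le> 1" for v
  proof -
    have "integrable M (\<lambda>\<omega>. f (v + (\<Sum>i\<in>F. g i (X i \<omega>))))"
      by (rule integrable_const_bound[where B=1]) (use fb in auto)
    from integral_le_const[OF this, of 1] integral_ge_const[OF this, of "-1"] show ?thesis
      unfolding Ef_def using fb by (auto simp: abs_le_iff minus_le_iff)
  qed
  have ind: "indep_var borel (X j) borel (\<lambda>\<omega>. \<Sum>i\<in>F. g i (X i \<omega>))"
  proof -
    \<comment> \<open>Choosing the identity at \<open>j\<close> and \<open>g i\<close> elsewhere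
      keeps \<open>X j\<close> itself independent of the transformed rest.\<close>
    have "indep_var borel ((\<lambda>x. (if j = j then id else g j) (X j x))) borel (\<lambda>\<omega>. \<Sum>i\<in>F. (if i = j then id else g i) (X i \<omega>))"
      using insert.hyps by (intro indep_term_sum) auto
    moreover have "(\<lambda>\<omega>. \<Sum>i\<in>F. (if i = j then id else g i) (X i \<omega>)) = (\<lambda>\<omega>. \<Sum>i\<in>F. g i (X i \<omega>))"
      using insert.hyps by (intro ext sum.cong) auto
    ultimately show ?thesis by simp
  qed
  have "expectation (\<lambda>\<omega>. f (u + (\<Sum>i\<in>insert j F. g i (X i \<omega>)))) =
      expectation (\<lambda>\<omega>. (\<lambda>y z. f (u + g j y + z)) (X j \<omega>) (\<Sum>i\<in>F. g i (X i \<omega>)))"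
    using insert.hyps by (simp add: add.assoc)
  also have "\<dots> = (LINT y|\<mu>. Ef (u + g j y))"
    unfolding Ef_def law[of j, symmetric]
    by (rule indep_expectation[OF ind, where B=1]) (use fb in auto)
  finally have 1: "expectation (\<lambda>\<omega>. f (u + (\<Sum>i\<in>insert j F. g i (X i \<omega>)))) = (LINT y|\<mu>. Ef (u + g j y))" .
  have iE: "integrable \<mu> (\<lambda>y. Ef (u + g j y))" "integrable \<mu> (\<lambda>y. Gf (u + g j y))"
    by (rule mu.integrable_const_bound[where B=1]; use Eb Gb in auto)+
  have ex: "exp (L * (u + g j y)) = exp (L * u) * exp (L * g j y)" for y by (simp add: exp_add[symmetric] algebra_simps)
  have d0: "d i \<ge> 0" if "i \<in> insert j F" for i
    using insert.prems(7)[OF that] by (rule order_trans[rotated]) (auto intro!: add_nonneg_nonneg integral_nonneg)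
  have K0: "K \<ge> 0" unfolding K_def using d0 by (auto intro!: mult_nonneg_nonneg sum_nonneg)
  \<comment> \<open>First error: the induction hypothesis at \<open>u + g j y\<close>, averaged over
    \<open>y\<close>.\<close>
  have "\<bar>(LINT y|\<mu>. Ef (u + g j y)) - (LINT y|\<mu>. Gf (u + g j y))\<bar> = \<bar>LINT y|\<mu>. Ef (u + g j y) - Gf (u + g j y)\<bar>"
    using iE by simp
  also have "\<dots> \<le> (LINT y|\<mu>. B * exp (L * u) * K * exp (L * g j y))"
  proof (rule order_trans[OF integral_norm_bound[of \<mu> "\<lambda>y. Ef (u + g j y) - Gf (u + g j y)", unfolded real_norm_def] integral_mono])
    show "integrable \<mu> (\<lambda>y. \<bar>Ef (u + g j y) - Gf (u + g j y)\<bar>)" using iE by auto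
    show "integrable \<mu> (\<lambda>y. B * exp (L * u) * K * exp (L * g j y))" using insert.prems(5)[of j] by auto
    show "\<bar>Ef (u + g j y) - Gf (u + g j y)\<bar> \<le> B * exp (L * u) * K * exp (L * g j y)" for y
      using IH[of "u + g j y"] unfolding ex by (simp add: mult_ac)
  qed
  also have "\<dots> \<le> B * exp (L * u) * K * exp (L\<^sup>2 * (c j)\<^sup>2 / 2 + e j)"
    using insert.prems(8)[of j] B K0 by (simp add: mult_left_mono)
  also have "\<dots> = B * exp (L * u) * exp (L\<^sup>2 * (\<Sum>i\<in>insert j F. (c i)\<^sup>2) / 2 + (\<Sum>i\<in>insert j F. e i)) * (\<Sum>i\<in>F. d i)"
    using insert.hyps unfolding K_def by (simp add: exp_add[symmetric] add_divide_distrib algebra_simps)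
  finally have 2: "\<bar>(LINT y|\<mu>. Ef (u + g j y)) - (LINT y|\<mu>. Gf (u + g j y))\<bar> \<le>
    B * exp (L * u) * exp (L\<^sup>2 * (\<Sum>i\<in>insert j F. (c i)\<^sup>2) / 2 + (\<Sum>i\<in>insert j F. e i)) * (\<Sum>i\<in>F. d i)" .
  \<comment> \<open>Second error: one summand is exchanged, with the Gaussian average
    \<open>Gf\<close> as test function; its weight already contains the variance of the remaining
    Gaussians.\<close>
  have "\<bar>(LINT y|\<mu>. Gf (u + g j y)) - (LINT z|gauss. Gf (u + c j * z))\<bar> \<le> B * exp (L\<^sup>2 * s\<^sup>2 / 2) * exp (L * u) * d j"
  proof (rule order_trans[OF exp_taylor_compare[OF Gf _ prob_space_mu _ _ _ _ prob_space_gauss]])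
    show "B * exp (L\<^sup>2 * s\<^sup>2 / 2) * exp (L * u) *
      (\<bar>(LINT x|\<mu>. g j x) - (LINT z|gauss. c j * z)\<bar> + \<bar>(LINT x|\<mu>. (g j x)\<^sup>2) - (LINT z|gauss. (c j * z)\<^sup>2)\<bar> / 2 +
       (LINT x|\<mu>. \<bar>g j x\<bar> powr q * exp (L * max (g j x) 0)) + (LINT z|gauss. \<bar>c j * z\<bar> powr q * exp (L * max (c j * z) 0)))
      \<le> B * exp (L\<^sup>2 * s\<^sup>2 / 2) * exp (L * u) * d j"
      using insert.prems(7)[of j] B by (intro mult_left_mono) (auto simp: gauss_moments power_mult_distrib)
    show "0 \<le> B * exp (L\<^sup>2 * s\<^sup>2 / 2)" using B by simp
    show "g j \<in> borel_measurable \<mu>" by measurable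
    show "integrable \<mu> (g j)" "integrable \<mu> (\<lambda>x. (g j x)\<^sup>2)"
      "integrable \<mu> (\<lambda>x. \<bar>g j x\<bar> powr q * exp (L * max (g j x) 0))"
      by (rule insert.prems(2-4)[OF insertI1])+
    show "(\<lambda>z. c j * z) \<in> borel_measurable gauss" by measurable
    show "integrable gauss (\<lambda>z. c j * z)" "integrable gauss (\<lambda>z. (c j * z)\<^sup>2)"
      unfolding power_mult_distrib by (intro integrable_mult_right gauss_moments)+
    show "integrable gauss (\<lambda>z. \<bar>c j * z\<bar> powr q * exp (L * max (c j * z) 0))"
      by (rule insert.prems(6)[OF insertI1])
  qed
  also have "(LINT z|gauss. Gf (u + c j * z)) = (LINT z|gauss. f (u + sqrt (\<Sum>i\<in>insert j F. (c i)\<^sup>2) * z))"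
    unfolding Gf_def using insert.hyps
    by (subst gauss_convolution[OF fm fb]) (use s insert.prems(1)[of j] in auto)
  also have "B * exp (L\<^sup>2 * s\<^sup>2 / 2) * exp (L * u) * d j \<le>
      B * exp (L\<^sup>2 * (\<Sum>i\<in>insert j F. (c i)\<^sup>2) / 2 + (\<Sum>i\<in>insert j F. e i)) * exp (L * u) * d j"
  proof (intro mult_left_mono mult_right_mono)
    have "L\<^sup>2 * s\<^sup>2 \<le> L\<^sup>2 * (\<Sum>i\<in>insert j F. (c i)\<^sup>2)" using insert.hyps by (intro mult_left_mono) (auto simp: s)
    moreover have "(\<Sum>i\<in>insert j F. e i) \<ge> 0" using insert.prems(9) by (intro sum_nonneg)
    ultimately show "exp (L\<^sup>2 * s\<^sup>2 / 2) \<le> exp (L\<^sup>2 * (\<Sum>i\<in>insert j F. (c i)\<^sup>2) / 2 + (\<Sum>i\<in>insert j F. e i))" by simp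
  qed (use B d0 in auto)
  finally have 3: "\<bar>(LINT y|\<mu>. Gf (u + g j y)) - (LINT z|gauss. f (u + sqrt (\<Sum>i\<in>insert j F. (c i)\<^sup>2) * z))\<bar> \<le>
      B * exp (L * u) * exp (L\<^sup>2 * (\<Sum>i\<in>insert j F. (c i)\<^sup>2) / 2 + (\<Sum>i\<in>insert j F. e i)) * d j" by (simp add: mult_ac)
  have "(\<Sum>i\<in>insert j F. d i) = d j + (\<Sum>i\<in>F. d i)" using insert.hyps by simp
  then show ?case unfolding 1 using 2 3 by (simp only: distrib_left)
qed

end

section \<open>Moderate deviations of finite sums\<close>

text \<open>One-sided, and by \<open>0\<close> rather than by the level: so truncation never increases a sum.\<close>

definition trunc :: "real \<Rightarrow> real \<Rightarrow> real" where
  "trunc L y = (if L * y \<le> 1 then y else 0)"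

lemma trunc_measurable[measurable]: "trunc L \<in> borel_measurable borel"
  unfolding trunc_def[abs_def] by measurable

lemma trunc_le: "L > 0 \<Longrightarrow> trunc L y \<le> y"
  unfolding trunc_def using mult_nonneg_nonpos[of L y] by (cases "y \<ge> 0") auto

text \<open>An upper restriction on \<open>v\<close> suffices, in line with truncation from above
  only: below -1 the linear term is compensated by \<open>|v| powr q \<ge> |v|\<close>, and between
  -1 and 1 the third-order coefficient is at most \<open>exp 1 / 6 \<le> 1\<close>.\<close>

lemma exp_le_taylor:
  assumes q: "2 < q" "q \<le> 3" and v: "v \<le> (1::real)"
  shows "exp v \<le> 1 + v + v\<^sup>2 / 2 + \<bar>v\<bar> powr q"
proof (cases "v < - 1")
  case True
  have "\<bar>v\<bar> powr 1 \<le> \<bar>v\<bar> powr q" using True q by (intro powr_mono) auto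
  then have "- v \<le> \<bar>v\<bar> powr q" using True by simp
  moreover have "exp v \<le> 1" using True by simp
  moreover have "0 \<le> v\<^sup>2" by simp
  ultimately show ?thesis by linarith
next
  case False
  obtain t where t: "\<bar>t\<bar> \<le> \<bar>v\<bar>" "exp v = (\<Sum>m<3. v ^ m / fact m) + exp t / fact 3 * v ^ 3"
    using Maclaurin_exp_le[of v 3] by auto
  have s: "(\<Sum>m<3. v ^ m / fact m) = 1 + v + v\<^sup>2 / 2"
    by (simp add: numeral_3_eq_3 power2_eq_square)
  have "exp t \<le> exp 1" using t(1) False v by simp
  also have "\<dots> \<le> 6" using exp_le by simp
  finally have "exp t / fact 3 * \<bar>v\<bar> ^ 3 \<le> 1 * \<bar>v\<bar> ^ 3" by (intro mult_right_mono) (auto simp: fact_numeral)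
  moreover have "exp t / fact 3 * v ^ 3 \<le> exp t / fact 3 * \<bar>v\<bar> ^ 3"
    by (intro mult_left_mono) (auto simp: power_abs[symmetric] abs_ge_self)
  moreover have "\<bar>v\<bar> ^ 3 \<le> \<bar>v\<bar> powr q"
    using False v q powr_mono'[of q 3 "\<bar>v\<bar>"] by (cases "v = 0") (auto simp: powr_numeral)
  ultimately show ?thesis unfolding t(2) s by linarith
qed

text \<open>Where the truncation acts, \<open>L * y > 1\<close>, so any nonnegative power of
  \<open>L * y\<close> may be inserted to raise the order to \<open>q\<close>. Where it does not
  act, \<open>L * max y 0 \<le> 1\<close> and the exponential is at most 3.\<close>

lemma trunc_bounds:
  assumes L: "L > 0" and q: "2 < q" "q \<le> 3"
  shows "\<bar>y - trunc L y\<bar> \<le> L powr (q - 1) * \<bar>y\<bar> powr q"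
    "\<bar>y\<^sup>2 - (trunc L y)\<^sup>2\<bar> \<le> L powr (q - 2) * \<bar>y\<bar> powr q"
    "\<bar>trunc L y\<bar> powr q * exp (L * max (trunc L y) 0) \<le> 3 * \<bar>y\<bar> powr q"
    "0 \<le> l \<Longrightarrow> l \<le> L \<Longrightarrow> exp (l * trunc L y) \<le> 1 + l * y + l\<^sup>2 / 2 * y\<^sup>2 + l powr q * \<bar>y\<bar> powr q"
proof -
  have gt: "y > 0" "1 \<le> (L * y) powr r" if "L * y > 1" "r \<ge> 0" for r
  proof -
    show "y > 0" using that L by (metis less_trans zero_less_mult_pos zero_less_one)
    show "1 \<le> (L * y) powr r" using that by (intro ge_one_powr_ge_zero) auto
  qed
  show "\<bar>y - trunc L y\<bar> \<le> L powr (q - 1) * \<bar>y\<bar> powr q"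
  proof (cases "L * y \<le> 1")
    case False
    with gt[of "q - 1"] q have y: "y > 0" "1 \<le> (L * y) powr (q - 1)" by auto
    have "y * 1 \<le> y * (L * y) powr (q - 1)" using y by (intro mult_left_mono) auto
    also have "\<dots> = L powr (q - 1) * (y powr 1 * y powr (q - 1))" using y L by (simp add: powr_mult)
    also have "y powr 1 * y powr (q - 1) = y powr q" by (subst powr_add[symmetric]) simp
    finally show ?thesis using False y by (simp add: trunc_def)
  qed (simp add: trunc_def)
  show "\<bar>y\<^sup>2 - (trunc L y)\<^sup>2\<bar> \<le> L powr (q - 2) * \<bar>y\<bar> powr q"
  proof (cases "L * y \<le> 1")
    case False
    with gt[of "q - 2"] q have y: "y > 0" "1 \<le> (L * y) powr (q - 2)" by auto
    have "y\<^sup>2 * 1 \<le> y\<^sup>2 * (L * y) powr (q - 2)" using y by (intro mult_left_mono) auto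
    also have "\<dots> = L powr (q - 2) * (y powr 2 * y powr (q - 2))" using y L by (simp add: powr_mult powr_numeral)
    also have "y powr 2 * y powr (q - 2) = y powr q" by (subst powr_add[symmetric]) simp
    finally show ?thesis using False y by (simp add: trunc_def)
  qed (simp add: trunc_def)
  show "\<bar>trunc L y\<bar> powr q * exp (L * max (trunc L y) 0) \<le> 3 * \<bar>y\<bar> powr q"
  proof (cases "L * y \<le> 1")
    case True
    then have "L * max y 0 \<le> 1" by (simp add: max_def)
    then have "exp (L * max y 0) \<le> exp 1" by simp
    also have "\<dots> \<le> 3" by (rule exp_le)
    finally have "\<bar>y\<bar> powr q * exp (L * max y 0) \<le> \<bar>y\<bar> powr q * 3" by (intro mult_left_mono) auto
    then show ?thesis using True by (simp add: trunc_def mult.commute)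
  qed (simp add: trunc_def)
  show "exp (l * trunc L y) \<le> 1 + l * y + l\<^sup>2 / 2 * y\<^sup>2 + l powr q * \<bar>y\<bar> powr q" if l: "0 \<le> l" "l \<le> L"
  proof (cases "L * y \<le> 1")
    case True
    have "l * y \<le> 1"
    proof (cases "y \<ge> 0")
      case 2: True
      then have "l * y \<le> L * y" using l by (intro mult_right_mono) auto
      with True show ?thesis by simp
    next
      case False
      then have "l * y \<le> 0" using l by (intro mult_nonneg_nonpos) auto
      then show ?thesis by simp
    qed
    from exp_le_taylor[OF q this] show ?thesis
      using True l by (simp add: trunc_def power_mult_distrib abs_mult powr_mult)
  next
    case False
    with gt[of 1] have "y > 0" by auto
    then show ?thesis using False l by (simp add: trunc_def)
  qed
qed

section \<open>Truncated sums: moments, exponential bounds, large summands\<close>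

context iid_std
begin

definition T :: "real \<Rightarrow> ('i \<Rightarrow> real) \<Rightarrow> 'i set \<Rightarrow> 'a \<Rightarrow> real" where
  "T L c F \<omega> = (\<Sum>i\<in>F. trunc L (c i * X i \<omega>))"

lemma T_measurable[measurable]: "T L c F \<in> borel_measurable M"
  unfolding T_def by measurable

lemma T_le_S: "L > 0 \<Longrightarrow> T L c F \<omega> \<le> S c F \<omega>"
  unfolding T_def S_def by (intro sum_mono trunc_le)

lemma integrable_trunc:
  assumes L: "L > 0" and q: "2 < q" "q \<le> 3" and m: "integrable \<mu> (\<lambda>x. \<bar>x\<bar> powr q)" and c: "c \<ge> 0"
  shows "integrable \<mu> (\<lambda>x. trunc L (c * x))" "integrable \<mu> (\<lambda>x. (trunc L (c * x))\<^sup>2)"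
    "integrable \<mu> (\<lambda>x. \<bar>trunc L (c * x)\<bar> powr q * exp (L * max (trunc L (c * x)) 0))"
    "0 \<le> l \<Longrightarrow> l \<le> L \<Longrightarrow> integrable \<mu> (\<lambda>x. exp (l * trunc L (c * x)))"
proof -
  note [measurable] = trunc_measurable
  have "integrable \<mu> (\<lambda>x. c * x)" using integrable_id by simp
  then show "integrable \<mu> (\<lambda>x. trunc L (c * x))"
    by (rule Bochner_Integration.integrable_bound) (auto simp: trunc_def)
  have "integrable \<mu> (\<lambda>x. c\<^sup>2 * x\<^sup>2)" using sq_integrable by simp
  then show "integrable \<mu> (\<lambda>x. (trunc L (c * x))\<^sup>2)"
    by (rule Bochner_Integration.integrable_bound) (auto simp: trunc_def power_mult_distrib)
  have "integrable \<mu> (\<lambda>x. 3 * \<bar>c\<bar> powr q * \<bar>x\<bar> powr q)" using m by simp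
  then show "integrable \<mu> (\<lambda>x. \<bar>trunc L (c * x)\<bar> powr q * exp (L * max (trunc L (c * x)) 0))"
    by (rule Bochner_Integration.integrable_bound)
       (use trunc_bounds(3)[OF L q, of "c * _"] c in \<open>auto simp: abs_mult powr_mult mult.assoc\<close>)
  show "integrable \<mu> (\<lambda>x. exp (l * trunc L (c * x)))" if l: "0 \<le> l" "l \<le> L"
  proof (rule mu.integrable_const_bound[where B="exp 1"])
    have "l * trunc L (c * x) \<le> 1" for x
    proof (cases "trunc L (c * x) \<ge> 0")
      case True
      then have "l * trunc L (c * x) \<le> L * trunc L (c * x)" using l by (intro mult_right_mono)
      also have "\<dots> \<le> 1" by (simp add: trunc_def)
      finally show ?thesis .
    next
      case False
      then have "l * trunc L (c * x) \<le> 0" using l by (intro mult_nonneg_nonpos) auto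
      then show ?thesis by simp
    qed
    then show "AE x in \<mu>. norm (exp (l * trunc L (c * x))) \<le> exp 1" by simp
  qed measurable
qed

text \<open>On integration the linear terms drop out by \<open>mean\<close>, and \<open>var\<close>
  turns the quadratic ones into \<open>c^2\<close>. What remains is due to the truncation and has
  order \<open>c powr q\<close>.\<close>

lemma trunc_moments:
  assumes L: "L > 0" and q: "2 < q" "q \<le> 3" and m: "integrable \<mu> (\<lambda>x. \<bar>x\<bar> powr q)" and c: "c \<ge> 0"
  defines "m \<equiv> LINT x|\<mu>. \<bar>x\<bar> powr q"
  shows "\<bar>LINT x|\<mu>. trunc L (c * x)\<bar> \<le> L powr (q - 1) * c powr q * m"
    "\<bar>(LINT x|\<mu>. (trunc L (c * x))\<^sup>2) - c\<^sup>2\<bar> \<le> L powr (q - 2) * c powr q * m"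
    "(LINT x|\<mu>. \<bar>trunc L (c * x)\<bar> powr q * exp (L * max (trunc L (c * x)) 0)) \<le> 3 * c powr q * m"
    "0 \<le> l \<Longrightarrow> l \<le> L \<Longrightarrow> (LINT x|\<mu>. exp (l * trunc L (c * x))) \<le> exp (l\<^sup>2 * c\<^sup>2 / 2 + l powr q * c powr q * m)"
proof -
  note I = integrable_trunc[OF L q assms(4) c]
  have cx: "\<bar>c * x\<bar> powr q = c powr q * \<bar>x\<bar> powr q" for x using c by (simp add: abs_mult powr_mult)
  have i1: "integrable \<mu> (\<lambda>x. c * x)" using integrable_id by simp
  have i2: "integrable \<mu> (\<lambda>x. c\<^sup>2 * x\<^sup>2)" using sq_integrable by simp
  have i3: "integrable \<mu> (\<lambda>x. k * (c powr q * \<bar>x\<bar> powr q))" for k using assms(4) by simp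
  have v3: "(LINT x|\<mu>. k * (c powr q * \<bar>x\<bar> powr q)) = k * c powr q * m" for k by (simp add: m_def)
  have "(LINT x|\<mu>. trunc L (c * x)) = - (LINT x|\<mu>. c * x - trunc L (c * x))"
    using I(1) i1 by (simp add: mean)
  then have "\<bar>LINT x|\<mu>. trunc L (c * x)\<bar> = \<bar>LINT x|\<mu>. c * x - trunc L (c * x)\<bar>" by simp
  also have "\<dots> \<le> (LINT x|\<mu>. L powr (q - 1) * (c powr q * \<bar>x\<bar> powr q))"
    using I(1) i1 i3 trunc_bounds(1)[OF L q]
    by (intro order_trans[OF integral_norm_bound[of \<mu> "\<lambda>x. c * x - trunc L (c * x)", unfolded real_norm_def] integral_mono])
       (auto simp flip: cx)
  finally show "\<bar>LINT x|\<mu>. trunc L (c * x)\<bar> \<le> L powr (q - 1) * c powr q * m" unfolding v3 .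
  have "(LINT x|\<mu>. (trunc L (c * x))\<^sup>2) - c\<^sup>2 = - (LINT x|\<mu>. c\<^sup>2 * x\<^sup>2 - (trunc L (c * x))\<^sup>2)"
    using I(2) i2 by (simp add: var)
  then have "\<bar>(LINT x|\<mu>. (trunc L (c * x))\<^sup>2) - c\<^sup>2\<bar> = \<bar>LINT x|\<mu>. c\<^sup>2 * x\<^sup>2 - (trunc L (c * x))\<^sup>2\<bar>" by simp
  also have "\<dots> \<le> (LINT x|\<mu>. L powr (q - 2) * (c powr q * \<bar>x\<bar> powr q))"
    using I(2) i2 i3 trunc_bounds(2)[OF L q]
    by (intro order_trans[OF integral_norm_bound[of \<mu> "\<lambda>x. c\<^sup>2 * x\<^sup>2 - (trunc L (c * x))\<^sup>2", unfolded real_norm_def] integral_mono])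
       (auto simp flip: cx power_mult_distrib)
  finally show "\<bar>(LINT x|\<mu>. (trunc L (c * x))\<^sup>2) - c\<^sup>2\<bar> \<le> L powr (q - 2) * c powr q * m" unfolding v3 .
  have "(LINT x|\<mu>. \<bar>trunc L (c * x)\<bar> powr q * exp (L * max (trunc L (c * x)) 0)) \<le> (LINT x|\<mu>. 3 * (c powr q * \<bar>x\<bar> powr q))"
    by (intro integral_mono I(3) i3) (use trunc_bounds(3)[OF L q] in \<open>simp flip: cx\<close>)
  then show "(LINT x|\<mu>. \<bar>trunc L (c * x)\<bar> powr q * exp (L * max (trunc L (c * x)) 0)) \<le> 3 * c powr q * m"
    unfolding v3 .
  show "(LINT x|\<mu>. exp (l * trunc L (c * x))) \<le> exp (l\<^sup>2 * c\<^sup>2 / 2 + l powr q * c powr q * m)" if l: "0 \<le> l" "l \<le> L"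
  proof -
    have "(LINT x|\<mu>. exp (l * trunc L (c * x))) \<le>
        (LINT x|\<mu>. 1 + l * (c * x) + l\<^sup>2 / 2 * (c\<^sup>2 * x\<^sup>2) + l powr q * (c powr q * \<bar>x\<bar> powr q))"
    proof (intro integral_mono I(4)[OF l])
      show "integrable \<mu> (\<lambda>x. 1 + l * (c * x) + l\<^sup>2 / 2 * (c\<^sup>2 * x\<^sup>2) + l powr q * (c powr q * \<bar>x\<bar> powr q))"
        using integrable_id sq_integrable assms(4) by auto
      show "exp (l * trunc L (c * x)) \<le> 1 + l * (c * x) + l\<^sup>2 / 2 * (c\<^sup>2 * x\<^sup>2) + l powr q * (c powr q * \<bar>x\<bar> powr q)" for x
        using trunc_bounds(4)[OF L q l, of "c * x"] by (simp add: cx power_mult_distrib)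
    qed
    also have "\<dots> = 1 + (l\<^sup>2 * c\<^sup>2 / 2 + l powr q * c powr q * m)"
      using integrable_id sq_integrable assms(4) by (simp add: mean var m_def mu.prob_space)
    also have "\<dots> \<le> exp (l\<^sup>2 * c\<^sup>2 / 2 + l powr q * c powr q * m)" by (rule exp_ge_add_one_self)
    finally show ?thesis .
  qed
qed

lemma chernoff_T:
  assumes F: "finite F" and l: "0 \<le> l"
    and i: "\<And>i. i \<in> F \<Longrightarrow> integrable \<mu> (\<lambda>x. exp (l * trunc L (c i * x)))"
    and b: "\<And>i. i \<in> F \<Longrightarrow> (LINT x|\<mu>. exp (l * trunc L (c i * x))) \<le> exp (b i)"
  shows "\<P>(\<omega> in M. T L c F \<omega> \<ge> x) \<le> exp (- l * x + (\<Sum>i\<in>F. b i))"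
proof -
  have ind: "indep_vars (\<lambda>_. borel) (\<lambda>i \<omega>. exp (l * trunc L (c i * X i \<omega>))) F"
    by (rule indep_vars_compose2[OF indep_vars_subset[OF indep], of F "\<lambda>i x. exp (l * trunc L (c i * x))"]) auto
  have i': "integrable M (\<lambda>\<omega>. exp (l * trunc L (c i * X i \<omega>)))" if "i \<in> F" for i
    by (subst integrable_law) (auto intro!: i that)
  have e: "exp (l * T L c F \<omega>) = (\<Prod>i\<in>F. exp (l * trunc L (c i * X i \<omega>)))" for \<omega>
    unfolding T_def sum_distrib_left by (rule exp_sum[OF F])
  have I: "integrable M (\<lambda>\<omega>. exp (l * T L c F \<omega>))"
    unfolding e by (rule indep_vars_integrable[OF F ind i'])
  have "expectation (\<lambda>\<omega>. exp (l * T L c F \<omega>)) = (\<Prod>i\<in>F. LINT x|\<mu>. exp (l * trunc L (c i * x)))"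
    unfolding e by (subst indep_vars_lebesgue_integral[OF F ind i']) (auto intro!: prod.cong expectation_law)
  also have "\<dots> \<le> (\<Prod>i\<in>F. exp (b i))"
    by (intro prod_mono conjI b Bochner_Integration.integral_nonneg) auto
  also have "\<dots> = exp (\<Sum>i\<in>F. b i)" by (rule exp_sum[OF F, symmetric])
  finally have E: "expectation (\<lambda>\<omega>. exp (l * T L c F \<omega>)) \<le> exp (\<Sum>i\<in>F. b i)" .
  have "\<P>(\<omega> in M. T L c F \<omega> \<ge> x) \<le> \<P>(\<omega> in M. exp (l * T L c F \<omega>) \<ge> exp (l * x))"
    using l by (intro finite_measure_mono) (auto intro!: mult_left_mono)
  also have "\<dots> \<le> expectation (\<lambda>\<omega>. exp (l * T L c F \<omega>)) / exp (l * x)"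
    by (rule integral_Markov_inequality_measure[OF I, of "space M"]) auto
  also have "\<dots> \<le> exp (\<Sum>i\<in>F. b i) / exp (l * x)"
    using E by (simp add: divide_right_mono)
  also have "\<dots> = exp (- l * x + (\<Sum>i\<in>F. b i))"
    by (simp add: exp_diff[symmetric])
  finally show ?thesis .
qed

lemma chernoff_trunc:
  assumes L: "L > 0" and q: "2 < q" "q \<le> 3" and m: "integrable \<mu> (\<lambda>x. \<bar>x\<bar> powr q)"
    and F: "finite F" and c: "\<And>i. i \<in> F \<Longrightarrow> 0 \<le> c i" and l: "0 \<le> l" "l \<le> L"
  shows "\<P>(\<omega> in M. T L c F \<omega> \<ge> x) \<le>
    exp (- l * x + l\<^sup>2 * (\<Sum>i\<in>F. (c i)\<^sup>2) / 2 + l powr q * (\<Sum>i\<in>F. c i powr q) * (LINT x|\<mu>. \<bar>x\<bar> powr q))"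
proof -
  let ?m = "LINT x|\<mu>. \<bar>x\<bar> powr q"
  have "\<P>(\<omega> in M. T L c F \<omega> \<ge> x) \<le> exp (- l * x + (\<Sum>i\<in>F. l\<^sup>2 * (c i)\<^sup>2 / 2 + l powr q * c i powr q * ?m))"
    by (intro chernoff_T F l integrable_trunc(4)[OF L q m] trunc_moments(4)[OF L q m] c)
  also have "(\<Sum>i\<in>F. l\<^sup>2 * (c i)\<^sup>2 / 2 + l powr q * c i powr q * ?m) =
      l\<^sup>2 * (\<Sum>i\<in>F. (c i)\<^sup>2) / 2 + l powr q * (\<Sum>i\<in>F. c i powr q) * ?m"
    by (simp add: sum.distrib sum_distrib_left sum_distrib_right sum_divide_distrib)
  finally show ?thesis by (simp only: add.assoc)
qed

lemma prob_jump_le: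
  assumes p: "p > 0" and m: "integrable \<mu> (\<lambda>x. \<bar>x\<bar> powr p)" and L: "L > 0" and c: "c \<ge> 0"
  shows "\<P>(\<omega> in M. L * (c * X i \<omega>) > 1) \<le> L powr p * c powr p * (LINT x|\<mu>. \<bar>x\<bar> powr p)"
proof -
  have I: "integrable M (\<lambda>\<omega>. L powr p * c powr p * \<bar>X i \<omega>\<bar> powr p)"
    using m by (subst integrable_law) auto
  have "\<P>(\<omega> in M. L * (c * X i \<omega>) > 1) \<le> \<P>(\<omega> in M. L powr p * c powr p * \<bar>X i \<omega>\<bar> powr p \<ge> 1)"
  proof (intro finite_measure_mono subsetI)
    fix \<omega> assume w: "\<omega> \<in> {\<omega> \<in> space M. L * (c * X i \<omega>) > 1}"
    then have "1 \<le> (L * (c * X i \<omega>)) powr p" using p by (intro ge_one_powr_ge_zero) auto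
    also have "\<dots> \<le> (L * (c * \<bar>X i \<omega>\<bar>)) powr p" using w p L c by (intro powr_mono2 mult_left_mono) auto
    also have "\<dots> = L powr p * c powr p * \<bar>X i \<omega>\<bar> powr p" using L c by (simp add: powr_mult)
    finally show "\<omega> \<in> {\<omega> \<in> space M. L powr p * c powr p * \<bar>X i \<omega>\<bar> powr p \<ge> 1}" using w by simp
  qed measurable
  also have "\<dots> \<le> expectation (\<lambda>\<omega>. L powr p * c powr p * \<bar>X i \<omega>\<bar> powr p) / 1"
    by (rule integral_Markov_inequality_measure[OF I, of "space M"]) auto
  also have "expectation (\<lambda>\<omega>. L powr p * c powr p * \<bar>X i \<omega>\<bar> powr p) = L powr p * c powr p * (LINT x|\<mu>. \<bar>x\<bar> powr p)"
    by (subst expectation_law) auto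
  finally show ?thesis by simp
qed

lemma prob_S_le_T_plus_jumps:
  assumes F: "finite F"
  shows "\<P>(\<omega> in M. S c F \<omega> \<ge> x) \<le> \<P>(\<omega> in M. T L c F \<omega> \<ge> x) + (\<Sum>i\<in>F. \<P>(\<omega> in M. L * (c i * X i \<omega>) > 1))"
proof -
  have "\<P>(\<omega> in M. S c F \<omega> \<ge> x) \<le> prob ({\<omega> \<in> space M. T L c F \<omega> \<ge> x} \<union> (\<Union>i\<in>F. {\<omega> \<in> space M. L * (c i * X i \<omega>) > 1}))"
  proof (intro finite_measure_mono subsetI)
    fix \<omega> assume w: "\<omega> \<in> {\<omega> \<in> space M. x \<le> S c F \<omega>}"
    show "\<omega> \<in> {\<omega> \<in> space M. x \<le> T L c F \<omega>} \<union> (\<Union>i\<in>F. {\<omega> \<in> space M. 1 < L * (c i * X i \<omega>)})"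
    proof (cases "\<exists>i\<in>F. L * (c i * X i \<omega>) > 1")
      case False
      then have "T L c F \<omega> = S c F \<omega>" unfolding T_def S_def trunc_def by (intro sum.cong) (auto simp: not_less)
      then show ?thesis using w by auto
    qed (use w in auto)
  qed (intro sets.Un sets.finite_UN F; measurable)
  also have "\<dots> \<le> \<P>(\<omega> in M. T L c F \<omega> \<ge> x) + prob (\<Union>i\<in>F. {\<omega> \<in> space M. L * (c i * X i \<omega>) > 1})"
    by (intro measure_Un_le sets.finite_UN F) measurable
  also have "prob (\<Union>i\<in>F. {\<omega> \<in> space M. L * (c i * X i \<omega>) > 1}) \<le> (\<Sum>i\<in>F. \<P>(\<omega> in M. L * (c i * X i \<omega>) > 1))"
    using F by (intro finite_measure_subadditive_finite) auto
  finally show ?thesis by simp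
qed

lemma prob_term_and_rest:
  assumes F: "finite F" "i \<in> F" and A[measurable]: "A \<in> sets borel" and B[measurable]: "B \<in> sets borel"
  shows "\<P>(\<omega> in M. c i * X i \<omega> \<in> A \<and> S c (F - {i}) \<omega> \<in> B) =
    \<P>(\<omega> in M. c i * X i \<omega> \<in> A) * \<P>(\<omega> in M. S c (F - {i}) \<omega> \<in> B)"
proof -
  have "indep_var borel (\<lambda>\<omega>. c i * X i \<omega>) borel (S c (F - {i}))"
    unfolding S_def[abs_def] using F by (intro indep_term_sum[where f="\<lambda>i x. c i * x"]) auto
  from prob_indep_random_variable[OF this A B] show ?thesis .
qed

text \<open>If no single summand exceeds \<open>b\<close>, a sum above \<open>x\<close> that has a summand above the truncation
  level \<open>1 / L\<close> forces the remaining sum to exceed \<open>x - b\<close>.\<close>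

lemma prob_S_le_one_big_jump:
  assumes F: "finite F"
  shows "\<P>(\<omega> in M. S c F \<omega> \<ge> x) \<le> \<P>(\<omega> in M. T L c F \<omega> \<ge> x) + (\<Sum>i\<in>F. \<P>(\<omega> in M. c i * X i \<omega> \<ge> b)) +
    (\<Sum>i\<in>F. \<P>(\<omega> in M. L * (c i * X i \<omega>) > 1) * \<P>(\<omega> in M. S c (F - {i}) \<omega> \<ge> x - b))"
proof -
  define A where "A i = {\<omega> \<in> space M. c i * X i \<omega> \<ge> b}" for i
  define B where "B i = {\<omega> \<in> space M. c i * X i \<omega> \<in> {y. L * y > 1} \<and> S c (F - {i}) \<omega> \<in> {x - b..}}" for i
  have [measurable]: "A i \<in> sets M" "B i \<in> sets M" for i unfolding A_def B_def by measurable
  have "{\<omega> \<in> space M. S c F \<omega> \<ge> x} \<subseteq> {\<omega> \<in> space M. T L c F \<omega> \<ge> x} \<union> ((\<Union>i\<in>F. A i) \<union> (\<Union>i\<in>F. B i))"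
  proof
    fix \<omega> assume w: "\<omega> \<in> {\<omega> \<in> space M. x \<le> S c F \<omega>}"
    consider "\<exists>i\<in>F. c i * X i \<omega> \<ge> b" | i where "i \<in> F" "L * (c i * X i \<omega>) > 1" "c i * X i \<omega> < b"
      | "\<forall>i\<in>F. L * (c i * X i \<omega>) \<le> 1" by force
    then show "\<omega> \<in> {\<omega> \<in> space M. T L c F \<omega> \<ge> x} \<union> ((\<Union>i\<in>F. A i) \<union> (\<Union>i\<in>F. B i))"
    proof cases
      case 1 then show ?thesis using w by (auto simp: A_def)
    next
      case 2
      have "S c F \<omega> = c i * X i \<omega> + S c (F - {i}) \<omega>"
        unfolding S_def by (rule sum.remove[OF F 2(1)])
      then show ?thesis using 2 w by (auto simp: B_def)
    next
      case 3
      then have "T L c F \<omega> = S c F \<omega>" unfolding T_def S_def trunc_def by (intro sum.cong) auto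
      then show ?thesis using w by auto
    qed
  qed
  then have "\<P>(\<omega> in M. S c F \<omega> \<ge> x) \<le> prob ({\<omega> \<in> space M. T L c F \<omega> \<ge> x} \<union> ((\<Union>i\<in>F. A i) \<union> (\<Union>i\<in>F. B i)))"
    by (intro finite_measure_mono sets.Un sets.finite_UN F) auto
  also have "\<dots> \<le> \<P>(\<omega> in M. T L c F \<omega> \<ge> x) + prob ((\<Union>i\<in>F. A i) \<union> (\<Union>i\<in>F. B i))"
    by (intro measure_Un_le sets.Un sets.finite_UN F) auto
  also have "prob ((\<Union>i\<in>F. A i) \<union> (\<Union>i\<in>F. B i)) \<le> prob (\<Union>i\<in>F. A i) + prob (\<Union>i\<in>F. B i)"
    using F by (intro measure_Un_le) auto
  also have "prob (\<Union>i\<in>F. A i) \<le> (\<Sum>i\<in>F. prob (A i))"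
    using F by (intro finite_measure_subadditive_finite) auto
  also have "prob (\<Union>i\<in>F. B i) \<le> (\<Sum>i\<in>F. prob (B i))"
    using F by (intro finite_measure_subadditive_finite) auto
  also have "(\<Sum>i\<in>F. prob (B i)) = (\<Sum>i\<in>F. \<P>(\<omega> in M. L * (c i * X i \<omega>) > 1) * \<P>(\<omega> in M. S c (F - {i}) \<omega> \<ge> x - b))"
    unfolding B_def using F by (intro sum.cong refl) (subst prob_term_and_rest, auto)
  finally show ?thesis by (simp add: A_def)
qed

end

section \<open>Comparison of truncated sums with the normal law\<close>

definition "gK = (LINT z|gauss. (1 + \<bar>z\<bar> ^ 3) * exp \<bar>z\<bar>)"

lemma gK_nonneg: "gK \<ge> 0"
  unfolding gK_def by (intro Bochner_Integration.integral_nonneg) auto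

lemma gauss_exp_powr_moment:
  assumes q: "2 < q" "q \<le> 3" and c: "c \<ge> 0" "L * c \<le> 1" "L \<ge> 0"
  shows "integrable gauss (\<lambda>z. \<bar>c * z\<bar> powr q * exp (L * max (c * z) 0))"
    "(LINT z|gauss. \<bar>c * z\<bar> powr q * exp (L * max (c * z) 0)) \<le> c powr q * gK"
proof -
  have b: "\<bar>c * z\<bar> powr q * exp (L * max (c * z) 0) \<le> c powr q * ((1 + \<bar>z\<bar> ^ 3) * exp \<bar>z\<bar>)" for z
  proof -
    have "\<bar>z\<bar> powr q \<le> 1 + \<bar>z\<bar> ^ 3"
    proof (cases "\<bar>z\<bar> \<le> 1")
      case True
      then have "\<bar>z\<bar> powr q \<le> 1" using q by (intro powr_le1) auto
      then show ?thesis by (simp add: add_increasing2)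
    next
      case False
      then have "\<bar>z\<bar> powr q \<le> \<bar>z\<bar> powr 3" using q by (intro powr_mono) auto
      then show ?thesis using False by (simp add: powr_numeral)
    qed
    moreover have "L * max (c * z) 0 \<le> \<bar>z\<bar>"
    proof -
      have "L * max (c * z) 0 \<le> L * (c * \<bar>z\<bar>)" using c by (intro mult_left_mono) (auto intro: mult_left_mono)
      also have "\<dots> \<le> 1 * \<bar>z\<bar>" unfolding mult.assoc[symmetric] using c by (intro mult_right_mono) auto
      finally show ?thesis by simp
    qed
    ultimately have "\<bar>z\<bar> powr q * exp (L * max (c * z) 0) \<le> (1 + \<bar>z\<bar> ^ 3) * exp \<bar>z\<bar>"
      by (intro mult_mono) auto
    then have "c powr q * (\<bar>z\<bar> powr q * exp (L * max (c * z) 0)) \<le> c powr q * ((1 + \<bar>z\<bar> ^ 3) * exp \<bar>z\<bar>)"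
      by (intro mult_left_mono) auto
    then show ?thesis using c by (simp add: abs_mult powr_mult mult.assoc)
  qed
  have i: "integrable gauss (\<lambda>z. c powr q * ((1 + \<bar>z\<bar> ^ 3) * exp \<bar>z\<bar>))"
    by (intro integrable_mult_right gauss_abs_moment)
  show *: "integrable gauss (\<lambda>z. \<bar>c * z\<bar> powr q * exp (L * max (c * z) 0))"
    by (rule Bochner_Integration.integrable_bound[OF i]) (use b in \<open>auto simp: abs_mult intro: order_trans\<close>)
  have "(LINT z|gauss. \<bar>c * z\<bar> powr q * exp (L * max (c * z) 0)) \<le> (LINT z|gauss. c powr q * ((1 + \<bar>z\<bar> ^ 3) * exp \<bar>z\<bar>))"
    by (intro integral_mono * i b)
  then show "(LINT z|gauss. \<bar>c * z\<bar> powr q * exp (L * max (c * z) 0)) \<le> c powr q * gK"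
    by (simp add: gK_def)
qed

text \<open>At scale \<open>h\<close> the spline climbs from 0 at \<open>x\<close> to 1 at
  \<open>x + 3 * h\<close>, hence the two different levels.\<close>

lemma gauss_spline_bounds:
  assumes s: "s > 0" and h: "h > 0"
  shows "(LINT z|gauss. spl ((s * z - x) / h)) \<le> Q (x / s)"
    "Q ((x + 3 * h) / s) \<le> (LINT z|gauss. spl ((s * z - x) / h))"
proof -
  have i: "integrable gauss (\<lambda>z. spl ((s * z - x) / h))"
    by (rule gauss.integrable_const_bound[where B=1]) (use spl_bounds in auto)
  have Qi: "Q y = (LINT z|gauss. indicator {y..} z)" for y unfolding Q_def by simp
  have ii: "integrable gauss (indicator {y..} :: real \<Rightarrow> real)" for y
    by (rule gauss.integrable_const_bound[where B=1]) (auto simp: indicator_def)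
  show "(LINT z|gauss. spl ((s * z - x) / h)) \<le> Q (x / s)"
    unfolding Qi
  proof (intro integral_mono i ii)
    show "spl ((s * z - x) / h) \<le> indicator {x / s..} z" for z
      using spl_bounds[of "(s * z - x) / h"] spl_zero(1)[of "(s * z - x) / h"] s h
      by (auto simp: indicator_def divide_le_0_iff pos_divide_le_eq mult.commute)
  qed
  show "Q ((x + 3 * h) / s) \<le> (LINT z|gauss. spl ((s * z - x) / h))"
    unfolding Qi
  proof (intro integral_mono i ii)
    show "indicator {(x + 3 * h) / s..} z \<le> spl ((s * z - x) / h)" for z
      using spl_bounds[of "(s * z - x) / h"] spl_one(1)[of "(s * z - x) / h"] s h
      by (auto simp: indicator_def pos_divide_le_eq pos_le_divide_eq mult.commute)
  qed
qed

text \<open>Two of the \<open>r\<close> powers are spent on the normalisation, the other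
  \<open>r - 2\<close> on the maximal weight.\<close>

lemma sum_powr_weights_le:
  fixes c :: "'i \<Rightarrow> real" and r \<gamma> :: real
  assumes "r \<ge> 2" and c: "\<And>i. i \<in> F \<Longrightarrow> 0 \<le> c i" "\<And>i. i \<in> F \<Longrightarrow> c i \<le> \<gamma>" and s: "(\<Sum>i\<in>F. (c i)\<^sup>2) \<le> 1"
  shows "(\<Sum>i\<in>F. c i powr r) \<le> \<gamma> powr (r - 2)"
proof -
  have "c i powr r \<le> \<gamma> powr (r - 2) * (c i)\<^sup>2" if i: "i \<in> F" for i
  proof (cases "c i = 0")
    case False
    then have "c i powr r = c i powr (r - 2) * c i powr 2" by (simp add: powr_add[symmetric])
    also have "\<dots> \<le> \<gamma> powr (r - 2) * c i powr 2"
      using c[OF i] assms(1) by (intro mult_right_mono powr_mono2) auto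
    finally show ?thesis using c(1)[OF i] False by (simp add: powr_numeral)
  qed simp
  then have "(\<Sum>i\<in>F. c i powr r) \<le> (\<Sum>i\<in>F. \<gamma> powr (r - 2) * (c i)\<^sup>2)" by (rule sum_mono)
  also have "\<dots> \<le> \<gamma> powr (r - 2) * 1" unfolding sum_distrib_left[symmetric] by (intro mult_left_mono s) auto
  finally show ?thesis by simp
qed

context iid_std
begin

text \<open>The tilt equals the truncation parameter, so each truncated summand has a bounded
  exponential weight; \<open>L * \<gamma> \<le> 1\<close> does the corresponding job for its
  Gaussian substitute. All powers of \<open>L\<close> from the moment bounds have exponent at most
  3, hence the common \<open>L ^ 3\<close>; the sum over the weights yields
  \<open>\<gamma> powr (q - 2)\<close>.\<close>

lemma lindeberg_trunc:
  assumes L: "L \<ge> 1" and q: "2 < q" "q \<le> 3" and m: "integrable \<mu> (\<lambda>x. \<bar>x\<bar> powr q)"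
    and F: "finite F" and c: "\<And>i. i \<in> F \<Longrightarrow> 0 \<le> c i" "\<And>i. i \<in> F \<Longrightarrow> c i \<le> \<gamma>"
    and g: "L * \<gamma> \<le> 1" and s: "(\<Sum>i\<in>F. (c i)\<^sup>2) \<le> 1" and h: "0 < h" "h \<le> 1"
  defines "m \<equiv> LINT x|\<mu>. \<bar>x\<bar> powr q"
  shows "\<bar>expectation (\<lambda>\<omega>. spl ((T L c F \<omega> - x) / h)) - (LINT z|gauss. spl ((sqrt (\<Sum>i\<in>F. (c i)\<^sup>2) * z - x) / h))\<bar>
    \<le> 3 / h ^ 3 * exp (- L * x) * exp (L\<^sup>2 / 2 + L ^ 3 * m * \<gamma> powr (q - 2)) * (L ^ 3 * (5 * m + gK) * \<gamma> powr (q - 2))"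
proof -
  let ?B = "3 / h ^ 3 * exp (- L * x)"
  have m0: "m \<ge> 0" unfolding m_def by (intro Bochner_Integration.integral_nonneg) auto
  have L0: "L > 0" using L by simp
  have Lc: "L * c i \<le> 1" if "i \<in> F" for i
    using mult_left_mono[OF c(2)[OF that], of L] L g by linarith
  have Lp: "L powr r \<le> L ^ 3" if "r \<le> 3" for r
    using L powr_mono[OF that L] by (simp add: powr_numeral)
  have sp: "(\<Sum>i\<in>F. c i powr q) \<le> \<gamma> powr (q - 2)"
    using q by (intro sum_powr_weights_le c s) auto
  have "\<bar>expectation (\<lambda>\<omega>. (\<lambda>u. spl ((u - x) / h)) (0 + (\<Sum>i\<in>F. trunc L (c i * X i \<omega>)))) -
      (LINT z|gauss. (\<lambda>u. spl ((u - x) / h)) (0 + sqrt (\<Sum>i\<in>F. (c i)\<^sup>2) * z))\<bar>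
    \<le> ?B * exp (L * 0) * exp (L\<^sup>2 * (\<Sum>i\<in>F. (c i)\<^sup>2) / 2 + (\<Sum>i\<in>F. L ^ 3 * m * c i powr q)) * (\<Sum>i\<in>F. L ^ 3 * (5 * m + gK) * c i powr q)"
  proof (rule lindeberg_exp[OF F, where q=q and g="\<lambda>i x. trunc L (c i * x)"])
    show "2 \<le> q" "0 \<le> L" using q L by auto
    show "exp_taylor L q ?B (\<lambda>u. spl ((u - x) / h))" using q L h by (intro exp_taylor_spline) auto
    show "0 \<le> ?B" using h by simp
    fix i assume i: "i \<in> F"
    show "0 \<le> c i" using c i by auto
    note I = integrable_trunc[OF L0 q assms(4) c(1)[OF i]]
    note E = trunc_moments[OF L0 q assms(4) c(1)[OF i], folded m_def]
    note G = gauss_exp_powr_moment[OF q c(1)[OF i] Lc[OF i]]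
    show "integrable \<mu> (\<lambda>x. trunc L (c i * x))" "integrable \<mu> (\<lambda>x. (trunc L (c i * x))\<^sup>2)"
      "integrable \<mu> (\<lambda>x. \<bar>trunc L (c i * x)\<bar> powr q * exp (L * max (trunc L (c i * x)) 0))"
      by (rule I)+
    show "integrable \<mu> (\<lambda>x. exp (L * trunc L (c i * x)))" using L0 by (intro I) auto
    show "integrable gauss (\<lambda>z. \<bar>c i * z\<bar> powr q * exp (L * max (c i * z) 0))" using L0 by (intro G) auto
    show "0 \<le> L ^ 3 * m * c i powr q" using L m0 by auto
    have le: "L powr r * c i powr q * m \<le> L ^ 3 * (c i powr q * m)" if "r \<le> 3" for r
      using mult_right_mono[OF Lp[OF that], of "c i powr q * m"] m0 by (simp add: mult.assoc)
    show "(LINT x|\<mu>. exp (L * trunc L (c i * x))) \<le> exp (L\<^sup>2 * (c i)\<^sup>2 / 2 + L ^ 3 * m * c i powr q)"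
      using E(4)[of L] L0 le[of q] q by (auto simp: mult_ac intro: order_trans)
    have L3: "1 \<le> L ^ 3" using L by simp
    have a: "c i powr q * k \<le> L ^ 3 * (c i powr q * k)" if "k \<ge> 0" for k
      using mult_right_mono[OF L3, of "c i powr q * k"] that by simp
    have "\<bar>LINT x|\<mu>. trunc L (c i * x)\<bar> \<le> L ^ 3 * (c i powr q * m)"
      "\<bar>(LINT x|\<mu>. (trunc L (c i * x))\<^sup>2) - (c i)\<^sup>2\<bar> \<le> L ^ 3 * (c i powr q * m)"
      "(LINT x|\<mu>. \<bar>trunc L (c i * x)\<bar> powr q * exp (L * max (trunc L (c i * x)) 0)) \<le> 3 * (L ^ 3 * (c i powr q * m))"
      "(LINT z|gauss. \<bar>c i * z\<bar> powr q * exp (L * max (c i * z) 0)) \<le> L ^ 3 * (c i powr q * gK)"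
      using E(1-3) G(2) le[of "q - 1"] le[of "q - 2"] q a[OF m0] a[OF gK_nonneg] L0 by linarith+
    moreover have "0 \<le> L ^ 3 * (c i powr q * m)" using L m0 by auto
    \<comment> \<open>The 5 rounds up \<open>1 + 1/2 + 3\<close>: the mean, half the variance defect
      and the weighted moment of a truncated summand.\<close>
    moreover have "L ^ 3 * (5 * m + gK) * c i powr q = 5 * (L ^ 3 * (c i powr q * m)) + L ^ 3 * (c i powr q * gK)"
      by (simp add: algebra_simps)
    ultimately show "\<bar>LINT x|\<mu>. trunc L (c i * x)\<bar> + \<bar>(LINT x|\<mu>. (trunc L (c i * x))\<^sup>2) - (c i)\<^sup>2\<bar> / 2 +
      (LINT x|\<mu>. \<bar>trunc L (c i * x)\<bar> powr q * exp (L * max (trunc L (c i * x)) 0)) +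
      (LINT z|gauss. \<bar>c i * z\<bar> powr q * exp (L * max (c i * z) 0)) \<le> L ^ 3 * (5 * m + gK) * c i powr q"
    proof -
      have lin: "\<bar>a\<bar> + \<bar>b\<bar> / 2 + c + d \<le> 5 * U + V"
        if "\<bar>a\<bar> \<le> U" "\<bar>b\<bar> \<le> U" "c \<le> 3 * U" "d \<le> V" "0 \<le> U" for a b c d U V :: real
        using that by linarith
      assume *: "\<bar>LINT x|\<mu>. trunc L (c i * x)\<bar> \<le> L ^ 3 * (c i powr q * m)"
        "\<bar>(LINT x|\<mu>. (trunc L (c i * x))\<^sup>2) - (c i)\<^sup>2\<bar> \<le> L ^ 3 * (c i powr q * m)"
        "(LINT x|\<mu>. \<bar>trunc L (c i * x)\<bar> powr q * exp (L * max (trunc L (c i * x)) 0)) \<le> 3 * (L ^ 3 * (c i powr q * m))"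
        "(LINT z|gauss. \<bar>c i * z\<bar> powr q * exp (L * max (c i * z) 0)) \<le> L ^ 3 * (c i powr q * gK)"
        "0 \<le> L ^ 3 * (c i powr q * m)"
        "L ^ 3 * (5 * m + gK) * c i powr q = 5 * (L ^ 3 * (c i powr q * m)) + L ^ 3 * (c i powr q * gK)"
      show ?thesis unfolding *(6) by (rule lin[OF *(1-5)])
    qed
  qed measurable
  also have "\<dots> \<le> ?B * exp (L * 0) * exp (L\<^sup>2 / 2 + L ^ 3 * m * \<gamma> powr (q - 2)) * (L ^ 3 * (5 * m + gK) * \<gamma> powr (q - 2))"
  proof (intro mult_mono[OF mult_left_mono])
    have "L\<^sup>2 * (\<Sum>i\<in>F. (c i)\<^sup>2) \<le> L\<^sup>2 * 1" by (intro mult_left_mono s) auto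
    moreover have "(\<Sum>i\<in>F. L ^ 3 * m * c i powr q) \<le> L ^ 3 * m * \<gamma> powr (q - 2)"
      unfolding sum_distrib_left[symmetric] using L m0 by (intro mult_left_mono sp) auto
    ultimately show "exp (L\<^sup>2 * (\<Sum>i\<in>F. (c i)\<^sup>2) / 2 + (\<Sum>i\<in>F. L ^ 3 * m * c i powr q)) \<le> exp (L\<^sup>2 / 2 + L ^ 3 * m * \<gamma> powr (q - 2))"
      by simp
    show "(\<Sum>i\<in>F. L ^ 3 * (5 * m + gK) * c i powr q) \<le> L ^ 3 * (5 * m + gK) * \<gamma> powr (q - 2)"
      unfolding sum_distrib_left[symmetric] using L m0 gK_nonneg by (intro mult_left_mono sp) auto
    show "0 \<le> (\<Sum>i\<in>F. L ^ 3 * (5 * m + gK) * c i powr q)"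
      using L m0 gK_nonneg by (intro sum_nonneg) auto
  qed (use h in auto)
  finally show ?thesis by (simp add: T_def)
qed

lemma prob_T_spline:
  assumes h: "h > 0"
  shows "expectation (\<lambda>\<omega>. spl ((T L c F \<omega> - x) / h)) \<le> \<P>(\<omega> in M. T L c F \<omega> \<ge> x)"
    "\<P>(\<omega> in M. T L c F \<omega> \<ge> x + 3 * h) \<le> expectation (\<lambda>\<omega>. spl ((T L c F \<omega> - x) / h))"
proof -
  have i: "integrable M (\<lambda>\<omega>. spl ((T L c F \<omega> - x) / h))"
    by (rule integrable_const_bound[where B=1]) (use spl_bounds in auto)
  have pi: "\<P>(\<omega> in M. T L c F \<omega> \<ge> y) = expectation (indicator {\<omega> \<in> space M. T L c F \<omega> \<ge> y})" for y
    by simp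
  have ii: "integrable M (indicator {\<omega> \<in> space M. T L c F \<omega> \<ge> y} :: 'a \<Rightarrow> real)" for y
    by (rule integrable_const_bound[where B=1]) (auto simp: indicator_def)
  show "expectation (\<lambda>\<omega>. spl ((T L c F \<omega> - x) / h)) \<le> \<P>(\<omega> in M. T L c F \<omega> \<ge> x)"
    unfolding pi
  proof (intro integral_mono i ii)
    show "spl ((T L c F \<omega> - x) / h) \<le> indicator {\<omega> \<in> space M. T L c F \<omega> \<ge> x} \<omega>" if "\<omega> \<in> space M" for \<omega>
      using spl_bounds[of "(T L c F \<omega> - x) / h"] spl_zero(1)[of "(T L c F \<omega> - x) / h"] h that
      by (auto simp: indicator_def divide_le_0_iff)
  qed
  show "\<P>(\<omega> in M. T L c F \<omega> \<ge> x + 3 * h) \<le> expectation (\<lambda>\<omega>. spl ((T L c F \<omega> - x) / h))"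
    unfolding pi
  proof (intro integral_mono i ii)
    show "indicator {\<omega> \<in> space M. T L c F \<omega> \<ge> x + 3 * h} \<omega> \<le> spl ((T L c F \<omega> - x) / h)" for \<omega>
      using spl_bounds[of "(T L c F \<omega> - x) / h"] spl_one(1)[of "(T L c F \<omega> - x) / h"] h
      by (auto simp: indicator_def pos_le_divide_eq)
  qed
qed

text \<open>The upper bound uses a spline that rises on \<open>[x - 3 * h, x]\<close>, the lower
  bound one that rises on \<open>[x, x + 3 * h]\<close>. The lower starting point of the former
  accounts for \<open>exp (3 * L * h)\<close> in \<open>err\<close>.\<close>

lemma prob_T_gauss:
  fixes x h \<gamma> q L :: real
  assumes L: "L \<ge> 1" and q: "2 < q" "q \<le> 3" and m: "integrable \<mu> (\<lambda>x. \<bar>x\<bar> powr q)"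
    and F: "finite F" and c: "\<And>i. i \<in> F \<Longrightarrow> 0 \<le> c i" "\<And>i. i \<in> F \<Longrightarrow> c i \<le> \<gamma>"
    and g: "L * \<gamma> \<le> 1" and s: "(\<Sum>i\<in>F. (c i)\<^sup>2) \<le> 1" "0 < (\<Sum>i\<in>F. (c i)\<^sup>2)" and h: "0 < h" "h \<le> 1"
  defines "m \<equiv> LINT x|\<mu>. \<bar>x\<bar> powr q" and "s \<equiv> sqrt (\<Sum>i\<in>F. (c i)\<^sup>2)"
  defines "err \<equiv> 3 / h ^ 3 * exp (- L * x + 3 * L * h) * exp (L\<^sup>2 / 2 + L ^ 3 * m * \<gamma> powr (q - 2)) * (L ^ 3 * (5 * m + gK) * \<gamma> powr (q - 2))"
  shows "\<P>(\<omega> in M. T L c F \<omega> \<ge> x) \<le> Q ((x - 3 * h) / s) + err"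
    "\<P>(\<omega> in M. T L c F \<omega> \<ge> x) \<ge> Q ((x + 3 * h) / s) - err"
proof -
  have s0: "s > 0" using assms by (simp add: s_def)
  note lind = lindeberg_trunc[OF L q assms(4) F c g assms(9) h, folded m_def s_def]
  have m0: "m \<ge> 0" unfolding m_def by (intro Bochner_Integration.integral_nonneg) auto
  have e2: "exp (- L * (x - 3 * h)) = exp (- L * x + 3 * L * h)" by (simp add: algebra_simps)
  have "exp (- L * x) \<le> exp (- L * x + 3 * L * h)" using L h by simp
  then have e1: "3 / h ^ 3 * exp (- L * x) * exp (L\<^sup>2 / 2 + L ^ 3 * m * \<gamma> powr (q - 2)) * (L ^ 3 * (5 * m + gK) * \<gamma> powr (q - 2)) \<le> err"
    unfolding err_def using L m0 gK_nonneg h by (intro mult_right_mono mult_left_mono) auto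
  have "\<P>(\<omega> in M. T L c F \<omega> \<ge> x) \<le> expectation (\<lambda>\<omega>. spl ((T L c F \<omega> - (x - 3 * h)) / h))"
    using prob_T_spline(2)[OF h(1), of "x - 3 * h"] by simp
  also have "\<dots> \<le> (LINT z|gauss. spl ((s * z - (x - 3 * h)) / h)) + err"
    using lind[of "x - 3 * h"] unfolding err_def e2 by linarith
  also have "\<dots> \<le> Q ((x - 3 * h) / s) + err" using gauss_spline_bounds(1)[OF s0 h(1)] by simp
  finally show "\<P>(\<omega> in M. T L c F \<omega> \<ge> x) \<le> Q ((x - 3 * h) / s) + err" .
  have "Q ((x + 3 * h) / s) \<le> (LINT z|gauss. spl ((s * z - x) / h))" by (rule gauss_spline_bounds(2)[OF s0 h(1)])
  also have "\<dots> \<le> expectation (\<lambda>\<omega>. spl ((T L c F \<omega> - x) / h)) + err"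
    using lind[of x] e1 by linarith
  also have "expectation (\<lambda>\<omega>. spl ((T L c F \<omega> - x) / h)) \<le> \<P>(\<omega> in M. T L c F \<omega> \<ge> x)" by (rule prob_T_spline(1)[OF h(1)])
  finally show "\<P>(\<omega> in M. T L c F \<omega> \<ge> x) \<ge> Q ((x + 3 * h) / s) - err" by simp
qed

end

text \<open>The hypothesis keeps \<open>x^2\<close> below a multiple of
  \<open>ln (1 / \<gamma>)\<close>, up to a constant. Half of the exponent of
  \<open>\<gamma> powr (q - 2)\<close> is traded for \<open>exp (- t * x^2 / 2)\<close>, which beats
  \<open>exp |x|\<close> and every power of \<open>x\<close>; the other half is made as small as
  desired.\<close>

lemma moderate_weight_small:
  assumes p: "p > 2" and q: "q > 2" and K: "K > 0" and e: "\<eta> > 0"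
  shows "\<exists>g0\<in>{0<..1::real}. \<forall>\<gamma>\<in>{0<..g0}. \<forall>x. \<gamma> powr (p - 2) \<le> K * exp (- x\<^sup>2 / 2) \<longrightarrow>
    (1 + \<bar>x\<bar>) ^ 10 * exp \<bar>x\<bar> * \<gamma> powr (q - 2) \<le> \<eta>"
proof -
  define t where "t = (q - 2) / (2 * (p - 2))"
  have t: "t > 0" using p q by (simp add: t_def)
  \<comment> \<open>\<open>10 ^ 10\<close> stems from
    \<open>(1 + y) ^ 10 \<le> 10 ^ 10 * exp (1 + y)\<close>, and \<open>exp (1 + 2 / t)\<close> is
    the maximum of \<open>exp (1 + 2 * y - t * y^2 / 2)\<close>.\<close>
  define C where "C = 10 ^ 10 * exp (1 + 2 / t) * K powr t"
  have C: "C > 0" using K by (simp add: C_def)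
  define g0 where "g0 = min 1 ((\<eta> / C) powr (2 / (q - 2)))"
  have g0: "g0 \<in> {0<..1}" using C e by (auto simp: g0_def)
  have "(1 + \<bar>x\<bar>) ^ 10 * exp \<bar>x\<bar> * \<gamma> powr (q - 2) \<le> \<eta>"
    if g: "\<gamma> \<in> {0<..g0}" and x: "\<gamma> powr (p - 2) \<le> K * exp (- x\<^sup>2 / 2)" for \<gamma> x
  proof -
    define y where "y = \<bar>x\<bar>"
    have "((1 + y) / 10) ^ 10 \<le> exp ((1 + y) / 10) ^ 10"
      using exp_ge_add_one_self[of "(1 + y) / 10"] by (intro power_mono) (linarith, simp add: y_def)
    also have "\<dots> = exp (1 + y)" by (simp flip: exp_of_nat_mult)
    finally have 1: "(1 + y) ^ 10 \<le> 10 ^ 10 * exp (1 + y)" by (simp add: power_divide)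
    have "(\<gamma> powr (p - 2)) powr t \<le> (K * exp (- x\<^sup>2 / 2)) powr t"
      using x t by (intro powr_mono2) auto
    also have "\<dots> = K powr t * exp (- (t * y\<^sup>2 / 2))" using K by (simp add: powr_mult exp_powr_real y_def mult.commute)
    finally have 2: "(\<gamma> powr (p - 2)) powr t \<le> K powr t * exp (- (t * y\<^sup>2 / 2))" .
    have "\<gamma> powr ((q - 2) / 2) \<le> ((\<eta> / C) powr (2 / (q - 2))) powr ((q - 2) / 2)"
      using g q by (intro powr_mono2) (auto simp: g0_def)
    also have "\<dots> = \<eta> / C"
    proof -
      have one: "2 / (q - 2) * ((q - 2) / 2) = 1" using q by (simp add: field_simps)
      show ?thesis unfolding powr_powr one using C e by simp
    qed
    finally have 3: "\<gamma> powr ((q - 2) / 2) \<le> \<eta> / C" .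
    have "z * (w / (2 * z)) = w / 2" if "z \<noteq> 0" for z w :: real using that by simp
    from this[of "p - 2" "q - 2"] have "(p - 2) * t = (q - 2) / 2" using p unfolding t_def by simp
    then have "\<gamma> powr (q - 2) = \<gamma> powr ((q - 2) / 2) * (\<gamma> powr (p - 2)) powr t"
      unfolding powr_powr powr_add[symmetric] by (simp only: field_sum_of_halves)
    also have "\<dots> \<le> \<eta> / C * (K powr t * exp (- (t * y\<^sup>2 / 2)))" using 2 3 e C by (intro mult_mono) auto
    finally have 4: "\<gamma> powr (q - 2) \<le> \<eta> / C * (K powr t * exp (- (t * y\<^sup>2 / 2)))" .
    have "(1 + y) ^ 10 * exp y * \<gamma> powr (q - 2) \<le> 10 ^ 10 * exp (1 + y) * exp y * (\<eta> / C * (K powr t * exp (- (t * y\<^sup>2 / 2))))"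
      using 1 4 by (intro mult_mono) (auto simp: y_def)
    also have "\<dots> = \<eta> / C * 10 ^ 10 * K powr t * exp (1 + 2 * y - t * y\<^sup>2 / 2)"
    proof -
      have "exp (1 + 2 * y - t * y\<^sup>2 / 2) = exp ((1 + y) + y + - (t * y\<^sup>2 / 2))"
        by (rule arg_cong[where f=exp]) simp
      also have "\<dots> = exp (1 + y) * exp y * exp (- (t * y\<^sup>2 / 2))" unfolding exp_add ..
      finally have ee: "exp (1 + 2 * y - t * y\<^sup>2 / 2) = exp (1 + y) * exp y * exp (- (t * y\<^sup>2 / 2))" .
      show ?thesis unfolding ee by (simp only: mult_ac)
    qed
    also have "\<dots> \<le> \<eta> / C * 10 ^ 10 * K powr t * exp (1 + 2 / t)"
    proof -
      have "0 \<le> (t / 2) * (y - 2 / t)\<^sup>2" using t by simp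
      also have "\<dots> = t * y\<^sup>2 / 2 - 2 * y + 2 / t" using t by (simp add: power2_eq_square field_simps)
      finally show ?thesis using e C K by (intro mult_left_mono) auto
    qed
    also have "\<dots> = \<eta>" using K by (simp add: C_def)
    finally show ?thesis by (simp add: y_def)
  qed
  with g0 show ?thesis by blast
qed

text \<open>Relative to \<open>exp (- x^2 / 2) / x\<close>, the three terms stand for one summand
  above \<open>x / 2\<close>, for two large summands, and for one large summand together with a
  large truncated remainder.\<close>

lemma jump_ratio_small:
  assumes p: "p > (2::real)" and e: "\<eta> > 0"
  shows "\<exists>A\<ge>1. \<forall>x\<ge>A. a * x powr (1 - p) + b * (x powr (2 * p + 1) * exp (- x\<^sup>2 / 2)) + c * (x powr (p + 1) * exp (- x\<^sup>2 / 8)) \<le> \<eta>"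
proof -
  have "((\<lambda>x::real. x powr (1 - p)) \<longlongrightarrow> 0) at_top" using p by real_asymp
  moreover have "((\<lambda>x::real. x powr (2 * p + 1) * exp (- x\<^sup>2 / 2)) \<longlongrightarrow> 0) at_top" by real_asymp
  moreover have "((\<lambda>x::real. x powr (p + 1) * exp (- x\<^sup>2 / 8)) \<longlongrightarrow> 0) at_top" by real_asymp
  ultimately have "((\<lambda>x. a * x powr (1 - p) + b * (x powr (2 * p + 1) * exp (- x\<^sup>2 / 2)) + c * (x powr (p + 1) * exp (- x\<^sup>2 / 8)))
      \<longlongrightarrow> a * 0 + b * 0 + c * 0) at_top" by (intro tendsto_intros)
  then have "\<forall>\<^sub>F x in at_top. a * x powr (1 - p) + b * (x powr (2 * p + 1) * exp (- x\<^sup>2 / 2)) + c * (x powr (p + 1) * exp (- x\<^sup>2 / 8)) < \<eta>"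
    using e by (intro order_tendstoD) auto
  then obtain A where "\<forall>x\<ge>A. a * x powr (1 - p) + b * (x powr (2 * p + 1) * exp (- x\<^sup>2 / 2)) + c * (x powr (p + 1) * exp (- x\<^sup>2 / 8)) < \<eta>"
    by (auto simp: eventually_at_top_linorder)
  then show ?thesis by (intro exI[of _ "max 1 A"]) (auto intro: less_imp_le)
qed

context iid_std
begin

lemma sum_jumps_le:
  assumes p: "p > 2" and m: "integrable \<mu> (\<lambda>x. \<bar>x\<bar> powr p)" and L: "L > 0"
    and c: "\<And>i. i \<in> F \<Longrightarrow> 0 \<le> c i" "\<And>i. i \<in> F \<Longrightarrow> c i \<le> \<gamma>" and s: "(\<Sum>i\<in>F. (c i)\<^sup>2) \<le> 1"
  shows "(\<Sum>i\<in>F. \<P>(\<omega> in M. L * (c i * X i \<omega>) > 1)) \<le> L powr p * (LINT x|\<mu>. \<bar>x\<bar> powr p) * \<gamma> powr (p - 2)"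
proof -
  let ?m = "LINT x|\<mu>. \<bar>x\<bar> powr p"
  have "(\<Sum>i\<in>F. \<P>(\<omega> in M. L * (c i * X i \<omega>) > 1)) \<le> (\<Sum>i\<in>F. L powr p * c i powr p * ?m)"
    using p by (intro sum_mono prob_jump_le m L c) auto
  also have "\<dots> = L powr p * ?m * (\<Sum>i\<in>F. c i powr p)" by (simp add: sum_distrib_left mult_ac)
  also have "\<dots> \<le> L powr p * ?m * \<gamma> powr (p - 2)"
    using p by (intro mult_left_mono sum_powr_weights_le c s) (auto intro!: mult_nonneg_nonneg Bochner_Integration.integral_nonneg)
  finally show ?thesis .
qed

text \<open>For \<open>x < A\<close> a union bound over the summands above the cut suffices,
  \<open>\<gamma>\<close> being small. For \<open>x \<ge> A\<close> the event is split at
  \<open>b = x / 2\<close>; each contribution keeps a factor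
  \<open>\<gamma> powr (p - 2) \<le> K * exp (- x^2 / 2)\<close> times something that vanishes
  faster than \<open>1 / x\<close>.\<close>

lemma truncation_error_small:
  assumes p: "p > 2" and mp: "integrable \<mu> (\<lambda>x. \<bar>x\<bar> powr p)" and q: "2 < q" "q \<le> 3"
    and mq: "integrable \<mu> (\<lambda>x. \<bar>x\<bar> powr q)" and K: "K > 0" and e: "\<eta> > 0"
  shows "\<exists>g0\<in>{0<..1::real}. \<forall>\<gamma>\<in>{0<..g0}. \<forall>x. \<gamma> powr (p - 2) \<le> K * exp (- x\<^sup>2 / 2) \<longrightarrow>
    (max 1 x) ^ 3 * (LINT x|\<mu>. \<bar>x\<bar> powr q) * \<gamma> powr (q - 2) \<le> 1 \<longrightarrow>
    (\<forall>c F. finite F \<longrightarrow> (\<forall>i\<in>F. 0 \<le> c i \<and> c i \<le> \<gamma>) \<longrightarrow> (\<Sum>i\<in>F. (c i)\<^sup>2) \<le> 1 \<longrightarrow>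
      \<P>(\<omega> in M. S c F \<omega> \<ge> x) \<le> \<P>(\<omega> in M. T (max 1 x) c F \<omega> \<ge> x) + \<eta> * Q x)"
proof -
  define m where "m = (LINT x|\<mu>. \<bar>x\<bar> powr p)"
  define m' where "m' = (LINT x|\<mu>. \<bar>x\<bar> powr q)"
  have m0: "m \<ge> 0" "m' \<ge> 0" unfolding m_def m'_def by (auto intro!: Bochner_Integration.integral_nonneg)
  obtain A where A: "A \<ge> 1" and ratio: "\<And>x. x \<ge> A \<Longrightarrow>
     K * m * 4 powr p * x powr (1 - p) + K * m * m * K * (x powr (2 * p + 1) * exp (- x\<^sup>2 / 2)) +
      K * m * exp 1 * (x powr (p + 1) * exp (- x\<^sup>2 / 8)) \<le> \<eta> * kQ"
    using jump_ratio_small[OF p, of "\<eta> * kQ" "K * m * 4 powr p" "K * m * m * K" "K * m * exp 1"] e kQ_pos by auto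
  define B where "B = A powr p * (m + 1)"
  have B: "B > 0" using A m0 by (simp add: B_def)
  \<comment> \<open>Gives \<open>B * \<gamma> powr (p - 2) \<le> \<eta> * Q A\<close>, and for
    \<open>x < A\<close> the allowed error \<open>\<eta> * Q x\<close> is at least that.\<close>
  define g0 where "g0 = min 1 ((\<eta> * Q A / B) powr (1 / (p - 2)))"
  have g0: "g0 \<in> {0<..1}" using B e Q_pos[of A] by (auto simp: g0_def)
  have "\<P>(\<omega> in M. S c F \<omega> \<ge> x) \<le> \<P>(\<omega> in M. T (max 1 x) c F \<omega> \<ge> x) + \<eta> * Q x"
    if g: "\<gamma> \<in> {0<..g0}" and gx: "\<gamma> powr (p - 2) \<le> K * exp (- x\<^sup>2 / 2)"
      and Lm: "(max 1 x) ^ 3 * m' * \<gamma> powr (q - 2) \<le> 1"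
      and F: "finite F" and c: "\<And>i. i \<in> F \<Longrightarrow> 0 \<le> c i" "\<And>i. i \<in> F \<Longrightarrow> c i \<le> \<gamma>" and s: "(\<Sum>i\<in>F. (c i)\<^sup>2) \<le> 1"
    for \<gamma> x c F
  proof (cases "x < A")
    case True
    have L: "max 1 x \<le> A" using True A by auto
    have "\<gamma> powr (p - 2) \<le> ((\<eta> * Q A / B) powr (1 / (p - 2))) powr (p - 2)"
      using g p by (intro powr_mono2) (auto simp: g0_def)
    also have "\<dots> = \<eta> * Q A / B" using p e B Q_pos[of A] by (simp add: powr_powr)
    finally have gB: "B * \<gamma> powr (p - 2) \<le> \<eta> * Q A" using B by (simp add: field_simps)
    have "(\<Sum>i\<in>F. \<P>(\<omega> in M. max 1 x * (c i * X i \<omega>) > 1)) \<le> max 1 x powr p * m * \<gamma> powr (p - 2)"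
      unfolding m_def by (rule sum_jumps_le[OF p mp _ c s]) auto
    also have "\<dots> \<le> B * \<gamma> powr (p - 2)"
      unfolding B_def using L p m0 by (intro mult_right_mono mult_mono powr_mono2) auto
    also have "\<dots> \<le> \<eta> * Q x"
      using gB Q_antimono[of x A] True e by (smt (verit) mult_left_mono)
    finally show ?thesis using prob_S_le_T_plus_jumps[OF F, of x c "max 1 x"] by linarith
  next
    case False
    then have x: "x \<ge> A" "x \<ge> 1" using A by auto
    then have Lx: "max 1 x = x" by simp
    define P where "P = \<gamma> powr (p - 2)"
    have P: "0 \<le> P" "P \<le> K * exp (- x\<^sup>2 / 2)" using gx by (auto simp: P_def)
    \<comment> \<open>The factor 4 instead of 2 turns the non-strict \<open>\<ge> x / 2\<close> into
      the strict inequality of \<open>sum_jumps_le\<close>.\<close>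
    have big: "(\<Sum>i\<in>F. \<P>(\<omega> in M. c i * X i \<omega> \<ge> x / 2)) \<le> (4 / x) powr p * m * P"
    proof -
      have "(\<Sum>i\<in>F. \<P>(\<omega> in M. c i * X i \<omega> \<ge> x / 2)) \<le> (\<Sum>i\<in>F. \<P>(\<omega> in M. 4 / x * (c i * X i \<omega>) > 1))"
        using x by (intro sum_mono finite_measure_mono) (auto simp: field_simps)
      also have "\<dots> \<le> (4 / x) powr p * m * P"
        unfolding m_def P_def using x by (intro sum_jumps_le[OF p mp _ c s]) auto
      finally show ?thesis .
    qed
    \<comment> \<open>Chernoff with parameter \<open>x / 2\<close> at level \<open>x / 2\<close>
      gives the exponent \<open>- (x / 2)^2 + (x / 2)^2 / 2 + 1 = 1 - x^2 / 8\<close>. A union bound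
      for the jumps of the remainder is affordable here, as the result gets multiplied by another
      jump probability.\<close>
    have rest: "\<P>(\<omega> in M. S c (F - {i}) \<omega> \<ge> x - x / 2) \<le> exp 1 * exp (- x\<^sup>2 / 8) + x powr p * m * P" if "i \<in> F" for i
    proof -
      have F': "finite (F - {i})" using F by simp
      have c': "\<And>j. j \<in> F - {i} \<Longrightarrow> 0 \<le> c j" "\<And>j. j \<in> F - {i} \<Longrightarrow> c j \<le> \<gamma>" using c by auto
      have s': "(\<Sum>j\<in>F - {i}. (c j)\<^sup>2) \<le> 1"
        using s F by (intro order_trans[OF sum_mono2[of F "F - {i}"]]) auto
      have sq: "(\<Sum>j\<in>F - {i}. c j powr q) \<le> \<gamma> powr (q - 2)" using q by (intro sum_powr_weights_le c' s') auto
      have "x - x / 2 = x / 2" by simp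
      then have "\<P>(\<omega> in M. S c (F - {i}) \<omega> \<ge> x - x / 2) \<le> \<P>(\<omega> in M. T x c (F - {i}) \<omega> \<ge> x / 2) +
          (\<Sum>j\<in>F - {i}. \<P>(\<omega> in M. x * (c j * X j \<omega>) > 1))"
        using prob_S_le_T_plus_jumps[OF F', of "x/2" c x] by simp
      also have "(\<Sum>j\<in>F - {i}. \<P>(\<omega> in M. x * (c j * X j \<omega>) > 1)) \<le> x powr p * m * P"
        unfolding m_def P_def using x by (intro sum_jumps_le[OF p mp _ c' s']) auto
      also have "\<P>(\<omega> in M. T x c (F - {i}) \<omega> \<ge> x / 2) \<le>
        exp (- (x/2) * (x/2) + (x/2)\<^sup>2 * (\<Sum>j\<in>F - {i}. (c j)\<^sup>2) / 2 + (x/2) powr q * (\<Sum>j\<in>F - {i}. c j powr q) * m')"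
        unfolding m'_def using x by (intro chernoff_trunc[OF _ q mq F' c'(1)]) auto
      also have "\<dots> \<le> exp (1 + (- x\<^sup>2 / 8))"
      proof -
        have "(x/2)\<^sup>2 * (\<Sum>j\<in>F - {i}. (c j)\<^sup>2) \<le> (x/2)\<^sup>2 * 1" by (intro mult_left_mono s') auto
        moreover have "(x/2) powr q * (\<Sum>j\<in>F - {i}. c j powr q) * m' \<le> 1"
        proof -
          have "(x/2) powr q \<le> x powr q" using x q by (intro powr_mono2) auto
          also have "\<dots> \<le> x powr 3" using x q by (intro powr_mono) auto
          finally have "(x/2) powr q \<le> x ^ 3" using x by (simp add: powr_numeral)
          then have "(x/2) powr q * (\<Sum>j\<in>F - {i}. c j powr q) * m' \<le> x ^ 3 * \<gamma> powr (q - 2) * m'"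
            using m0 sq x by (intro mult_right_mono mult_mono) (auto intro!: sum_nonneg)
          also have "\<dots> \<le> 1" using Lm unfolding Lx by (simp add: mult_ac)
          finally show ?thesis .
        qed
        ultimately have "- (x/2) * (x/2) + (x/2)\<^sup>2 * (\<Sum>j\<in>F - {i}. (c j)\<^sup>2) / 2 + (x/2) powr q * (\<Sum>j\<in>F - {i}. c j powr q) * m'
          \<le> - (x/2) * (x/2) + (x/2)\<^sup>2 / 2 + 1" by simp
        also have "\<dots> = 1 + (- x\<^sup>2 / 8)" by (simp add: power2_eq_square)
        finally show ?thesis by simp
      qed
      finally have "\<P>(\<omega> in M. S c (F - {i}) \<omega> \<ge> x - x / 2) \<le> exp (1 + (- x\<^sup>2 / 8)) + x powr p * m * P" by simp
      then show ?thesis unfolding exp_add .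
    qed
    let ?R = "exp 1 * exp (- x\<^sup>2 / 8) + x powr p * m * P"
    have "(\<Sum>i\<in>F. \<P>(\<omega> in M. x * (c i * X i \<omega>) > 1) * \<P>(\<omega> in M. S c (F - {i}) \<omega> \<ge> x - x / 2)) \<le>
        (\<Sum>i\<in>F. \<P>(\<omega> in M. x * (c i * X i \<omega>) > 1) * ?R)"
      by (intro sum_mono mult_left_mono rest) auto
    also have "\<dots> = (\<Sum>i\<in>F. \<P>(\<omega> in M. x * (c i * X i \<omega>) > 1)) * ?R" by (simp only: sum_distrib_right)
    also have "\<dots> \<le> (x powr p * m * P) * ?R"
      unfolding m_def P_def using x m0 P
      by (intro mult_right_mono sum_jumps_le[OF p mp _ c s]) (auto simp: m_def[symmetric])
    finally have two: "(\<Sum>i\<in>F. \<P>(\<omega> in M. x * (c i * X i \<omega>) > 1) * \<P>(\<omega> in M. S c (F - {i}) \<omega> \<ge> x - x / 2)) \<le> (x powr p * m * P) * ?R" .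
    have "(4 / x) powr p * m * P + (x powr p * m * P) * ?R = P * (m * (4 / x) powr p + m * x powr p * (exp 1 * exp (- x\<^sup>2 / 8)) + m * x powr p * x powr p * m * P)"
      by (simp add: algebra_simps)
    also have "\<dots> \<le> (K * exp (- x\<^sup>2 / 2)) * (m * (4 / x) powr p + m * x powr p * (exp 1 * exp (- x\<^sup>2 / 8)) + m * x powr p * x powr p * m * (K * exp (- x\<^sup>2 / 2)))"
      using P m0 by (intro mult_mono add_mono mult_left_mono) (auto intro!: add_nonneg_nonneg mult_nonneg_nonneg)
    also have "\<dots> = exp (- x\<^sup>2 / 2) / x * (K * m * 4 powr p * x powr (1 - p) + K * m * m * K * (x powr (2 * p + 1) * exp (- x\<^sup>2 / 2)) +
      K * m * exp 1 * (x powr (p + 1) * exp (- x\<^sup>2 / 8)))"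
    proof -
      define w where "w = x powr p"
      have w: "w > 0" "x > 0" using x by (auto simp: w_def)
      have pw: "(4 / x) powr p = 4 powr p / w" "x powr (1 - p) = x / w" "x powr (2 * p + 1) = w * w * x" "x powr (p + 1) = w * x"
      proof -
        show "(4 / x) powr p = 4 powr p / w" using w(2) unfolding w_def by (intro powr_divide)
        show "x powr (1 - p) = x / w" using w(2) unfolding w_def powr_diff by simp
        have "x powr (2 * p + 1) = x powr (p + p) * x powr 1" unfolding powr_add[symmetric] by simp
        then show "x powr (2 * p + 1) = w * w * x" unfolding powr_add w_def using w(2) by simp
        show "x powr (p + 1) = w * x" using w(2) unfolding w_def powr_add by simp
      qed
      have alg: "(K * E) * (m * (f / w) + m * w * (e * W) + m * w * w * m * (K * E)) =
          E / x * (K * m * f * (x / w) + K * m * m * K * (w * w * x * E) + K * m * e * (w * x * W))" for E W f e :: real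
      proof -
        have "E / x * (K * m * f * (x / w) + K * m * m * K * (w * w * x * E) + K * m * e * (w * x * W)) =
            (x / x) * E * K * (m * f / w + m * m * K * w * w * E + m * e * w * W)"
          by (simp add: distrib_left mult_ac)
        also have "x / x = 1" using w by simp
        finally show ?thesis by (simp add: distrib_left mult_ac)
      qed
      show ?thesis unfolding pw w_def[symmetric] by (rule alg)
    qed
    also have "\<dots> \<le> exp (- x\<^sup>2 / 2) / x * (\<eta> * kQ)" using x by (intro mult_left_mono ratio) auto
    also have "\<dots> = \<eta> * (kQ * exp (- (max x 0)\<^sup>2 / 2) / max 1 x)" using x by simp
    also have "\<dots> \<le> \<eta> * Q x" using e by (intro mult_left_mono Q_ge) auto
    finally show ?thesis using prob_S_le_one_big_jump[OF F, of x c x "x/2"] big two unfolding Lx by linarith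
  qed
  with g0 show ?thesis unfolding m'_def by blast
qed

text \<open>The order of quantifiers matters: \<open>g0\<close> is uniform in \<open>x\<close>, as
  the limit in \<open>n\<close> needs, while \<open>s0\<close> may depend on \<open>x\<close> and
  \<open>\<gamma>\<close>, since a finite section of the process can be taken with variance as close
  to 1 as desired.\<close>

theorem moderate_deviations_finite:
  assumes p: "p > 2" and mp: "integrable \<mu> (\<lambda>x. \<bar>x\<bar> powr p)" and K: "K > 0" and e: "\<epsilon> > 0"
  shows "\<exists>g0>0. \<forall>\<gamma>\<in>{0<..g0}. \<forall>x. \<gamma> powr (p - 2) \<le> K * exp (- x\<^sup>2 / 2) \<longrightarrow>
    (\<exists>s0<1. \<forall>c F. finite F \<longrightarrow> (\<forall>i\<in>F. 0 \<le> c i \<and> c i \<le> \<gamma>) \<longrightarrow>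
      s0 \<le> (\<Sum>i\<in>F. (c i)\<^sup>2) \<longrightarrow> (\<Sum>i\<in>F. (c i)\<^sup>2) \<le> 1 \<longrightarrow> \<bar>\<P>(\<omega> in M. S c F \<omega> \<ge> x) - Q x\<bar> \<le> \<epsilon> * Q x)"
proof -
  \<comment> \<open>The spline has an expansion of third order, so \<open>q\<close> is capped at
    3.\<close>
  define q where "q = min p 3"
  have q: "2 < q" "q \<le> 3" "q \<le> p" using p by (auto simp: q_def)
  have mq: "integrable \<mu> (\<lambda>x. \<bar>x\<bar> powr q)"
  proof (rule Bochner_Integration.integrable_bound)
    show "integrable \<mu> (\<lambda>x. 1 + \<bar>x\<bar> powr p)" using mp by auto
    have "\<bar>x\<bar> powr q \<le> 1 + \<bar>x\<bar> powr p" for x :: real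
    proof (cases "\<bar>x\<bar> \<le> 1")
      case True
      then have "\<bar>x\<bar> powr q \<le> 1" using q by (intro powr_le1) auto
      then show ?thesis by (simp add: add_increasing2)
    next
      case False
      then have "\<bar>x\<bar> powr q \<le> \<bar>x\<bar> powr p" using q by (intro powr_mono) auto
      then show ?thesis by simp
    qed
    then show "AE x in \<mu>. norm (\<bar>x\<bar> powr q) \<le> norm (1 + \<bar>x\<bar> powr p)" by simp
  qed measurable
  define m where "m = (LINT x|\<mu>. \<bar>x\<bar> powr q)"
  have m0: "m \<ge> 0" unfolding m_def by (intro Bochner_Integration.integral_nonneg) auto
  \<comment> \<open>\<open>1 / 8\<close> keeps the exponents in the increments of \<open>Q\<close>
    at most 1, so that a factor 3 covers them; \<open>\<epsilon> * kQ / 36\<close> makes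
    \<open>12 * h * L / kQ\<close>, the relative change of \<open>Q\<close>, at most
    \<open>\<epsilon> / 3\<close>.\<close>
  define \<delta> where "\<delta> = min (1 / 8) (\<epsilon> * kQ / 36)"
  have d: "\<delta> > 0" "\<delta> \<le> 1 / 8" "\<delta> \<le> \<epsilon> * kQ / 36" using e kQ_pos by (auto simp: \<delta>_def)
  \<comment> \<open>Constants of the replacement error relative to \<open>Q x\<close>:
    \<open>3 / \<delta> ^ 3\<close> from the spline, \<open>exp 3\<close> from the exponents,
    \<open>1 / kQ\<close> from the Gaussian lower bound.\<close>
  define C where "C = 3 * exp 3 * (5 * m + gK) / (\<delta> ^ 3 * kQ)"
  have C0: "C \<ge> 0" using m0 gK_nonneg d kQ_pos by (simp add: C_def)
  define \<eta> where "\<eta> = min 1 (\<epsilon> / 3) / (C + m + 1)"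
  have eta: "\<eta> > 0" "\<eta> \<le> 1" "m * \<eta> \<le> 1" "C * \<eta> \<le> \<epsilon> / 3"
  proof -
    show "\<eta> > 0" using e C0 m0 by (auto simp: \<eta>_def)
    have N: "C + m + 1 > 0" using C0 m0 by simp
    have a: "k * \<eta> \<le> min 1 (\<epsilon> / 3)" if "0 \<le> k" "k \<le> C + m + 1" for k
    proof -
      have "k * min 1 (\<epsilon> / 3) \<le> (C + m + 1) * min 1 (\<epsilon> / 3)" using that e by (intro mult_right_mono) auto
      then have "k * min 1 (\<epsilon> / 3) / (C + m + 1) \<le> min 1 (\<epsilon> / 3)"
        unfolding pos_divide_le_eq[OF N] by (simp only: mult.commute)
      then show ?thesis unfolding \<eta>_def by (simp only: times_divide_eq_right)
    qed
    show "\<eta> \<le> 1" using a[of 1] C0 m0 by simp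
    show "m * \<eta> \<le> 1" using a[of m] C0 m0 by simp
    show "C * \<eta> \<le> \<epsilon> / 3" using a[of C] C0 m0 by simp
  qed
  obtain g1 where g1: "g1 \<in> {0<..1}" and small: "\<And>\<gamma> x. \<gamma> \<in> {0<..g1} \<Longrightarrow> \<gamma> powr (p - 2) \<le> K * exp (- x\<^sup>2 / 2) \<Longrightarrow>
      (1 + \<bar>x\<bar>) ^ 10 * exp \<bar>x\<bar> * \<gamma> powr (q - 2) \<le> \<eta>"
    using moderate_weight_small[OF p q(1) K eta(1)] by blast
  obtain g2 where g2: "g2 \<in> {0<..1}" and jump: "\<And>\<gamma> x c F. \<gamma> \<in> {0<..g2} \<Longrightarrow> \<gamma> powr (p - 2) \<le> K * exp (- x\<^sup>2 / 2) \<Longrightarrow>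
    (max 1 x) ^ 3 * m * \<gamma> powr (q - 2) \<le> 1 \<Longrightarrow> finite F \<Longrightarrow> (\<forall>i\<in>F. 0 \<le> c i \<and> c i \<le> \<gamma>) \<Longrightarrow> (\<Sum>i\<in>F. (c i)\<^sup>2) \<le> 1 \<Longrightarrow>
      \<P>(\<omega> in M. S c F \<omega> \<ge> x) \<le> \<P>(\<omega> in M. T (max 1 x) c F \<omega> \<ge> x) + \<epsilon> / 3 * Q x"
    using truncation_error_small[OF p mp q(1,2) mq K, of "\<epsilon> / 3"] e unfolding m_def by auto
  have main: "\<exists>s0<1. \<forall>c F. finite F \<longrightarrow> (\<forall>i\<in>F. 0 \<le> c i \<and> c i \<le> \<gamma>) \<longrightarrow>
      s0 \<le> (\<Sum>i\<in>F. (c i)\<^sup>2) \<longrightarrow> (\<Sum>i\<in>F. (c i)\<^sup>2) \<le> 1 \<longrightarrow> \<bar>\<P>(\<omega> in M. S c F \<omega> \<ge> x) - Q x\<bar> \<le> \<epsilon> * Q x"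
    if g: "\<gamma> \<in> {0<..min g1 g2}" and gx: "\<gamma> powr (p - 2) \<le> K * exp (- x\<^sup>2 / 2)" for \<gamma> x
  proof -
    define L where "L = max 1 x"
    define g where "g = \<gamma> powr (q - 2)"
    \<comment> \<open>The width satisfies \<open>L * h \<le> \<delta>\<close>, which puts it below
      the scale \<open>1 / L\<close> on which \<open>Q\<close> changes by a constant factor.\<close>
    define h where "h = \<delta> / L\<^sup>2"
    define y where "y = max x 0"
    have L: "L \<ge> 1" "L \<le> 1 + \<bar>x\<bar>" "y \<le> L" "0 \<le> y" by (auto simp: L_def y_def)
    have gg: "0 < \<gamma>" "\<gamma> \<le> 1" using g g1 by auto
    have g0: "g \<ge> 0" by (simp add: g_def)
    have sm: "(1 + \<bar>x\<bar>) ^ 10 * exp \<bar>x\<bar> * g \<le> \<eta>" using small[of \<gamma> x] g gx by (simp add: g_def)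
    have Lk: "L ^ k * g \<le> \<eta>" if "k \<le> 10" for k
    proof -
      have "L ^ k \<le> L ^ 10" using L that by (intro power_increasing)
      also have "\<dots> \<le> (1 + \<bar>x\<bar>) ^ 10" using L by (intro power_mono) auto
      also have "\<dots> \<le> (1 + \<bar>x\<bar>) ^ 10 * exp \<bar>x\<bar>"
        using mult_left_mono[of 1 "exp \<bar>x\<bar>" "(1 + \<bar>x\<bar>) ^ 10"] by simp
      finally have "L ^ k * g \<le> (1 + \<bar>x\<bar>) ^ 10 * exp \<bar>x\<bar> * g" by (intro mult_right_mono g0)
      with sm show ?thesis by simp
    qed
    have L3: "L ^ 3 * m * g \<le> 1"
    proof -
      have "m * (L ^ 3 * g) \<le> m * \<eta>" using Lk[of 3] m0 by (intro mult_left_mono) auto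
      then show ?thesis using eta(3) by (simp add: mult_ac)
    qed
    have Lg: "L * \<gamma> \<le> 1"
    proof -
      have "\<gamma> powr 1 \<le> g" unfolding g_def using gg q by (intro powr_mono') auto
      then have "L * \<gamma> \<le> L ^ 1 * g" using L gg by (simp add: mult_left_mono)
      then show ?thesis using Lk[of 1] eta by simp
    qed
    have L2: "1 \<le> L\<^sup>2" "L \<le> L\<^sup>2" using L power_increasing[of 1 2 L] by auto
    have h: "0 < h" "h \<le> \<delta>" "L * h \<le> \<delta>" "h \<le> 1"
    proof -
      show "0 < h" using d L by (simp add: h_def)
      show 1: "h \<le> \<delta>" using d L2 by (simp add: h_def divide_le_eq mult_left_le)
      show "L * h \<le> \<delta>" using mult_left_mono[OF L2(2), of \<delta>] d L by (simp add: h_def divide_le_eq mult.commute)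
      show "h \<le> 1" using 1 d by simp
    qed
    have hL: "h * L \<le> \<delta>" using h by (simp add: mult.commute)
    have Qlow: "exp (- y\<^sup>2 / 2) \<le> L / kQ * Q x"
      using Q_ge[of x] kQ_pos L unfolding L_def[symmetric] y_def[symmetric] by (simp add: field_simps)
    have smooth: "4 * h * (3 * exp (- y\<^sup>2 / 2)) \<le> \<epsilon> / 3 * Q x"
    proof -
      have "4 * h * (3 * exp (- y\<^sup>2 / 2)) \<le> 4 * h * (3 * (L / kQ * Q x))"
        using Qlow h by (intro mult_left_mono) auto
      also have "\<dots> = (h * L) * (12 / kQ) * Q x" by simp
      also have "\<dots> \<le> (\<epsilon> * kQ / 36) * (12 / kQ) * Q x"
        using hL d Q_pos[of x] kQ_pos by (intro mult_right_mono) auto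
      also have "\<dots> = \<epsilon> / 3 * Q x" using kQ_pos by simp
      finally show ?thesis .
    qed
    have e1: "exp z \<le> 3" if "z \<le> 1" for z :: real using that exp_le by (meson exp_le_cancel_iff order_trans)
    have Qup: "Q (x - 4 * h) \<le> Q x + \<epsilon> / 3 * Q x"
    proof -
      have "y * (4 * h) \<le> L * (4 * h)" using L h by (intro mult_right_mono) auto
      also have "\<dots> = 4 * (L * h)" by simp
      also have "\<dots> \<le> 1" using h(3) d(2) by linarith
      finally have "y * (4 * h) \<le> 1" .
      then have "exp (- y\<^sup>2 / 2 + y * (4 * h)) \<le> 3 * exp (- y\<^sup>2 / 2)"
        unfolding exp_add using mult_left_mono[OF e1, of "y * (4 * h)" "exp (- y\<^sup>2 / 2)"] by simp
      then have "4 * h * exp (- y\<^sup>2 / 2 + y * (4 * h)) \<le> 4 * h * (3 * exp (- y\<^sup>2 / 2))" using h by (intro mult_left_mono) auto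
      then show ?thesis using Q_diff_le[of "4 * h" x] h smooth unfolding y_def by linarith
    qed
    have Qdown: "Q (x + 4 * h) \<ge> Q x - \<epsilon> / 3 * Q x"
    proof -
      define z where "z = max (x + 4 * h) 0"
      have z: "y \<le> z" "z \<le> y + 4 * h" "0 \<le> z" using h by (auto simp: z_def y_def)
      have "z * (4 * h) \<le> (L + 4 * h) * (4 * h)" using z L h by (intro mult_right_mono) auto
      also have "\<dots> = 4 * (L * h) + 16 * (h * h)" by (simp add: algebra_simps)
      also have "\<dots> \<le> 4 * (1/8) + 16 * ((1/8) * (1/8))" using h d by (intro add_mono mult_left_mono mult_mono) auto
      finally have "z * (4 * h) \<le> 1" by simp
      moreover have "y\<^sup>2 \<le> z\<^sup>2" using z L by (intro power_mono) auto
      ultimately have "exp (- z\<^sup>2 / 2 + z * (4 * h)) \<le> exp (- y\<^sup>2 / 2 + 1)" by simp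
      also have "\<dots> \<le> 3 * exp (- y\<^sup>2 / 2)"
        unfolding exp_add using mult_left_mono[OF exp_le, of "exp (- y\<^sup>2 / 2)"] by simp
      finally have "4 * h * exp (- z\<^sup>2 / 2 + z * (4 * h)) \<le> 4 * h * (3 * exp (- y\<^sup>2 / 2))" using h by (intro mult_left_mono) auto
      moreover have "Q (x + 4 * h - 4 * h) = Q x" by simp
      ultimately show ?thesis
        using Q_diff_le[of "4 * h" "x + 4 * h"] h smooth unfolding z_def by linarith
    qed
    define err where "err = 3 / h ^ 3 * exp (- L * x + 3 * L * h) * exp (L\<^sup>2 / 2 + L ^ 3 * m * g) * (L ^ 3 * (5 * m + gK) * g)"
    have err: "err \<le> \<epsilon> / 3 * Q x"
    proof -
      \<comment> \<open>For \<open>x \<ge> 1\<close> the tilt is \<open>L = x\<close> and the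
        exponent is exactly \<open>- x^2 / 2\<close>. Otherwise \<open>L = 1\<close> and
        \<open>1 + |x|\<close> absorbs everything, which is why \<open>exp |x|\<close> is part of
        \<open>moderate_weight_small\<close>.\<close>
      have x1: "- L * x + L\<^sup>2 / 2 \<le> 1 + \<bar>x\<bar> - y\<^sup>2 / 2"
      proof (cases "x \<ge> 1")
        case True
        then show ?thesis by (simp add: L_def y_def power2_eq_square)
      next
        case False
        then have "L = 1" "y\<^sup>2 \<le> 1" by (auto simp: L_def y_def intro!: power_le_one)
        then show ?thesis by simp
      qed
      have "exp (- L * x + 3 * L * h) * exp (L\<^sup>2 / 2 + L ^ 3 * m * g) = exp ((- L * x + L\<^sup>2 / 2) + 3 * (L * h) + L ^ 3 * m * g)"
        by (simp add: exp_add[symmetric] algebra_simps)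
      also have "\<dots> \<le> exp (1 + \<bar>x\<bar> - y\<^sup>2 / 2 + 1 + 1)" using x1 h d L3 by simp
      also have "\<dots> = exp 3 * exp \<bar>x\<bar> * exp (- y\<^sup>2 / 2)" by (simp add: exp_add[symmetric])
      also have "\<dots> \<le> exp 3 * exp \<bar>x\<bar> * (L / kQ * Q x)" using Qlow by (intro mult_left_mono) auto
      finally have ex: "exp (- L * x + 3 * L * h) * exp (L\<^sup>2 / 2 + L ^ 3 * m * g) \<le> exp 3 * exp \<bar>x\<bar> * (L / kQ * Q x)" .
      have h3: "3 / h ^ 3 = 3 * L ^ 6 / \<delta> ^ 3" using L by (simp add: h_def power_divide power_mult[symmetric])
      have "err = 3 * L ^ 6 / \<delta> ^ 3 * (exp (- L * x + 3 * L * h) * exp (L\<^sup>2 / 2 + L ^ 3 * m * g)) * (L ^ 3 * (5 * m + gK) * g)"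
        unfolding err_def h3 by (simp add: mult.assoc)
      also have "\<dots> \<le> 3 * L ^ 6 / \<delta> ^ 3 * (exp 3 * exp \<bar>x\<bar> * (L / kQ * Q x)) * (L ^ 3 * (5 * m + gK) * g)"
        using ex L d m0 gK_nonneg g0 by (intro mult_right_mono mult_left_mono) auto
      also have "\<dots> = C * (L ^ 6 * L * L ^ 3 * exp \<bar>x\<bar> * g) * Q x"
        by (simp add: C_def)
      \<comment> \<open>\<open>L ^ 6\<close> comes from \<open>1 / h ^ 3\<close>, \<open>L\<close>
        from the lower bound of \<open>Q\<close> and \<open>L ^ 3\<close> from the moment bounds;
        hence the exponent 10 in \<open>moderate_weight_small\<close>.\<close>
      also have "L ^ 6 * L * L ^ 3 = L ^ 10" by (simp add: power_add[symmetric] flip: power_Suc2)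
      also have "C * (L ^ 10 * exp \<bar>x\<bar> * g) * Q x \<le> C * \<eta> * Q x"
      proof -
        have "L ^ 10 * exp \<bar>x\<bar> * g \<le> (1 + \<bar>x\<bar>) ^ 10 * exp \<bar>x\<bar> * g"
          using L g0 by (intro mult_right_mono power_mono) auto
        from order_trans[OF this sm] show ?thesis
          using C0 Q_pos[of x] by (intro mult_right_mono mult_left_mono) (simp_all only: less_imp_le)
      qed
      also have "\<dots> \<le> \<epsilon> / 3 * Q x" using eta Q_pos[of x] by (intro mult_right_mono) auto
      finally show ?thesis .
    qed
    \<comment> \<open>Chosen so that division by a standard deviation \<open>s\<close> between
      \<open>s1\<close> and 1 moves the levels \<open>x - 3 * h\<close> and \<open>x + 3 * h\<close>
      outwards by at most \<open>h\<close>: this amounts to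
      \<open>(|x| + 3) * (1 - s) \<le> h * s\<close>.\<close>
    define s1 where "s1 = (\<bar>x\<bar> + 3) / (\<bar>x\<bar> + 3 + h)"
    have s1: "0 < s1" "s1 < 1" using h by (auto simp: s1_def)
    show ?thesis
    proof (intro exI[of _ "s1\<^sup>2"] conjI allI impI)
      show "s1\<^sup>2 < 1" using s1 by (simp add: power_less_one_iff)
      fix c :: "'i \<Rightarrow> real" and F assume F: "finite F" and c: "\<forall>i\<in>F. 0 \<le> c i \<and> c i \<le> \<gamma>"
        and s0: "s1\<^sup>2 \<le> (\<Sum>i\<in>F. (c i)\<^sup>2)" and s: "(\<Sum>i\<in>F. (c i)\<^sup>2) \<le> 1"
      have sp: "0 < (\<Sum>i\<in>F. (c i)\<^sup>2)" using s0 s1 by (smt (verit) zero_less_power)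
      define s where "s = sqrt (\<Sum>i\<in>F. (c i)\<^sup>2)"
      have ss: "s1 \<le> s" "s \<le> 1" "0 < s" using s0 s s1 sp by (auto simp: s_def real_le_rsqrt)
      have sh: "(\<bar>x\<bar> + 3) * (1 - s) \<le> h * s"
      proof -
        have "(\<bar>x\<bar> + 3) \<le> s * (\<bar>x\<bar> + 3 + h)" using ss h by (simp add: s1_def divide_le_eq)
        then show ?thesis by (simp add: algebra_simps)
      qed
      have "0 \<le> 1 - s" using ss by simp
      then have ab: "\<bar>z\<bar> * (1 - s) \<le> h * s" if "\<bar>z\<bar> \<le> \<bar>x\<bar> + 3" for z
        by (rule order_trans[OF mult_right_mono[OF that] sh])
      have "\<bar>x - 3 * h\<bar> \<le> \<bar>x\<bar> + 3" "\<bar>x + 3 * h\<bar> \<le> \<bar>x\<bar> + 3" using h by auto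
      from this[THEN ab] have "\<bar>x - 3 * h\<bar> * (1 - s) \<le> h * s" "\<bar>x + 3 * h\<bar> * (1 - s) \<le> h * s" .
      moreover have "- z * (1 - s) \<le> \<bar>z\<bar> * (1 - s)" "z * (1 - s) \<le> \<bar>z\<bar> * (1 - s)" for z
        using ss by (intro mult_right_mono; simp)+
      ultimately have "- (x - 3 * h) * (1 - s) \<le> h * s" "(x + 3 * h) * (1 - s) \<le> h * s"
        using order_trans by blast+
      then have lo: "x - 4 * h \<le> (x - 3 * h) / s" and hi: "(x + 3 * h) / s \<le> x + 4 * h"
        unfolding pos_le_divide_eq[OF ss(3)] pos_divide_le_eq[OF ss(3)] by (simp_all add: algebra_simps)
      have c': "\<And>i. i \<in> F \<Longrightarrow> 0 \<le> c i" "\<And>i. i \<in> F \<Longrightarrow> c i \<le> \<gamma>" using c by auto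
      note G = prob_T_gauss[where x=x, OF L(1) q(1,2) mq F c' Lg s sp h(1,4), folded m_def s_def g_def, folded err_def]
      have "\<P>(\<omega> in M. S c F \<omega> \<ge> x) \<le> \<P>(\<omega> in M. T L c F \<omega> \<ge> x) + \<epsilon> / 3 * Q x"
        unfolding L_def using g gx L3 F c s by (intro jump[of \<gamma>]) (auto simp: L_def g_def)
      also have "\<P>(\<omega> in M. T L c F \<omega> \<ge> x) \<le> Q ((x - 3 * h) / s) + err" by (rule G(1))
      also have "Q ((x - 3 * h) / s) \<le> Q (x - 4 * h)" by (rule Q_antimono[OF lo])
      finally have up: "\<P>(\<omega> in M. S c F \<omega> \<ge> x) \<le> Q x + \<epsilon> * Q x" using Qup err by simp
      have "Q (x + 4 * h) - err \<le> \<P>(\<omega> in M. T L c F \<omega> \<ge> x)"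
        using G(2) Q_antimono[OF hi] by linarith
      also have "\<dots> \<le> \<P>(\<omega> in M. S c F \<omega> \<ge> x)"
        using L T_le_S[of L c F] by (intro finite_measure_mono) (auto intro: order_trans)
      finally have "Q x - \<epsilon> * Q x \<le> \<P>(\<omega> in M. S c F \<omega> \<ge> x)"
      proof -
        have r: "\<epsilon> / 3 * Q x = \<epsilon> * Q x / 3" by simp
        assume "Q (x + 4 * h) - err \<le> \<P>(\<omega> in M. S c F \<omega> \<ge> x)"
        then show ?thesis using Qdown err mult_pos_pos[OF e Q_pos[of x]] unfolding r by linarith
      qed
      with up show "\<bar>\<P>(\<omega> in M. S c F \<omega> \<ge> x) - Q x\<bar> \<le> \<epsilon> * Q x" by (simp add: abs_le_iff)
    qed
  qed
  show ?thesis
    by (rule exI[of _ "min g1 g2"]) (use g1 g2 main in auto)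
qed

end

section \<open>Large deviations of finite sums\<close>

text \<open>The factor \<open>exp q\<close> is the price for positive \<open>w\<close>; for negative
  \<open>w\<close> the bound holds even with coefficient 1, so no lower restriction on
  \<open>w\<close> appears.\<close>

lemma exp_le_quadratic:
  assumes q: "q \<ge> 0" and w: "w \<le> (q::real)"
  shows "exp w \<le> 1 + w + exp q * w\<^sup>2 / 2"
proof -
  obtain t where t: "\<bar>t\<bar> \<le> \<bar>w\<bar>" "exp w = (\<Sum>m<2. w ^ m / fact m) + exp t / fact 2 * w ^ 2"
    using Maclaurin_exp_le[of w 2] by auto
  show ?thesis
  proof (cases "w \<ge> 0")
    case True
    then have "exp t \<le> exp q" using t(1) w by simp
    then have "exp t * w\<^sup>2 \<le> exp q * w\<^sup>2" by (intro mult_right_mono) auto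
    then show ?thesis unfolding t(2) by (simp add: numeral_2_eq_2)
  next
    case False
    have "1 + w + w\<^sup>2 / 2 \<ge> exp w"
    proof -
      have "exp (- w) \<ge> 1 + (- w) + (- w)\<^sup>2 / 2" using False by (intro exp_lower_Taylor_quadratic) auto
      then have a: "exp (- w) \<ge> 1 - w + w\<^sup>2 / 2" by simp
      have p: "1 + w + w\<^sup>2 / 2 > 0"
      proof -
        have "0 < 1 / 2 + (w + 1)\<^sup>2 / 2" by (simp add: add_pos_nonneg)
        then show ?thesis by (simp add: power2_eq_square field_simps)
      qed
      \<comment> \<open>This product inequality turns the lower Taylor bound for
        \<open>exp (- w)\<close> into an upper bound for \<open>exp w\<close>.\<close>
      have "1 \<le> (1 + w + w\<^sup>2 / 2) * (1 - w + w\<^sup>2 / 2)"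
      proof -
        have "(1 + w + w\<^sup>2 / 2) * (1 - w + w\<^sup>2 / 2) = 1 + (w\<^sup>2)\<^sup>2 / 4" by (simp add: power2_eq_square field_simps)
        then show ?thesis by simp
      qed
      also have "\<dots> \<le> (1 + w + w\<^sup>2 / 2) * exp (- w)" using a p by (intro mult_left_mono) auto
      finally show ?thesis by (simp add: exp_minus field_simps)
    qed
    moreover have "1 * w\<^sup>2 \<le> exp q * w\<^sup>2" using q by (intro mult_right_mono) auto
    ultimately show ?thesis by simp
  qed
qed

text \<open>The quotient \<open>exp w / w powr q\<close> is increasing for \<open>w \<ge> q\<close>;
  the proof uses only \<open>ln z \<le> z - 1\<close>.\<close>

lemma exp_le_powr_ratio:
  assumes q: "q > 0" and w: "q \<le> w" "w \<le> (W::real)"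
  shows "exp w \<le> exp W * (w / W) powr q"
proof -
  have p: "w > 0" "W > 0" using q w by auto
  have "q * ln (W / w) \<le> q * (W / w - 1)" using p q by (intro mult_left_mono ln_le_minus_one) auto
  also have "\<dots> = q / w * (W - w)" using p by (simp add: field_simps)
  also have "\<dots> \<le> 1 * (W - w)" using w q p by (intro mult_right_mono) auto
  finally have "w \<le> W + q * ln (w / W)" using p by (simp add: ln_div algebra_simps)
  then have "exp w \<le> exp (W + q * ln (w / W))" by simp
  also have "\<dots> = exp W * (w / W) powr q" using p by (simp add: exp_add powr_def)
  finally show ?thesis .
qed

context iid_std
begin

text \<open>The Fuk-Nagaev splitting at \<open>l * v = q\<close>: below it the exponential is
  quadratic with constant \<open>exp q\<close>, above it a power \<open>q\<close> of
  \<open>v\<close>. The left tail then enters only through the variance, as is necessary when only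
  the right tail is known to be regular.\<close>

lemma trunc_exp_moment_right_tail:
  assumes y: "y > 0" and q: "q > 2" and m: "integrable \<mu> (\<lambda>x. (max x 0) powr q)" and c: "c \<ge> 0" and l: "l \<ge> 0"
  defines "m \<equiv> LINT x|\<mu>. (max x 0) powr q"
  shows "integrable \<mu> (\<lambda>x. exp (l * trunc (1 / y) (c * x)))"
    "(LINT x|\<mu>. exp (l * trunc (1 / y) (c * x))) \<le> exp (exp q * l\<^sup>2 / 2 * c\<^sup>2 + exp (l * y) * y powr (- q) * m * c powr q)"
proof -
  have b: "trunc (1 / y) v \<le> y" for v using y by (auto simp: trunc_def)
  show I: "integrable \<mu> (\<lambda>x. exp (l * trunc (1 / y) (c * x)))"
  proof (rule mu.integrable_const_bound[where B="exp (l * y)"])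
    show "AE x in \<mu>. norm (exp (l * trunc (1 / y) (c * x))) \<le> exp (l * y)"
      using mult_left_mono[OF b l] by simp
  qed measurable
  have pw: "exp (l * trunc (1 / y) v) \<le> 1 + l * v + exp q * l\<^sup>2 / 2 * v\<^sup>2 + exp (l * y) * y powr (- q) * (max v 0) powr q" for v
  proof (cases "v \<le> y")
    case True
    then have tv: "trunc (1 / y) v = v" using y by (simp add: trunc_def)
    show ?thesis
    proof (cases "l * v \<le> q")
      case True
      then have "exp (l * v) \<le> 1 + l * v + exp q * (l * v)\<^sup>2 / 2" using q by (intro exp_le_quadratic) auto
      moreover have "0 \<le> exp (l * y) * y powr (- q) * (max v 0) powr q" by simp
      moreover have "exp q * (l * v)\<^sup>2 / 2 = exp q * l\<^sup>2 / 2 * v\<^sup>2" by (simp add: power_mult_distrib)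
      ultimately show ?thesis unfolding tv by linarith
    next
      case False
      then have lv: "l * v > 0" using q by linarith
      then have vp: "v > 0" "l > 0" using l by (auto simp: zero_less_mult_iff)
      have "exp (l * v) \<le> exp (l * y) * ((l * v) / (l * y)) powr q"
        using False q True l by (intro exp_le_powr_ratio mult_left_mono) auto
      also have "((l * v) / (l * y)) powr q = y powr (- q) * (max v 0) powr q"
        using vp y by (simp add: powr_divide powr_minus_divide)
      finally have "exp (l * v) \<le> exp (l * y) * y powr (- q) * (max v 0) powr q" by (simp add: mult.assoc)
      moreover have "0 \<le> exp q * l\<^sup>2 / 2 * v\<^sup>2" by simp
      ultimately show ?thesis unfolding tv using lv by linarith
    qed
  next
    case False
    then have "trunc (1 / y) v = 0" "v > 0" using y by (auto simp: trunc_def)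
    then show ?thesis using l by simp
  qed
  have cm: "(max (c * x) 0) powr q = c powr q * (max x 0) powr q" for x
    using c max_mult_distrib_left[of c x 0] by (simp add: powr_mult[symmetric])
  let ?k = "exp (l * y) * y powr (- q)"
  have "(LINT x|\<mu>. exp (l * trunc (1 / y) (c * x))) \<le>
    (LINT x|\<mu>. 1 + l * (c * x) + exp q * l\<^sup>2 / 2 * (c\<^sup>2 * x\<^sup>2) + ?k * (c powr q * (max x 0) powr q))"
  proof (intro integral_mono I)
    show "integrable \<mu> (\<lambda>x. 1 + l * (c * x) + exp q * l\<^sup>2 / 2 * (c\<^sup>2 * x\<^sup>2) + ?k * (c powr q * (max x 0) powr q))"
      using integrable_id sq_integrable assms(3) by auto
    show "exp (l * trunc (1 / y) (c * x)) \<le> 1 + l * (c * x) + exp q * l\<^sup>2 / 2 * (c\<^sup>2 * x\<^sup>2) + ?k * (c powr q * (max x 0) powr q)" for x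
      using pw[of "c * x"] unfolding cm power_mult_distrib .
  qed
  also have "\<dots> = 1 + (exp q * l\<^sup>2 / 2 * c\<^sup>2 + ?k * m * c powr q)"
    using integrable_id sq_integrable assms(3) by (simp add: mean var m_def mu.prob_space)
  also have "\<dots> \<le> exp (exp q * l\<^sup>2 / 2 * c\<^sup>2 + ?k * m * c powr q)" by (rule exp_ge_add_one_self)
  finally show "(LINT x|\<mu>. exp (l * trunc (1 / y) (c * x))) \<le> exp (exp q * l\<^sup>2 / 2 * c\<^sup>2 + ?k * m * c powr q)" .
qed

text \<open>The two terms correspond to the two choices \<open>l = exp (- q) * x\<close> and
  \<open>l = ln (y powr q / \<gamma> powr (q - 2)) / y\<close>, with \<open>y = x / 4\<close>, of the exponential parameter;
  the smaller one is used.\<close>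

lemma prob_T_right_tail:
  assumes x: "x \<ge> 4" and q: "q > 2" and m: "integrable \<mu> (\<lambda>x. (max x 0) powr q)"
    and F: "finite F" and c: "\<And>i. i \<in> F \<Longrightarrow> 0 \<le> c i" "\<And>i. i \<in> F \<Longrightarrow> c i \<le> \<gamma>"
    and g: "0 < \<gamma>" "\<gamma> \<le> 1" and s: "(\<Sum>i\<in>F. (c i)\<^sup>2) \<le> 1"
  defines "m \<equiv> LINT x|\<mu>. (max x 0) powr q"
  shows "\<P>(\<omega> in M. T (4 / x) c F \<omega> \<ge> x) \<le>
    exp m * (exp (- (exp (- q) * x\<^sup>2 / 2)) + (\<gamma> powr (q - 2) / (x / 4) powr q)\<^sup>2)"
proof -
  define y where "y = x / 4"
  define D where "D = \<gamma> powr (q - 2)"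
  define L where "L = ln (y powr q / D)"
  have y: "y \<ge> 1" and x0: "x > 0" using x by (auto simp: y_def)
  have D: "0 < D" "D \<le> 1" using g q by (auto simp: D_def intro!: powr_le1)
  have yq: "y powr q \<ge> 1" using y q by (intro ge_one_powr_ge_zero) auto
  have L0: "L \<ge> 0" using D yq by (auto simp: L_def intro!: ln_ge_zero simp: le_divide_eq)
  have m0: "m \<ge> 0" unfolding m_def by (intro Bochner_Integration.integral_nonneg) auto
  define l where "l = min (exp (- q) * x) (L / y)"
  have l: "l \<ge> 0" "l \<le> exp (- q) * x" "l \<le> L / y" using L0 x0 y by (auto simp: l_def)
  have "\<P>(\<omega> in M. T (1 / y) c F \<omega> \<ge> x) \<le>
      exp (- l * x + (\<Sum>i\<in>F. exp q * l\<^sup>2 / 2 * (c i)\<^sup>2 + exp (l * y) * y powr (- q) * m * c i powr q))"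
    unfolding m_def using y
    by (intro chernoff_T F l(1) trunc_exp_moment_right_tail[OF _ q assms(3) c(1) l(1)]) auto
  also have "(\<Sum>i\<in>F. exp q * l\<^sup>2 / 2 * (c i)\<^sup>2 + exp (l * y) * y powr (- q) * m * c i powr q) =
      exp q * l\<^sup>2 / 2 * (\<Sum>i\<in>F. (c i)\<^sup>2) + exp (l * y) * y powr (- q) * m * (\<Sum>i\<in>F. c i powr q)"
    by (simp add: sum.distrib sum_distrib_left)
  also have "\<dots> \<le> l * x / 2 + m"
  proof (rule add_mono)
    \<comment> \<open>The first bound on \<open>l\<close>: the variance term uses up at most half of
      \<open>l * x\<close>.\<close>
    have "exp q * l * l \<le> exp q * (exp (- q) * x) * l" using l by (intro mult_right_mono mult_left_mono) auto
    also have "\<dots> = l * x" by (simp add: exp_minus)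
    finally have a: "exp q * l\<^sup>2 / 2 \<le> l * x / 2" by (simp add: power2_eq_square mult.assoc)
    have "exp q * l\<^sup>2 / 2 * (\<Sum>i\<in>F. (c i)\<^sup>2) \<le> exp q * l\<^sup>2 / 2 * 1" by (intro mult_left_mono s) auto
    then show "exp q * l\<^sup>2 / 2 * (\<Sum>i\<in>F. (c i)\<^sup>2) \<le> l * x / 2" using a by linarith
    \<comment> \<open>The second bound on \<open>l\<close>: \<open>exp L = y powr q / D\<close>
      cancels both \<open>y powr (- q)\<close> and the sum of the weights.\<close>
    have "l * y \<le> L" using l(3) y by (simp add: le_divide_eq)
    then have "exp (l * y) \<le> exp L" by simp
    also have "\<dots> = y powr q / D" unfolding L_def using y D by (intro exp_ln divide_pos_pos) auto
    finally have "exp (l * y) * y powr (- q) * m * (\<Sum>i\<in>F. c i powr q) \<le> (y powr q / D) * y powr (- q) * m * D"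
      unfolding D_def using q m0 yq
      by (intro mult_mono mult_right_mono sum_powr_weights_le c s mult_nonneg_nonneg sum_nonneg) auto
    also have "\<dots> = m" using D y by (simp add: powr_minus)
    finally show "exp (l * y) * y powr (- q) * m * (\<Sum>i\<in>F. c i powr q) \<le> m" .
  qed
  finally have "\<P>(\<omega> in M. T (1 / y) c F \<omega> \<ge> x) \<le> exp (m + - (l * x / 2))" by simp
  also have "\<dots> = exp m * exp (- (l * x / 2))" by (rule exp_add)
  also have "exp (- (l * x / 2)) \<le> exp (- (exp (- q) * x\<^sup>2 / 2)) + (D / y powr q)\<^sup>2"
  proof (cases "exp (- q) * x \<le> L / y")
    case True
    then show ?thesis by (simp add: l_def power2_eq_square mult.assoc)
  next
    case False
    \<comment> \<open>Truncating at a quarter of \<open>x\<close> is what produces the square of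
      \<open>D / y powr q\<close>; the second power of \<open>D\<close> makes the term negligible
      against \<open>V\<close> later.\<close>
    then have "l * x / 2 = 2 * L" using x0 by (simp add: l_def y_def)
    then have "exp (- (l * x / 2)) = exp (- L) * exp (- L)" by (simp flip: exp_add)
    also have "exp (- L) = D / y powr q"
    proof -
      have "exp L = y powr q / D" unfolding L_def using y D by (intro exp_ln divide_pos_pos) auto
      then show ?thesis by (simp add: exp_minus)
    qed
    finally show ?thesis by (simp add: power2_eq_square)
  qed
  finally show ?thesis by (simp add: y_def D_def mult_left_mono)
qed

section \<open>The right tail: one large summand, dyadic bounds and moments\<close>

definition G :: "real \<Rightarrow> real" where "G y = measure \<mu> {y..}"

lemma G_antimono: "x \<le> y \<Longrightarrow> G y \<le> G x"
  unfolding G_def by (intro mu.finite_measure_mono) auto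

lemma G_nonneg: "G y \<ge> 0" by (simp add: G_def)

lemma G_le_1: "G y \<le> 1" by (simp add: G_def)

lemma prob_term:
  assumes "x > 0" "c i \<ge> 0"
  shows "\<P>(\<omega> in M. c i * X i \<omega> \<ge> x) = (if c i = 0 then 0 else G (x / c i))"
proof (cases "c i = 0")
  case False
  then have "\<P>(\<omega> in M. c i * X i \<omega> \<ge> x) = \<P>(\<omega> in M. X i \<omega> \<in> {x / c i..})"
    using assms by (intro arg_cong[where f=prob]) (auto simp: pos_divide_le_eq mult.commute)
  also have "\<dots> = G (x / c i)" unfolding G_def by (rule prob_law) simp
  finally show ?thesis using False by simp
qed (use assms in simp)

lemma prob_term_le:
  assumes "x > 0" "c i \<ge> 0"
  shows "\<P>(\<omega> in M. c i * X i \<omega> \<ge> x) \<le> (c i)\<^sup>2 / x\<^sup>2"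
proof -
  have "\<P>(\<omega> in M. c i * X i \<omega> \<ge> x) \<le> \<P>(\<omega> in M. \<bar>S c {i} \<omega>\<bar> \<ge> x)"
    by (intro finite_measure_mono) (auto simp: S_def)
  also have "\<dots> \<le> (c i)\<^sup>2 / x\<^sup>2" using S_chebyshev[of "{i}" x c] assms by simp
  finally show ?thesis .
qed

text \<open>The events that summand \<open>i\<close> is the only one to exceed \<open>b\<close> while the others add up to more
  than \<open>- d\<close> are disjoint.\<close>

lemma prob_S_ge_one_big_jump:
  assumes F: "finite F" and c: "\<And>i. i \<in> F \<Longrightarrow> 0 \<le> c i" and s: "(\<Sum>i\<in>F. (c i)\<^sup>2) \<le> 1"
    and b: "b > 0" and d: "d > 0"
  shows "\<P>(\<omega> in M. S c F \<omega> \<ge> b - d) \<ge> (\<Sum>i\<in>F. \<P>(\<omega> in M. c i * X i \<omega> \<ge> b)) * (1 - 1 / d\<^sup>2 - 1 / b\<^sup>2)"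
proof -
  define p where "p i = \<P>(\<omega> in M. c i * X i \<omega> \<ge> b)" for i
  define A where "A i = {\<omega> \<in> space M. c i * X i \<omega> \<in> {b..} \<and> S c (F - {i}) \<omega> \<in> {- d..}}" for i
  \<comment> \<open>The second summand is written as a sum over \<open>{i, j} - {i}\<close> so that
    \<open>prob_term_and_rest\<close> also yields the independence of two single terms.\<close>
  define B where "B i j = {\<omega> \<in> space M. c i * X i \<omega> \<in> {b..} \<and> S c ({i, j} - {i}) \<omega> \<in> {b..}}" for i j
  define E where "E i = A i - (\<Union>j\<in>F - {i}. B i j)" for i
  have [measurable]: "A i \<in> sets M" "B i j \<in> sets M" for i j unfolding A_def B_def by measurable
  have Em[measurable]: "E i \<in> sets M" for i
  proof -
    have "(\<Union>j\<in>F - {i}. B i j) \<in> sets M" using F by (intro sets.finite_UN) auto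
    then show "E i \<in> sets M" unfolding E_def by (intro sets.Diff) auto
  qed
  have Sj: "S c ({i, j} - {i}) \<omega> = c j * X j \<omega>" if "i \<noteq> j" for i j \<omega>
  proof -
    have "{i, j} - {i} = {j}" using that by auto
    then show ?thesis by (simp add: S_def)
  qed
  have sump: "(\<Sum>j\<in>F. p j) \<le> 1 / b\<^sup>2"
  proof -
    have "(\<Sum>j\<in>F. p j) \<le> (\<Sum>j\<in>F. (c j)\<^sup>2 / b\<^sup>2)" unfolding p_def by (intro sum_mono prob_term_le b c)
    also have "\<dots> \<le> 1 / b\<^sup>2" unfolding sum_divide_distrib[symmetric] by (intro divide_right_mono s) auto
    finally show ?thesis .
  qed
  have E: "prob (E i) \<ge> p i * (1 - 1 / d\<^sup>2 - 1 / b\<^sup>2)" if i: "i \<in> F" for i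
  proof -
    have "prob (A i) \<le> prob (E i \<union> (\<Union>j\<in>F - {i}. B i j))"
      using F by (intro finite_measure_mono sets.Un sets.finite_UN Em) (auto simp: E_def)
    also have "\<dots> \<le> prob (E i) + prob (\<Union>j\<in>F - {i}. B i j)" using F by (intro measure_Un_le sets.finite_UN) auto
    also have "prob (\<Union>j\<in>F - {i}. B i j) \<le> (\<Sum>j\<in>F - {i}. prob (B i j))"
      using F by (intro finite_measure_subadditive_finite) auto
    also have "\<dots> = (\<Sum>j\<in>F - {i}. p i * p j)"
    proof (intro sum.cong refl)
      fix j assume j: "j \<in> F - {i}"
      then have "prob (B i j) = \<P>(\<omega> in M. c i * X i \<omega> \<in> {b..}) * \<P>(\<omega> in M. S c ({i, j} - {i}) \<omega> \<in> {b..})"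
        unfolding B_def by (intro prob_term_and_rest) auto
      moreover have "i \<noteq> j" using j by auto
      ultimately show "prob (B i j) = p i * p j" unfolding p_def by (simp only: Sj[OF \<open>i \<noteq> j\<close>] atLeast_iff)
    qed
    also have "\<dots> \<le> p i * (\<Sum>j\<in>F. p j)"
      unfolding sum_distrib_left[symmetric] using F by (intro mult_left_mono sum_mono2) (auto simp: p_def)
    also have "\<dots> \<le> p i * (1 / b\<^sup>2)" by (intro mult_left_mono sump) (simp add: p_def)
    finally have 1: "prob (A i) \<le> prob (E i) + p i * (1 / b\<^sup>2)" by simp
    have "prob (A i) = p i * \<P>(\<omega> in M. S c (F - {i}) \<omega> \<in> {- d..})"
      unfolding A_def p_def using prob_term_and_rest[OF F i, of "{b..}" "{- d..}" c] by simp
    moreover have "\<P>(\<omega> in M. S c (F - {i}) \<omega> \<in> {- d..}) \<ge> 1 - 1 / d\<^sup>2"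
    proof -
      have F': "finite (F - {i})" using F by simp
      have "\<P>(\<omega> in M. \<bar>S c (F - {i}) \<omega>\<bar> \<ge> d) \<le> (\<Sum>j\<in>F - {i}. (c j)\<^sup>2) / d\<^sup>2" by (rule S_chebyshev[OF F' d])
      also have "\<dots> \<le> 1 / d\<^sup>2"
        using F by (intro divide_right_mono order_trans[OF sum_mono2 s]) auto
      finally have u: "\<P>(\<omega> in M. \<bar>S c (F - {i}) \<omega>\<bar> \<ge> d) \<le> 1 / d\<^sup>2" .
      have "1 = prob (space M)" by (simp add: prob_space)
      also have "\<dots> \<le> prob ({\<omega> \<in> space M. S c (F - {i}) \<omega> \<in> {- d..}} \<union> {\<omega> \<in> space M. \<bar>S c (F - {i}) \<omega>\<bar> \<ge> d})"
        by (intro finite_measure_mono) auto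
      also have "\<dots> \<le> \<P>(\<omega> in M. S c (F - {i}) \<omega> \<in> {- d..}) + \<P>(\<omega> in M. \<bar>S c (F - {i}) \<omega>\<bar> \<ge> d)"
        by (intro measure_Un_le) auto
      finally show ?thesis using u by linarith
    qed
    then have "p i * (1 - 1 / d\<^sup>2) \<le> p i * \<P>(\<omega> in M. S c (F - {i}) \<omega> \<in> {- d..})"
      by (intro mult_left_mono) (auto simp: p_def)
    ultimately show ?thesis using 1 by (simp add: right_diff_distrib)
  qed
  have "(\<Sum>i\<in>F. p i) * (1 - 1 / d\<^sup>2 - 1 / b\<^sup>2) \<le> (\<Sum>i\<in>F. prob (E i))"
    unfolding sum_distrib_right by (intro sum_mono E)
  also have "\<dots> = prob (\<Union>i\<in>F. E i)"
  proof (intro finite_measure_finite_Union[symmetric] F)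
    show "disjoint_family_on E F"
      unfolding disjoint_family_on_def
    proof (intro ballI impI)
      fix i j assume ij: "i \<in> F" "j \<in> F" "i \<noteq> j"
      then show "E i \<inter> E j = {}" using Sj[OF ij(3)] by (auto simp: E_def A_def B_def)
    qed
  qed auto
  also have "\<dots> \<le> \<P>(\<omega> in M. S c F \<omega> \<ge> b - d)"
  proof (intro finite_measure_mono subsetI)
    fix \<omega> assume "\<omega> \<in> (\<Union>i\<in>F. E i)"
    then obtain i where i: "i \<in> F" "\<omega> \<in> A i" by (auto simp: E_def)
    have "S c F \<omega> = c i * X i \<omega> + S c (F - {i}) \<omega>" unfolding S_def by (rule sum.remove[OF F i(1)])
    then show "\<omega> \<in> {\<omega> \<in> space M. b - d \<le> S c F \<omega>}" using i(2) by (auto simp: A_def)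
  qed measurable
  finally show ?thesis by (simp add: p_def)
qed

text \<open>Iterating the ratio limit along powers of 2 gives geometric bounds; since
  \<open>G\<close> is antitone, they control all arguments.\<close>

lemma G_dyadic:
  assumes t: "\<eta> > 0" and pos: "\<And>y. G y > 0"
    and reg: "((\<lambda>y. G (2 * y) / G y) \<longlongrightarrow> 2 powr (- t)) at_top"
  shows "\<exists>Y\<ge>1. \<forall>k. G (2 ^ k * Y) \<le> (2 powr (- (t - \<eta>))) ^ k \<and> (2 powr (- (t + \<eta>))) ^ k * G Y \<le> G (2 ^ k * Y)"
proof -
  have "2 powr (- t) < 2 powr (- (t - \<eta>))" "2 powr (- (t + \<eta>)) < 2 powr (- t)" using t by auto
  from order_tendstoD(2)[OF reg this(1)] order_tendstoD(1)[OF reg this(2)]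
  have "\<forall>\<^sub>F y in at_top. G (2 * y) / G y < 2 powr (- (t - \<eta>)) \<and> 2 powr (- (t + \<eta>)) < G (2 * y) / G y"
    by eventually_elim auto
  then obtain Z where Z: "\<And>y. y \<ge> Z \<Longrightarrow> G (2 * y) / G y < 2 powr (- (t - \<eta>)) \<and> 2 powr (- (t + \<eta>)) < G (2 * y) / G y"
    by (auto simp: eventually_at_top_linorder)
  define Y where "Y = max 1 Z"
  have st: "G (2 * y) \<le> 2 powr (- (t - \<eta>)) * G y" "2 powr (- (t + \<eta>)) * G y \<le> G (2 * y)" if "y \<ge> Y" for y
  proof -
    have "y \<ge> Z" using that by (simp add: Y_def)
    from Z[OF this] show "G (2 * y) \<le> 2 powr (- (t - \<eta>)) * G y" "2 powr (- (t + \<eta>)) * G y \<le> G (2 * y)"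
      using pos[of y] by (simp_all add: divide_less_eq less_divide_eq less_imp_le)
  qed
  have "G (2 ^ k * Y) \<le> (2 powr (- (t - \<eta>))) ^ k \<and> (2 powr (- (t + \<eta>))) ^ k * G Y \<le> G (2 ^ k * Y)" for k
  proof (induction k)
    case (Suc k)
    have "1 * Y \<le> 2 ^ k * Y" by (intro mult_right_mono) (auto simp: Y_def)
    then have kY: "2 ^ k * Y \<ge> Y" by simp
    have e: "2 ^ Suc k * Y = 2 * (2 ^ k * Y)" by simp
    have "G (2 ^ Suc k * Y) \<le> 2 powr (- (t - \<eta>)) * (2 powr (- (t - \<eta>))) ^ k"
      unfolding e using Suc.IH by (intro order_trans[OF st(1)[OF kY]] mult_left_mono) auto
    moreover have "2 powr (- (t + \<eta>)) * ((2 powr (- (t + \<eta>))) ^ k * G Y) \<le> G (2 ^ Suc k * Y)"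
      unfolding e using Suc.IH by (intro order_trans[OF _ st(2)[OF kY]] mult_left_mono) auto
    ultimately show ?case by (simp add: mult.assoc)
  qed (simp add: G_le_1)
  then show ?thesis by (intro exI[of _ Y]) (auto simp: Y_def)
qed

lemma dyadic_bracket:
  assumes "Y > (0::real)" "y \<ge> Y"
  obtains k :: nat where "2 ^ k * Y \<le> y" "y < 2 ^ Suc k * Y"
proof -
  obtain n where n: "y / Y < 2 ^ n" using real_arch_pow[of 2 "y / Y"] by auto
  define m where "m = (LEAST n. y / Y < 2 ^ n)"
  have m: "y / Y < 2 ^ m" unfolding m_def by (rule LeastI[of _ n]) (rule n)
  have "m \<noteq> 0" using m assms by (cases m) auto
  then obtain k where k: "m = Suc k" by (cases m) auto
  have "\<not> y / Y < 2 ^ k" using not_less_Least[of k "\<lambda>n. y / Y < 2 ^ n"] k by (simp add: m_def)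
  then have "2 ^ k * Y \<le> y" "y < 2 ^ Suc k * Y" using m k assms(1) by (auto simp: field_simps not_less)
  then show ?thesis by (rule that)
qed

lemma G_lower_bound:
  assumes e: "\<eta> > 0" and t: "t > 0" and pos: "\<And>y. G y > 0"
    and reg: "((\<lambda>y. G (2 * y) / G y) \<longlongrightarrow> 2 powr (- t)) at_top"
  shows "\<exists>c0>0. \<exists>Y\<ge>1. \<forall>y\<ge>Y. G y \<ge> c0 * y powr (- (t + \<eta>))"
proof -
  obtain Y where Y: "Y \<ge> 1" and low: "\<And>k. (2 powr (- (t + \<eta>))) ^ k * G Y \<le> G (2 ^ k * Y)"
    using G_dyadic[OF e pos reg] by blast
  \<comment> \<open>Makes \<open>c0 * y powr (- (t + \<eta>))\<close> equal to
    \<open>(2 * y / Y) powr (- (t + \<eta>)) * G Y\<close>, to be compared with the dyadic point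
    above \<open>y\<close>, for which \<open>2 ^ Suc k \<le> 2 * y / Y\<close>.\<close>
  define c0 where "c0 = (2 / Y) powr (- (t + \<eta>)) * G Y"
  have "G y \<ge> c0 * y powr (- (t + \<eta>))" if y: "y \<ge> Y" for y
  proof -
    obtain k where k: "2 ^ k * Y \<le> y" "y < 2 ^ Suc k * Y" using dyadic_bracket[of Y y] Y y by auto
    have y0: "y > 0" using y Y by simp
    have "c0 * y powr (- (t + \<eta>)) = (2 * y / Y) powr (- (t + \<eta>)) * G Y"
      using Y y0 by (simp add: c0_def powr_mult powr_divide)
    also have "\<dots> \<le> (2 ^ Suc k) powr (- (t + \<eta>)) * G Y"
      using k Y e t pos[of Y] by (intro mult_right_mono powr_mono2') (auto simp: field_simps)
    also have "(2 ^ Suc k) powr (- (t + \<eta>)) = (2 powr (- (t + \<eta>))) ^ Suc k"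
      by (simp only: powr_realpow[symmetric] powr_powr powr_gt_zero zero_less_numeral mult.commute)
    also have "\<dots> * G Y \<le> G (2 ^ Suc k * Y)" by (rule low)
    also have "\<dots> \<le> G y" using k by (intro G_antimono) simp
    finally show ?thesis .
  qed
  moreover have "c0 > 0" using Y pos[of Y] by (simp add: c0_def)
  ultimately show ?thesis using Y by blast
qed

text \<open>On the dyadic shell of index \<open>k\<close> the integrand is at most
  \<open>(2 ^ Suc k * Y) powr q\<close>, and the tail there is at most
  \<open>(2 powr (- (t - \<eta>))) ^ k\<close>. With \<open>\<eta> = (t - q) / 2\<close> the
  products form a convergent geometric series.\<close>

lemma right_tail_moment:
  assumes q: "0 < q" "q < t" and pos: "\<And>y. G y > 0"
    and reg: "((\<lambda>y. G (2 * y) / G y) \<longlongrightarrow> 2 powr (- t)) at_top"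
  shows "integrable \<mu> (\<lambda>x. (max x 0) powr q)"
proof -
  define \<eta> where "\<eta> = (t - q) / 2"
  have e: "\<eta> > 0" "q - (t - \<eta>) < 0" using q by (auto simp: \<eta>_def field_simps)
  obtain Y where Y: "Y \<ge> 1" and up: "\<And>k. G (2 ^ k * Y) \<le> (2 powr (- (t - \<eta>))) ^ k"
    using G_dyadic[OF e(1) pos reg] by blast
  define b where "b k x = ennreal ((2 ^ Suc k * Y) powr q) * indicator {2 ^ k * Y..} x" for k x
  have bnd: "ennreal ((max x 0) powr q) \<le> ennreal (Y powr q) + (\<Sum>k. b k x)" for x
  proof (cases "x \<ge> Y")
    case True
    obtain k where k: "2 ^ k * Y \<le> x" "x < 2 ^ Suc k * Y" using dyadic_bracket[of Y x] Y True by auto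
    have "ennreal ((max x 0) powr q) \<le> ennreal ((2 ^ Suc k * Y) powr q)"
      using k True Y q by (intro ennreal_leI powr_mono2) auto
    also have "\<dots> = b k x" using k by (simp add: b_def)
    also have "\<dots> = (\<Sum>n\<in>{k}. b n x)" by simp
    also have "\<dots> \<le> (\<Sum>k. b k x)" by (rule sum_le_suminf) auto
    finally show ?thesis by (simp add: add_increasing)
  next
    case False
    then have "ennreal ((max x 0) powr q) \<le> ennreal (Y powr q)" using Y q by (intro ennreal_leI powr_mono2) auto
    then show ?thesis by (simp add: add_increasing2)
  qed
  define r where "r = 2 powr (q - (t - \<eta>))"
  have r: "0 < r" "r < 1" using powr_less_mono[OF e(2), of 2] by (auto simp: r_def)
  have bterm: "(\<integral>\<^sup>+x. b k x \<partial>\<mu>) \<le> ennreal ((2 * Y) powr q * r ^ k)" for k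
  proof -
    have "(\<integral>\<^sup>+x. b k x \<partial>\<mu>) = ennreal ((2 ^ Suc k * Y) powr q) * emeasure \<mu> {2 ^ k * Y..}"
      unfolding b_def by (subst nn_integral_cmult_indicator) auto
    also have "emeasure \<mu> {2 ^ k * Y..} = ennreal (G (2 ^ k * Y))" by (simp add: G_def mu.emeasure_eq_measure)
    also have "ennreal ((2 ^ Suc k * Y) powr q) * ennreal (G (2 ^ k * Y)) = ennreal ((2 ^ Suc k * Y) powr q * G (2 ^ k * Y))"
      using G_nonneg by (simp add: ennreal_mult)
    also have "\<dots> \<le> ennreal ((2 ^ Suc k * Y) powr q * (2 powr (- (t - \<eta>))) ^ k)"
      using up by (intro ennreal_leI mult_left_mono) auto
    also have "(2 ^ Suc k * Y) powr q * (2 powr (- (t - \<eta>))) ^ k = (2 * Y) powr q * r ^ k"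
    proof -
      have "(2 ^ Suc k * Y) powr q = ((2 * Y) * 2 ^ k) powr q" by (simp add: mult_ac)
      also have "\<dots> = (2 * Y) powr q * (2 ^ k) powr q" using Y by (intro powr_mult)
      also have "(2 ^ k) powr q = (2 powr q) ^ k"
        by (simp only: powr_realpow[symmetric] powr_powr powr_gt_zero zero_less_numeral mult.commute)
      finally have "(2 ^ Suc k * Y) powr q = (2 * Y) powr q * (2 powr q) ^ k" .
      moreover have "r ^ k = (2 powr q) ^ k * (2 powr (- (t - \<eta>))) ^ k"
        unfolding power_mult_distrib[symmetric] powr_add[symmetric] r_def by (simp only: diff_conv_add_uminus)
      ultimately show ?thesis by (simp only: mult_ac)
    qed
    finally show ?thesis .
  qed
  have bm[measurable]: "b k \<in> borel_measurable borel" for k unfolding b_def by measurable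
  have "(\<integral>\<^sup>+x. ennreal ((max x 0) powr q) \<partial>\<mu>) \<le> (\<integral>\<^sup>+x. ennreal (Y powr q) + (\<Sum>k. b k x) \<partial>\<mu>)"
    by (intro nn_integral_mono bnd)
  also have "\<dots> = ennreal (Y powr q) + (\<Sum>k. \<integral>\<^sup>+x. b k x \<partial>\<mu>)"
    by (subst nn_integral_add) (auto simp: nn_integral_suminf mu.emeasure_space_1)
  also have "\<dots> \<le> ennreal (Y powr q) + (\<Sum>k. ennreal ((2 * Y) powr q * r ^ k))"
    by (intro add_mono suminf_le bterm) auto
  also have "\<dots> < \<infinity>"
  proof -
    have "summable (\<lambda>k. (2 * Y) powr q * r ^ k)" using r by (intro summable_mult summable_geometric) auto
    then have "(\<Sum>k. ennreal ((2 * Y) powr q * r ^ k)) = ennreal (\<Sum>k. (2 * Y) powr q * r ^ k)"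
      using r by (intro suminf_ennreal2) auto
    then show ?thesis by simp
  qed
  finally show ?thesis by (intro integrableI_nonneg) auto
qed

end

text \<open>Fixes how far a level may move. The bound \<open>1 / 10\<close> ensures
  \<open>(1 - \<rho>)^2 \<ge> 3 / 4\<close>, so a level admissible with the constant 4 remains
  admissible with 3 after the move.\<close>

lemma powr_scale_near_one:
  assumes "e > (0::real)"
  shows "\<exists>\<rho>\<in>{0<..<1/10}. (1 - \<rho>) powr (- t) \<le> 1 + e \<and> (1 + \<rho>) powr (- t) \<ge> 1 - e"
proof -
  have "((\<lambda>r. (1 - r) powr (- t)) \<longlongrightarrow> (1 - 0) powr (- t)) (at_right (0::real))"
    "((\<lambda>r. (1 + r) powr (- t)) \<longlongrightarrow> (1 + 0) powr (- t)) (at_right (0::real))"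
    by (intro tendsto_intros; simp)+
  then have "\<forall>\<^sub>F r in at_right (0::real). (1 - r) powr (- t) < 1 + e" "\<forall>\<^sub>F r in at_right (0::real). (1 + r) powr (- t) > 1 - e"
    using assms by (auto intro: order_tendstoD)
  moreover have "\<forall>\<^sub>F r in at_right (0::real). r < 1/10" "\<forall>\<^sub>F r in at_right (0::real). 0 < r"
    by (auto simp: eventually_at_right_less intro!: eventually_at_rightI[of 0 "1/10"])
  ultimately have "\<forall>\<^sub>F r in at_right (0::real). r \<in> {0<..<1/10} \<and> (1 - r) powr (- t) \<le> 1 + e \<and> (1 + r) powr (- t) \<ge> 1 - e"
    by eventually_elim auto
  then show ?thesis using eventually_happens'[OF trivial_limit_at_right_real] by blast
qed

text \<open>Holds for every finite section of the normalised weights that contains \<open>n\<close>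
  central indices. Squares sum to at most 1 only, as a section loses variance; the set
  \<open>J\<close> is there to bound \<open>V\<close> from below.\<close>

definition spread_weights :: "real \<Rightarrow> nat \<Rightarrow> ('i \<Rightarrow> real) \<Rightarrow> 'i set \<Rightarrow> bool" where
  "spread_weights K n c F \<longleftrightarrow> finite F \<and> (\<forall>i\<in>F. 0 \<le> c i \<and> sqrt (real n) * c i \<le> K) \<and> (\<Sum>i\<in>F. (c i)\<^sup>2) \<le> 1 \<and>
    (\<exists>J\<subseteq>F. n \<le> card J \<and> (\<forall>i\<in>J. 1 \<le> K * (sqrt (real n) * c i)))"

context iid_std
begin

definition V :: "('i \<Rightarrow> real) \<Rightarrow> 'i set \<Rightarrow> real \<Rightarrow> real" where
  "V c F x = (\<Sum>i\<in>F. \<P>(\<omega> in M. c i * X i \<omega> \<ge> x))"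

lemma V_nonneg: "V c F x \<ge> 0"
  unfolding V_def by (intro sum_nonneg) auto

text \<open>Uniform in the weights: \<open>Y * c i \<le> x\<close> puts every \<open>x / c i\<close>
  in the range where the ratio of tails is close to its limit, so the bound holds term by term, and
  trivially for zero weights.\<close>

lemma V_scale:
  assumes pos: "\<And>y. G y > 0" and reg: "((\<lambda>y. G (f * y) / G y) \<longlongrightarrow> f powr (- t)) at_top" and f: "f > 0" and e: "\<eta> > 0"
  obtains Y where "Y > 0"
    "\<forall>x>0. \<forall>c F. (\<forall>i\<in>F. 0 \<le> c i \<and> Y * c i \<le> x) \<longrightarrow>
      V c F (f * x) \<le> (f powr (- t) + \<eta>) * V c F x \<and> (f powr (- t) - \<eta>) * V c F x \<le> V c F (f * x)"
proof -
  have "\<forall>\<^sub>F y in at_top. dist (G (f * y) / G y) (f powr (- t)) < \<eta>" using reg e by (rule tendstoD)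
  then obtain Z where Z: "\<And>y. y \<ge> Z \<Longrightarrow> dist (G (f * y) / G y) (f powr (- t)) < \<eta>"
    by (auto simp: eventually_at_top_linorder)
  define Y where "Y = max 1 Z"
  have GY: "G (f * y) \<le> (f powr (- t) + \<eta>) * G y" "(f powr (- t) - \<eta>) * G y \<le> G (f * y)" if "y \<ge> Y" for y
  proof -
    have "y \<ge> Z" using that by (simp add: Y_def)
    then have "\<bar>G (f * y) / G y - f powr (- t)\<bar> < \<eta>" using Z[of y] by (simp add: dist_real_def)
    then have "G (f * y) / G y \<le> f powr (- t) + \<eta>" "f powr (- t) - \<eta> \<le> G (f * y) / G y" by linarith+
    then show "G (f * y) \<le> (f powr (- t) + \<eta>) * G y" "(f powr (- t) - \<eta>) * G y \<le> G (f * y)"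
      using pos[of y] by (auto simp: pos_divide_le_eq pos_le_divide_eq)
  qed
  have "V c F (f * x) \<le> (f powr (- t) + \<eta>) * V c F x \<and> (f powr (- t) - \<eta>) * V c F x \<le> V c F (f * x)"
    if x: "x > 0" and c: "\<And>i. i \<in> F \<Longrightarrow> 0 \<le> c i \<and> Y * c i \<le> x" for x c F
  proof -
    have "\<P>(\<omega> in M. c i * X i \<omega> \<ge> f * x) \<le> (f powr (- t) + \<eta>) * \<P>(\<omega> in M. c i * X i \<omega> \<ge> x) \<and>
        (f powr (- t) - \<eta>) * \<P>(\<omega> in M. c i * X i \<omega> \<ge> x) \<le> \<P>(\<omega> in M. c i * X i \<omega> \<ge> f * x)" if i: "i \<in> F" for i
    proof (cases "c i = 0")
      case False
      then have ci: "c i > 0" using c[OF i] by simp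
      have "x / c i \<ge> Y" using c[OF i] ci by (simp add: pos_le_divide_eq)
      from GY[OF this] show ?thesis
        using ci x f by (simp add: prob_term)
    qed (use x f in \<open>auto simp: prob_term mult_le_0_iff\<close>)
    then show ?thesis unfolding V_def sum_distrib_left by (auto intro!: sum_mono)
  qed
  then have "\<forall>x>0. \<forall>c F. (\<forall>i\<in>F. 0 \<le> c i \<and> Y * c i \<le> x) \<longrightarrow>
      V c F (f * x) \<le> (f powr (- t) + \<eta>) * V c F x \<and> (f powr (- t) - \<eta>) * V c F x \<le> V c F (f * x)"
    by (intro allI impI) auto
  moreover have "Y > 0" by (simp add: Y_def)
  ultimately show ?thesis by (rule that[rotated])
qed

text \<open>As \<open>n\<close> weights are at least \<open>1 / (K * sqrt n)\<close>,
  \<open>V\<close> is at least a multiple of \<open>x powr (- u) * n powr (1 - u / 2)\<close> with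
  \<open>u\<close> slightly above \<open>t\<close>. Both terms of \<open>prob_T_right_tail\<close>
  are compared with this quantity.\<close>

lemma right_tail_negligible:
  fixes t K e :: real
  assumes t: "t > 2" and pos: "\<And>y. G y > 0"
    and reg: "((\<lambda>y. G (2 * y) / G y) \<longlongrightarrow> 2 powr (- t)) at_top" and K: "K \<ge> 1" and e: "e > 0"
  shows "\<exists>n0\<ge>1. \<forall>n\<ge>n0. \<forall>x>0. \<forall>c F. 3 * exp t * (t - 2) * ln (real n) \<le> x\<^sup>2 \<longrightarrow> spread_weights K n c F \<longrightarrow>
      \<P>(\<omega> in M. T (4 / x) c F \<omega> \<ge> x) \<le> e * V c F x"
proof -
  \<comment> \<open>Then \<open>u / 2 - 1 = 7/12 * (t - 2)\<close> is below
    \<open>3/4 * (t - 2)\<close>, the exponent obtained from half of the Gaussian factor, and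
    \<open>q - 2 = 10/12 * (t - 2)\<close> exceeds \<open>u / 2 - 1\<close> by
    \<open>w = 3/12 * (t - 2)\<close>.\<close>
  define d where "d = (t - 2) / 6"
  define q where "q = t - d"
  define u where "u = t + d"
  have d: "d > 0" using t by (simp add: d_def)
  have q: "q > 2" "q < t" "u \<le> 2 * q" "u > 0" using t by (auto simp: q_def u_def d_def field_simps)
  have mi: "integrable \<mu> (\<lambda>x. (max x 0) powr q)"
    using q by (intro right_tail_moment[OF _ _ pos reg]) auto
  define m where "m = (LINT x|\<mu>. (max x 0) powr q)"
  obtain c0 Y0 where c0: "c0 > 0" "Y0 \<ge> 1" and low: "\<And>y. y \<ge> Y0 \<Longrightarrow> G y \<ge> c0 * y powr (- u)"
    using G_lower_bound[OF d _ pos reg] t unfolding u_def by auto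
  define \<kappa> where "\<kappa> = e / 2 * c0 * K powr (- u) * exp (- m)"
  have kap: "\<kappa> > 0" using e c0 K by (simp add: \<kappa>_def)
  \<comment> \<open>Half of the available exponent \<open>exp (- t) / 2\<close>: one half beats
    \<open>x powr u\<close>, the other supplies the power of \<open>n\<close> through the lower
    bound on \<open>x^2\<close>.\<close>
  define a where "a = exp (- t) / 4"
  have a: "a > 0" by (simp add: a_def)
  have "((\<lambda>x::real. exp (- a * x\<^sup>2) * x powr u) \<longlongrightarrow> 0) at_top" using a by real_asymp
  then have "\<forall>\<^sub>F x in at_top. exp (- a * x\<^sup>2) * x powr u < \<kappa>" using kap by (rule order_tendstoD)
  then obtain X1 where X1: "\<And>x. x \<ge> X1 \<Longrightarrow> exp (- a * x\<^sup>2) * x powr u < \<kappa>"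
    by (auto simp: eventually_at_top_linorder)
  define k where "k = 3 * exp t * (t - 2)"
  have k: "k > 0" using t by (simp add: k_def)
  define Cn where "Cn = K powr (2 * (q - 2)) * 4 powr (2 * q)"
  define w where "w = (t - 2) / 4"
  have w: "w > 0" using t by (simp add: w_def)
  have "\<forall>\<^sub>F n in sequentially. sqrt (k * ln (real n)) > max 4 (max X1 Y0)"
  proof -
    have "filterlim (\<lambda>n::nat. sqrt (k * ln (real n))) at_top sequentially" using k by real_asymp
    then show ?thesis by (simp only: filterlim_at_top_dense)
  qed
  moreover have "\<forall>\<^sub>F n in sequentially. sqrt (real n) > K"
  proof -
    have "filterlim (\<lambda>n::nat. sqrt (real n)) at_top sequentially" by real_asymp
    then show ?thesis by (simp only: filterlim_at_top_dense)
  qed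
  moreover have "\<forall>\<^sub>F n in sequentially. Cn * real n powr (- w) < \<kappa>"
  proof -
    have "((\<lambda>n::nat. Cn * real n powr (- w)) \<longlongrightarrow> 0) sequentially" using w by real_asymp
    then show ?thesis using kap by (rule order_tendstoD)
  qed
  ultimately have "\<forall>\<^sub>F n in sequentially. sqrt (k * ln (real n)) > max 4 (max X1 Y0) \<and> sqrt (real n) > K \<and> Cn * real n powr (- w) < \<kappa>"
    by (intro eventually_conj)
  then obtain n1 where n1: "\<And>n. n \<ge> n1 \<Longrightarrow> sqrt (k * ln (real n)) > max 4 (max X1 Y0) \<and> sqrt (real n) > K \<and> Cn * real n powr (- w) < \<kappa>"
    by (auto simp: eventually_sequentially)
  have main: "\<P>(\<omega> in M. T (4 / x) c F \<omega> \<ge> x) \<le> e * V c F x"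
    if n: "n \<ge> max 1 n1" and x0: "x > 0" and xk: "3 * exp t * (t - 2) * ln (real n) \<le> x\<^sup>2"
    and sw: "spread_weights K n c F" for n x c F
  proof -
    have F: "finite F" and c: "\<forall>i\<in>F. 0 \<le> c i \<and> sqrt (real n) * c i \<le> K" and s: "(\<Sum>i\<in>F. (c i)\<^sup>2) \<le> 1"
      using sw by (auto simp: spread_weights_def)
    obtain J where J: "J \<subseteq> F" "n \<le> card J" "\<forall>i\<in>J. 1 \<le> K * (sqrt (real n) * c i)"
      using sw by (auto simp: spread_weights_def)
    have nn: "real n \<ge> 1" "n \<ge> n1" using n by auto
    note N = n1[OF nn(2)]
    have "sqrt (k * ln (real n)) \<le> x" using xk x0 by (intro real_le_lsqrt) (auto simp: k_def)
    then have x: "x \<ge> 4" "x \<ge> X1" "x \<ge> Y0" using N by auto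
    define \<gamma> where "\<gamma> = K / sqrt (real n)"
    have g: "0 < \<gamma>" "\<gamma> \<le> 1" using N K nn by (auto simp: \<gamma>_def)
    have c': "\<And>i. i \<in> F \<Longrightarrow> 0 \<le> c i" "\<And>i. i \<in> F \<Longrightarrow> c i \<le> \<gamma>"
      using c nn by (auto simp: \<gamma>_def pos_le_divide_eq mult.commute)
    define W where "W = real n * (c0 * (x * (K * sqrt (real n))) powr (- u))"
    have VW: "W \<le> V c F x"
    proof -
      have bterm: "c0 * (x * (K * sqrt (real n))) powr (- u) \<le> \<P>(\<omega> in M. c i * X i \<omega> \<ge> x)" if i: "i \<in> J" for i
      proof -
        have iF: "i \<in> F" using i J by auto
        have "c i \<noteq> 0" using J(3) i by fastforce
        then have ci: "c i > 0" using c'(1)[OF iF] by simp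
        have "1 * (1 * 1) \<le> K * sqrt (real n)" using K nn by (intro mult_mono) auto
        then have "x * 1 \<le> x * (K * sqrt (real n))" using x0 by (intro mult_left_mono) auto
        then have y: "x * (K * sqrt (real n)) \<ge> Y0" using x(3) by linarith
        have "1 * x \<le> (K * (sqrt (real n) * c i)) * x" using J(3) i x0 by (intro mult_right_mono) auto
        then have "x / c i \<le> x * (K * sqrt (real n))" using ci by (simp add: pos_divide_le_eq mult_ac)
        from order_trans[OF low[OF y] G_antimono[OF this]] show ?thesis using ci x0 by (simp add: prob_term)
      qed
      have "W \<le> real (card J) * (c0 * (x * (K * sqrt (real n))) powr (- u))"
        unfolding W_def using J c0 by (intro mult_right_mono) auto
      also have "\<dots> = (\<Sum>i\<in>J. c0 * (x * (K * sqrt (real n))) powr (- u))" by simp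
      also have "\<dots> \<le> (\<Sum>i\<in>J. \<P>(\<omega> in M. c i * X i \<omega> \<ge> x))" by (intro sum_mono bterm)
      also have "\<dots> \<le> V c F x" unfolding V_def using J F by (intro sum_mono2) auto
      finally show ?thesis .
    qed
    define nu where "nu = real n powr (1 - u / 2)"
    have W: "W = c0 * K powr (- u) * (x powr (- u) * nu)"
    proof -
      have "(x * (K * sqrt (real n))) powr (- u) = x powr (- u) * (K powr (- u) * sqrt (real n) powr (- u))"
        using x0 K by (simp add: powr_mult)
      also have "sqrt (real n) powr (- u) = real n powr (- u / 2)" using nn by (simp add: powr_half_sqrt[symmetric] powr_powr)
      finally have "W = c0 * K powr (- u) * (x powr (- u) * (real n * real n powr (- u / 2)))" by (simp add: W_def)
      also have "real n * real n powr (- u / 2) = nu" using nn by (simp add: nu_def powr_diff powr_minus_divide)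
      finally show ?thesis .
    qed
    have A1: "exp (- (exp (- q) * x\<^sup>2 / 2)) \<le> \<kappa> * (x powr (- u) * nu)"
    proof -
      have "exp (- t) * x\<^sup>2 \<le> exp (- q) * x\<^sup>2" using q by (intro mult_right_mono) auto
      then have "exp (- (exp (- q) * x\<^sup>2 / 2)) \<le> exp ((- a * x\<^sup>2) + (- a * x\<^sup>2))" by (simp add: a_def)
      also have "\<dots> = exp (- a * x\<^sup>2) * exp (- a * x\<^sup>2)" by (rule exp_add)
      also have "\<dots> \<le> (\<kappa> * x powr (- u)) * nu"
      proof (rule mult_mono)
        have "exp (- a * x\<^sup>2) \<le> \<kappa> / x powr u" using X1[OF x(2)] x0 by (simp add: pos_le_divide_eq)
        then show "exp (- a * x\<^sup>2) \<le> \<kappa> * x powr (- u)" by (simp add: powr_minus_divide)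
        have "exp (- t) * (3 * exp t * (t - 2) * ln (real n)) \<le> exp (- t) * x\<^sup>2" using xk by (intro mult_left_mono) auto
        also have "exp (- t) * (3 * exp t * (t - 2) * ln (real n)) = (exp (- t) * exp t) * (3 * (t - 2) * ln (real n))"
          by (simp only: mult_ac)
        also have "exp (- t) * exp t = 1" by (simp flip: exp_add)
        finally have "3 * (t - 2) * ln (real n) \<le> exp (- t) * x\<^sup>2" by simp
        moreover have "(u / 2 - 1) * ln (real n) \<le> (3 / 4 * (t - 2)) * ln (real n)"
          using nn t by (intro mult_right_mono) (auto simp: u_def d_def field_simps)
        ultimately have "- a * x\<^sup>2 \<le> (1 - u / 2) * ln (real n)" unfolding a_def by (simp add: algebra_simps)
        then show "exp (- a * x\<^sup>2) \<le> nu" using nn by (simp add: nu_def powr_def)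
      qed (use kap in auto)
      finally show ?thesis by (simp add: mult.assoc)
    qed
    have A2: "(\<gamma> powr (q - 2) / (x / 4) powr q)\<^sup>2 \<le> \<kappa> * (x powr (- u) * nu)"
    proof -
      have "(\<gamma> powr (q - 2))\<^sup>2 = \<gamma> powr (2 * (q - 2))" by (simp add: power2_eq_square powr_add[symmetric])
      also have "\<dots> = K powr (2 * (q - 2)) / sqrt (real n) powr (2 * (q - 2))" using K by (simp add: \<gamma>_def powr_divide)
      also have "sqrt (real n) powr (2 * (q - 2)) = real n powr (q - 2)"
      proof -
        have "sqrt (real n) powr (2 * z) = real n powr z" for z
          using nn by (simp add: powr_half_sqrt[symmetric] powr_powr)
        then show ?thesis .
      qed
      also have "K powr (2 * (q - 2)) / real n powr (q - 2) = K powr (2 * (q - 2)) * (real n powr (- w) * nu)"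
      proof -
        have "- w + (1 - u / 2) = - (q - 2)" by (simp add: w_def u_def q_def d_def field_simps)
        then have "real n powr (- w) * nu = real n powr (- (q - 2))"
          unfolding nu_def powr_add[symmetric] by (rule arg_cong[where f="(powr) (real n)"])
        then show ?thesis by (simp only: powr_minus_divide times_divide_eq_right mult_1_right)
      qed
      finally have 1: "(\<gamma> powr (q - 2))\<^sup>2 = K powr (2 * (q - 2)) * (real n powr (- w) * nu)" .
      have "((x / 4) powr q)\<^sup>2 = (x / 4) powr (2 * q)" by (simp add: power2_eq_square powr_add[symmetric])
      also have "\<dots> = x powr (2 * q) / 4 powr (2 * q)" using x0 by (simp add: powr_divide)
      finally have "1 / ((x / 4) powr q)\<^sup>2 = 4 powr (2 * q) * x powr (- (2 * q))" by (simp add: powr_minus_divide)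
      also have "\<dots> \<le> 4 powr (2 * q) * x powr (- u)" using q x by (intro mult_left_mono powr_mono) auto
      finally have 2: "1 / ((x / 4) powr q)\<^sup>2 \<le> 4 powr (2 * q) * x powr (- u)" .
      have "(\<gamma> powr (q - 2) / (x / 4) powr q)\<^sup>2 = (\<gamma> powr (q - 2))\<^sup>2 * (1 / ((x / 4) powr q)\<^sup>2)" by (simp add: power_divide)
      also have "\<dots> \<le> K powr (2 * (q - 2)) * (real n powr (- w) * nu) * (4 powr (2 * q) * x powr (- u))"
        unfolding 1 using 2 K by (intro mult_left_mono) (auto simp: nu_def)
      also have "\<dots> = (Cn * real n powr (- w)) * (x powr (- u) * nu)" by (simp add: Cn_def)
      also have "\<dots> \<le> \<kappa> * (x powr (- u) * nu)" using N by (intro mult_right_mono) (auto simp: nu_def)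
      finally show ?thesis .
    qed
    have "\<P>(\<omega> in M. T (4 / x) c F \<omega> \<ge> x) \<le> exp m * (exp (- (exp (- q) * x\<^sup>2 / 2)) + (\<gamma> powr (q - 2) / (x / 4) powr q)\<^sup>2)"
      unfolding m_def by (rule prob_T_right_tail[OF x(1) q(1) mi F c' g s])
    also have "\<dots> \<le> exp m * (2 * (\<kappa> * (x powr (- u) * nu)))" using A1 A2 by (intro mult_left_mono) auto
    also have "\<dots> = e * W" unfolding W \<kappa>_def by (simp add: exp_minus)
    also have "\<dots> \<le> e * V c F x" using VW e by (intro mult_left_mono) auto
    finally show ?thesis .
  qed
  have "1 \<le> max 1 n1" by simp
  then show ?thesis
    by (intro exI[of _ "max 1 n1"] conjI allI impI main) assumption+
qed

text \<open>From above: a summand over \<open>(1 - \<rho>) * x\<close> contributes nearly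
  \<open>V\<close>; a summand between \<open>x / 4\<close> and that level needs the others to exceed
  \<open>\<rho> * x\<close>, a factor of order \<open>1 / x^2\<close> by Chebyshev; without a
  summand over \<open>x / 4\<close> the truncated sum is negligible. From below: a summand over
  \<open>(1 + \<rho>) * x\<close> survives a fluctuation \<open>\<rho> * x\<close> of the
  rest.\<close>

theorem large_deviations_finite:
  fixes t K e :: real
  assumes t: "t > 2" and pos: "\<And>y. G y > 0"
    and reg: "\<And>f. f > 0 \<Longrightarrow> ((\<lambda>y. G (f * y) / G y) \<longlongrightarrow> f powr (- t)) at_top" and K: "K \<ge> 1" and e: "0 < e" "e < 1"
  shows "\<exists>n0\<ge>1. \<forall>n\<ge>n0. \<forall>x>0. \<forall>c F. 3 * exp t * (t - 2) * ln (real n) \<le> x\<^sup>2 \<longrightarrow> spread_weights K n c F \<longrightarrow>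
      \<bar>\<P>(\<omega> in M. S c F \<omega> \<ge> x) - V c F x\<bar> \<le> e * V c F x"
proof -
  obtain \<rho> where rho: "\<rho> > 0" "\<rho> < 1 / 10" and r1: "(1 - \<rho>) powr (- t) \<le> 1 + e / 4" and r2: "(1 + \<rho>) powr (- t) \<ge> 1 - e / 4"
    using powr_scale_near_one[of "e / 4" t] e by auto
  have fp: "1 - \<rho> > 0" "1 + \<rho> > 0" "e / 4 > 0" using rho e by auto
  obtain Y1 where Y1: "Y1 > 0" and v1: "\<forall>x>0. \<forall>c F. (\<forall>i\<in>F. 0 \<le> c i \<and> Y1 * c i \<le> x) \<longrightarrow>
      V c F ((1 - \<rho>) * x) \<le> ((1 - \<rho>) powr (- t) + e / 4) * V c F x \<and>
      ((1 - \<rho>) powr (- t) - e / 4) * V c F x \<le> V c F ((1 - \<rho>) * x)"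
    by (rule V_scale[OF pos reg[OF fp(1)] fp(1) fp(3)]) (rule that)
  obtain Y2 where Y2: "Y2 > 0" and v2: "\<forall>x>0. \<forall>c F. (\<forall>i\<in>F. 0 \<le> c i \<and> Y2 * c i \<le> x) \<longrightarrow>
      V c F ((1 + \<rho>) * x) \<le> ((1 + \<rho>) powr (- t) + e / 4) * V c F x \<and>
      ((1 + \<rho>) powr (- t) - e / 4) * V c F x \<le> V c F ((1 + \<rho>) * x)"
    by (rule V_scale[OF pos reg[OF fp(2)] fp(2) fp(3)]) (rule that)
  have f3: "(1 / 4 :: real) > 0" by simp
  obtain Y3 where Y3: "Y3 > 0" and v3: "\<forall>x>0. \<forall>c F. (\<forall>i\<in>F. 0 \<le> c i \<and> Y3 * c i \<le> x) \<longrightarrow>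
      V c F (1 / 4 * x) \<le> ((1 / 4) powr (- t) + 1) * V c F x \<and>
      ((1 / 4) powr (- t) - 1) * V c F x \<le> V c F (1 / 4 * x)"
    by (rule V_scale[OF pos reg[OF f3] f3 zero_less_one]) (rule that)
  define C4 where "C4 = (1 / 4) powr (- t) + (1 :: real)"
  have C4: "C4 \<ge> 1" by (simp add: C4_def)
  obtain n1 where n1: "n1 \<ge> 1" and neg: "\<forall>n\<ge>n1. \<forall>x>0. \<forall>c F. 3 * exp t * (t - 2) * ln (real n) \<le> x\<^sup>2 \<longrightarrow>
     spread_weights K n c F \<longrightarrow> \<P>(\<omega> in M. T (4 / x) c F \<omega> \<ge> x) \<le> e / 4 * V c F x"
    using right_tail_negligible[OF t pos reg[of 2, simplified] K fp(3)] by (elim exE conjE)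
  define k where "k = 3 * exp t * (t - 2)"
  have k: "k > 0" using t by (simp add: k_def)
  define Y where "Y = max Y1 (max Y2 Y3)"
  \<comment> \<open>The size of \<open>x^2\<close> that makes \<open>C4 / (\<rho> * x)^2\<close> at
    most \<open>e / 4\<close>; \<open>C4\<close> is the price of comparing the levels
    \<open>x / 4\<close> and \<open>x\<close>.\<close>
  define Z where "Z = 4 * C4 / (\<rho>\<^sup>2 * e)"
  have "\<forall>\<^sub>F n in sequentially. k * ln (real n) > max 1 Z"
  proof -
    have "filterlim (\<lambda>n::nat. k * ln (real n)) at_top sequentially" using k by real_asymp
    then show ?thesis by (simp only: filterlim_at_top_dense)
  qed
  moreover have "\<forall>\<^sub>F n in sequentially. sqrt (real n) > K * Y"
  proof -
    have "filterlim (\<lambda>n::nat. sqrt (real n)) at_top sequentially" by real_asymp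
    then show ?thesis by (simp only: filterlim_at_top_dense)
  qed
  ultimately have "\<forall>\<^sub>F n in sequentially. k * ln (real n) > max 1 Z \<and> sqrt (real n) > K * Y"
    by (rule eventually_conj)
  then obtain n2 where n2: "\<And>n. n \<ge> n2 \<Longrightarrow> k * ln (real n) > max 1 Z \<and> sqrt (real n) > K * Y"
    by (auto simp: eventually_sequentially)
  have main: "\<bar>\<P>(\<omega> in M. S c F \<omega> \<ge> x) - V c F x\<bar> \<le> e * V c F x"
    if n: "n \<ge> max n1 n2" and x0: "x > 0" and xk: "3 * exp t * (t - 2) * ln (real n) \<le> x\<^sup>2"
    and sw: "spread_weights K n c F" for n x c F
  proof -
    have F: "finite F" and c: "\<forall>i\<in>F. 0 \<le> c i \<and> sqrt (real n) * c i \<le> K" and s: "(\<Sum>i\<in>F. (c i)\<^sup>2) \<le> 1"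
      using sw by (auto simp: spread_weights_def)
    have nn: "n \<ge> n1" "n \<ge> n2" "n \<ge> 1" using n n1 by auto
    note N = n2[OF nn(2)]
    have x2: "x\<^sup>2 > 1" "x\<^sup>2 > Z" using xk N by (auto simp: k_def)
    have x1: "x \<ge> 1"
    proof (rule ccontr)
      assume "\<not> x \<ge> 1"
      then have "x\<^sup>2 \<le> 1" using x0 by (intro power_le_one) auto
      with x2 show False by simp
    qed
    have c0: "\<And>i. i \<in> F \<Longrightarrow> 0 \<le> c i" using c by auto
    have Yc: "y * c i \<le> x" if "i \<in> F" "0 < y" "y \<le> Y" for i y
    proof -
      have "Y > 0" using Y1 by (auto simp: Y_def)
      have "sqrt (real n) * (y * c i) \<le> sqrt (real n) * (Y * c i)"
        using that c0[OF that(1)] by (intro mult_left_mono mult_right_mono) auto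
      also have "\<dots> = Y * (sqrt (real n) * c i)" by simp
      also have "\<dots> \<le> Y * K" using c that \<open>Y > 0\<close> by (intro mult_left_mono) auto
      also have "\<dots> \<le> sqrt (real n) * 1" using N by (simp add: mult.commute)
      finally have "y * c i \<le> 1" using nn(3) by (subst (asm) mult_le_cancel_left_pos) auto
      with x1 show ?thesis by simp
    qed
    have Vc: "0 \<le> c i \<and> Y1 * c i \<le> x" "0 \<le> c i \<and> Y2 * c i \<le> x" "0 \<le> c i \<and> Y3 * c i \<le> x" if "i \<in> F" for i
      using c0[OF that] Yc[OF that] Y1 Y2 Y3 by (auto simp: Y_def)
    note V0 = V_nonneg[of c F x]
    have rx: "C4 / (\<rho> * x)\<^sup>2 \<le> e / 4"
    proof -
      have "Z * (\<rho>\<^sup>2 * e) \<le> x\<^sup>2 * (\<rho>\<^sup>2 * e)" using x2 e by (intro mult_right_mono) auto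
      then have "4 * C4 \<le> x\<^sup>2 * (\<rho>\<^sup>2 * e)" using rho e by (simp add: Z_def)
      then show ?thesis using rho x0 by (simp add: pos_divide_le_eq power_mult_distrib algebra_simps)
    qed
    have up: "\<P>(\<omega> in M. S c F \<omega> \<ge> x) \<le> (1 + e) * V c F x"
    proof -
      \<comment> \<open>The error \<open>e\<close> is split into \<open>e / 4\<close> for the
        truncated sum, \<open>e / 2\<close> for the change of level and \<open>e / 4\<close> for the
        product terms.\<close>
      have "\<P>(\<omega> in M. S c F \<omega> \<ge> x) \<le> \<P>(\<omega> in M. T (4 / x) c F \<omega> \<ge> x) + (\<Sum>i\<in>F. \<P>(\<omega> in M. c i * X i \<omega> \<ge> (1 - \<rho>) * x)) +
        (\<Sum>i\<in>F. \<P>(\<omega> in M. 4 / x * (c i * X i \<omega>) > 1) * \<P>(\<omega> in M. S c (F - {i}) \<omega> \<ge> x - (1 - \<rho>) * x))"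
        by (rule prob_S_le_one_big_jump[OF F])
      also have "\<P>(\<omega> in M. T (4 / x) c F \<omega> \<ge> x) \<le> e / 4 * V c F x"
        by (rule neg[rule_format, OF nn(1) x0 xk sw])
      also have "(\<Sum>i\<in>F. \<P>(\<omega> in M. c i * X i \<omega> \<ge> (1 - \<rho>) * x)) \<le> (1 + e / 2) * V c F x"
      proof -
        have "(\<Sum>i\<in>F. \<P>(\<omega> in M. c i * X i \<omega> \<ge> (1 - \<rho>) * x)) \<le> ((1 - \<rho>) powr (- t) + e / 4) * V c F x"
          using v1[rule_format, OF x0 Vc(1)] by (simp add: V_def)
        also have "\<dots> \<le> (1 + e / 2) * V c F x" using r1 V0 by (intro mult_right_mono) auto
        finally show ?thesis .
      qed
      also have "(\<Sum>i\<in>F. \<P>(\<omega> in M. 4 / x * (c i * X i \<omega>) > 1) * \<P>(\<omega> in M. S c (F - {i}) \<omega> \<ge> x - (1 - \<rho>) * x)) \<le>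
          (\<Sum>i\<in>F. \<P>(\<omega> in M. c i * X i \<omega> \<ge> 1 / 4 * x) * (1 / (\<rho> * x)\<^sup>2))"
      proof (intro sum_mono mult_mono)
        fix i assume i: "i \<in> F"
        show "\<P>(\<omega> in M. 4 / x * (c i * X i \<omega>) > 1) \<le> \<P>(\<omega> in M. c i * X i \<omega> \<ge> 1 / 4 * x)"
          using x0 by (intro finite_measure_mono) (auto simp: pos_less_divide_eq)
        have r0: "\<rho> * x > 0" using rho x0 by simp
        have "\<P>(\<omega> in M. S c (F - {i}) \<omega> \<ge> x - (1 - \<rho>) * x) \<le> \<P>(\<omega> in M. \<bar>S c (F - {i}) \<omega>\<bar> \<ge> \<rho> * x)"
          by (intro finite_measure_mono) (auto simp: algebra_simps)
        also have "\<dots> \<le> (\<Sum>i\<in>F - {i}. (c i)\<^sup>2) / (\<rho> * x)\<^sup>2" using F r0 by (intro S_chebyshev) auto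
        also have "\<dots> \<le> 1 / (\<rho> * x)\<^sup>2" using F by (intro divide_right_mono order_trans[OF sum_mono2 s]) auto
        finally show "\<P>(\<omega> in M. S c (F - {i}) \<omega> \<ge> x - (1 - \<rho>) * x) \<le> 1 / (\<rho> * x)\<^sup>2" .
      qed auto
      also have "\<dots> = V c F (1 / 4 * x) * (1 / (\<rho> * x)\<^sup>2)" unfolding V_def by (simp only: sum_distrib_right)
      also have "\<dots> \<le> (C4 * V c F x) * (1 / (\<rho> * x)\<^sup>2)"
        unfolding C4_def using v3[rule_format, OF x0 Vc(3)] by (intro mult_right_mono) auto
      also have "\<dots> = C4 / (\<rho> * x)\<^sup>2 * V c F x" by simp
      also have "\<dots> \<le> e / 4 * V c F x" using rx V0 by (intro mult_right_mono) auto
      finally show ?thesis by (simp add: algebra_simps)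
    qed
    have lo: "(1 - e) * V c F x \<le> \<P>(\<omega> in M. S c F \<omega> \<ge> x)"
    proof -
      have "(1 - e / 2) * V c F x \<le> ((1 + \<rho>) powr (- t) - e / 4) * V c F x"
        using r2 V0 by (intro mult_right_mono) auto
      also have "\<dots> \<le> V c F ((1 + \<rho>) * x)" by (rule v2[rule_format, OF x0 Vc(2), THEN conjunct2])
      finally have a: "(1 - e / 2) * V c F x \<le> V c F ((1 + \<rho>) * x)" .
      have b: "1 - e / 2 \<le> 1 - 1 / (\<rho> * x)\<^sup>2 - 1 / ((1 + \<rho>) * x)\<^sup>2"
      proof -
        have "(\<rho> * x)\<^sup>2 \<le> ((1 + \<rho>) * x)\<^sup>2" using rho x0 by (intro power_mono mult_right_mono) auto
        then have "1 / ((1 + \<rho>) * x)\<^sup>2 \<le> 1 / (\<rho> * x)\<^sup>2" using rho x0 by (intro divide_left_mono) auto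
        moreover have "1 / (\<rho> * x)\<^sup>2 \<le> C4 / (\<rho> * x)\<^sup>2" using C4 by (intro divide_right_mono) auto
        ultimately show ?thesis using rx by linarith
      qed
      have "(1 - e) * V c F x \<le> (1 - e / 2) * ((1 - e / 2) * V c F x)"
      proof -
        have "(1 - e) \<le> (1 - e / 2) * (1 - e / 2)" by (simp add: algebra_simps)
        then show ?thesis unfolding mult.assoc[symmetric] using V0 by (intro mult_right_mono) auto
      qed
      also have "\<dots> \<le> (1 - e / 2) * V c F ((1 + \<rho>) * x)" using a e by (intro mult_left_mono) auto
      also have "\<dots> = V c F ((1 + \<rho>) * x) * (1 - e / 2)" by (rule mult.commute)
      also have "\<dots> \<le> V c F ((1 + \<rho>) * x) * (1 - 1 / (\<rho> * x)\<^sup>2 - 1 / ((1 + \<rho>) * x)\<^sup>2)"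
        using b by (intro mult_left_mono V_nonneg)
      also have "\<dots> \<le> \<P>(\<omega> in M. S c F \<omega> \<ge> (1 + \<rho>) * x - \<rho> * x)"
        unfolding V_def using rho x0 by (intro prob_S_ge_one_big_jump F c0 s) auto
      finally show ?thesis by (simp add: algebra_simps)
    qed
    from up lo show ?thesis by (simp add: abs_le_iff algebra_simps)
  qed
  have "1 \<le> max n1 n2" using n1 by simp
  then show ?thesis
    by (intro exI[of _ "max n1 n2"] conjI allI impI main) assumption+
qed

end

section \<open>Passage to the linear process\<close>

lemma infsum_int_approx:
  fixes f :: "int \<Rightarrow> real"
  assumes nn: "\<And>i. f i \<ge> 0" and sm: "f summable_on {..b}" and y: "y < (\<Sum>\<^sub>\<infinity>i\<in>{..b}. f i)"
  shows "\<forall>\<^sub>F N in sequentially. y < (\<Sum>i\<in>{- int N<..b}. f i)"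
proof -
  have "(sum f \<longlongrightarrow> (\<Sum>\<^sub>\<infinity>i\<in>{..b}. f i)) (finite_subsets_at_top {..b})"
    using has_sum_infsum[OF sm] by (simp add: has_sum_def)
  then have "\<forall>\<^sub>F G in finite_subsets_at_top {..b}. y < sum f G" using y by (rule order_tendstoD)
  then obtain H where H: "finite H" "H \<subseteq> {..b}" "\<forall>G. finite G \<and> H \<subseteq> G \<and> G \<subseteq> {..b} \<longrightarrow> y < sum f G"
    unfolding eventually_finite_subsets_at_top by (elim exE conjE)
  obtain N0 :: nat where N0: "\<And>i. i \<in> H \<Longrightarrow> - int N0 < i"
  proof -
    have "bdd_below H" using H(1) by simp
    then obtain m where m: "\<And>i. i \<in> H \<Longrightarrow> m \<le> i" by (auto simp: bdd_below_def)
    have "- int (nat (1 - m)) < i" if "i \<in> H" for i using m[OF that] by linarith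
    then show ?thesis by (rule that)
  qed
  have "y < (\<Sum>i\<in>{- int N<..b}. f i)" if "N \<ge> N0" for N
  proof (rule H(3)[rule_format], intro conjI)
    show "H \<subseteq> {- int N<..b}" using N0 H(2) that by fastforce
  qed auto
  then show ?thesis by (auto simp: eventually_sequentially)
qed

text \<open>The factorisation must hold at every \<open>n \<ge> 1\<close>, not only eventually;
  therefore the error is the quotient minus 1, and \<open>V\<close> has to be positive at each such
  \<open>n\<close>.\<close>

lemma relative_error_sequence:
  fixes A V :: "nat \<Rightarrow> real"
  assumes V: "\<And>n. n \<ge> 1 \<Longrightarrow> V n > 0"
    and lim: "\<And>e. 0 < e \<Longrightarrow> e < 1 \<Longrightarrow> \<exists>N. \<forall>n\<ge>N. n \<ge> 1 \<longrightarrow> \<bar>A n - V n\<bar> \<le> e * V n"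
  shows "\<exists>\<epsilon>. \<epsilon> \<longlonglongrightarrow> 0 \<and> (\<forall>n\<ge>1. A n = V n * (1 + \<epsilon> n))"
proof (intro exI[of _ "\<lambda>n. A n / V n - 1"] conjI allI impI)
  show "A n = V n * (1 + (A n / V n - 1))" if "n \<ge> 1" for n using V[OF that] by simp
  show "(\<lambda>n. A n / V n - 1) \<longlonglongrightarrow> 0"
  proof (rule LIMSEQ_I)
    fix r :: real assume r: "r > 0"
    define e where "e = min (r / 2) (1 / 2)"
    have e: "0 < e" "e < 1" "e < r" using r by (auto simp: e_def)
    obtain N where N: "\<forall>n\<ge>N. n \<ge> 1 \<longrightarrow> \<bar>A n - V n\<bar> \<le> e * V n" using lim[OF e(1,2)] by blast
    have "norm (A n / V n - 1 - 0) < r" if "n \<ge> max 1 N" for n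
    proof -
      have n: "n \<ge> 1" "n \<ge> N" using that by auto
      have v: "V n > 0" by (rule V[OF n(1)])
      have "\<bar>A n / V n - 1\<bar> = \<bar>A n - V n\<bar> / V n" using v by (simp add: field_simps abs_divide)
      also have "\<dots> \<le> e" using N n v by (simp add: pos_divide_le_eq)
      finally show ?thesis using e by simp
    qed
    then show "\<exists>no. \<forall>n\<ge>no. norm (A n / V n - 1 - 0) < r" by blast
  qed
qed

locale weighted_process =
  iid_std M X \<mu> + regular_coeffs \<alpha> C \<rho> \<theta> a
  for M :: "'a measure" and X :: "int \<Rightarrow> 'a \<Rightarrow> real" and \<mu> \<alpha> C \<rho> \<theta> a
begin

definition B :: "nat \<Rightarrow> real" where "B n = sqrt (\<Sum>\<^sub>\<infinity>i\<in>{..int n}. (coeff_b a n i)\<^sup>2)"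
definition c :: "nat \<Rightarrow> int \<Rightarrow> real" where "c n i = coeff_b a n i / B n"
definition Z :: "nat \<Rightarrow> 'a \<Rightarrow> real" where "Z n \<omega> = partial_sum a X n \<omega> / B n"

lemma Z_measurable[measurable]: "Z n \<in> borel_measurable M"
  unfolding Z_def by measurable

lemma weights:
  obtains K where "K \<ge> 1"
    "\<And>n. n \<ge> 1 \<Longrightarrow> B n > 0"
    "\<And>n. n \<ge> 1 \<Longrightarrow> (\<lambda>i. (c n i)\<^sup>2) summable_on {..int n}"
    "\<And>n. n \<ge> 1 \<Longrightarrow> (\<Sum>\<^sub>\<infinity>i\<in>{..int n}. (c n i)\<^sup>2) = 1"
    "\<And>n i. n \<ge> 1 \<Longrightarrow> 0 \<le> c n i \<and> sqrt (real n) * c n i \<le> K"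
    "\<And>n i. n \<ge> 1 \<Longrightarrow> i \<in> {- int n..0} \<Longrightarrow> 1 \<le> K * (sqrt (real n) * c n i)"
proof -
  obtain K where K: "K \<ge> 1" and b: "\<forall>n\<ge>1. (\<lambda>i. (coeff_b a n i)\<^sup>2) summable_on {..int n} \<and>
     (\<Sum>\<^sub>\<infinity>i\<in>{..int n}. (coeff_b a n i)\<^sup>2) > 0 \<and>
     (\<forall>i. sqrt (real n) * coeff_b a n i \<le> K * sqrt (\<Sum>\<^sub>\<infinity>i\<in>{..int n}. (coeff_b a n i)\<^sup>2)) \<and>
     (\<forall>i\<in>{- int n..0}. sqrt (\<Sum>\<^sub>\<infinity>i\<in>{..int n}. (coeff_b a n i)\<^sup>2) \<le> K * (sqrt (real n) * coeff_b a n i))"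
    using normalised_coeff_b by (elim exE conjE)
  have Bp: "B n > 0" if "n \<ge> 1" for n using b that by (simp add: B_def)
  have cc: "(c n i)\<^sup>2 = (1 / (B n)\<^sup>2) * (coeff_b a n i)\<^sup>2" for n i by (simp add: c_def power_divide)
  show ?thesis
  proof (rule that[OF K Bp])
    fix n :: nat assume n: "n \<ge> 1"
    note b' = b[rule_format, OF n]
    show "(\<lambda>i. (c n i)\<^sup>2) summable_on {..int n}" unfolding cc using b' by (intro summable_on_cmult_right) auto
    have "(B n)\<^sup>2 = (\<Sum>\<^sub>\<infinity>i\<in>{..int n}. (coeff_b a n i)\<^sup>2)" using b' by (simp add: B_def)
    then show "(\<Sum>\<^sub>\<infinity>i\<in>{..int n}. (c n i)\<^sup>2) = 1"
      unfolding cc using b' Bp[OF n] by (subst infsum_cmult_right) auto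
    fix i
    show "0 \<le> c n i \<and> sqrt (real n) * c n i \<le> K"
      using b' Bp[OF n] coeff_b_nonneg unfolding c_def B_def[symmetric] by (auto simp: pos_divide_le_eq)
    show "1 \<le> K * (sqrt (real n) * c n i)" if "i \<in> {- int n..0}"
      using b' that Bp[OF n] unfolding c_def B_def[symmetric] by (auto simp: pos_le_divide_eq)
  qed
qed

lemma Z_sandwich:
  assumes n: "n \<ge> 1" and d: "\<delta> > 0" and e: "e > 0"
  shows "\<forall>\<^sub>F N in sequentially. \<forall>x. \<P>(\<omega> in M. Z n \<omega> \<ge> x) \<le> \<P>(\<omega> in M. S (c n) {- int N<..int n} \<omega> \<ge> x - \<delta>) + e \<and>
     \<P>(\<omega> in M. S (c n) {- int N<..int n} \<omega> \<ge> x + \<delta>) - e \<le> \<P>(\<omega> in M. Z n \<omega> \<ge> x)"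
proof (rule AE_tendsto_prob_sandwich[OF _ _ _ d e])
  have "AE \<omega> in M. (\<lambda>N. \<Sum>i\<in>{- int N<..int n}. coeff_b a n i * (1 * X i \<omega>)) \<longlonglongrightarrow> partial_sum a (\<lambda>i \<omega>. 1 * X i \<omega>) n \<omega>"
    using a_neg summable_a_square by (intro AE_partial_sum_limit[OF iid_std_axioms])
  then show "AE \<omega> in M. (\<lambda>N. S (c n) {- int N<..int n} \<omega>) \<longlonglongrightarrow> Z n \<omega>"
  proof eventually_elim
    case (elim \<omega>)
    then have "(\<lambda>N. (\<Sum>i\<in>{- int N<..int n}. coeff_b a n i * X i \<omega>) / B n) \<longlonglongrightarrow> partial_sum a X n \<omega> / B n"
      unfolding divide_inverse by (intro tendsto_mult_right) simp
    then show ?case by (simp add: S_def c_def Z_def sum_divide_distrib)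
  qed
qed measurable

text \<open>Almost everywhere only, because \<open>suminf\<close> need not respect scaling where a
  series diverges.\<close>

lemma AE_partial_sum_scale:
  "AE \<omega> in M. partial_sum a (\<lambda>i \<omega>. s * X i \<omega>) n \<omega> = s * partial_sum a X n \<omega>"
proof -
  have "AE \<omega> in M. (\<lambda>N. \<Sum>i\<in>{- int N<..int n}. coeff_b a n i * (k * X i \<omega>)) \<longlonglongrightarrow> partial_sum a (\<lambda>i \<omega>. k * X i \<omega>) n \<omega>" for k
    using a_neg summable_a_square by (intro AE_partial_sum_limit[OF iid_std_axioms])
  from this[of s] this[of 1] show ?thesis
  proof eventually_elim
    case (elim \<omega>)
    from tendsto_mult_left[OF elim(2), of s]
    have "(\<lambda>N. \<Sum>i\<in>{- int N<..int n}. coeff_b a n i * (s * X i \<omega>)) \<longlonglongrightarrow> s * partial_sum a X n \<omega>"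
      by (simp add: sum_distrib_left mult.left_commute)
    from LIMSEQ_unique[OF elim(1) this] show ?case .
  qed
qed

lemma prob_partial_sum:
  assumes s: "s > 0" and n: "n \<ge> 1"
  shows "\<P>(\<omega> in M. partial_sum a (\<lambda>i \<omega>. s * X i \<omega>) n \<omega> \<ge> x * (s * B n)) = \<P>(\<omega> in M. Z n \<omega> \<ge> x)"
proof -
  have Bp: "B n > 0" using weights n by metis
  have "AE \<omega> in M. (partial_sum a (\<lambda>i \<omega>. s * X i \<omega>) n \<omega> \<ge> x * (s * B n)) = (Z n \<omega> \<ge> x)"
    using AE_partial_sum_scale[of s n]
  proof eventually_elim
    case (elim \<omega>)
    have "x * (s * B n) \<le> s * partial_sum a X n \<omega> \<longleftrightarrow> s * (x * B n) \<le> s * partial_sum a X n \<omega>" by (simp add: mult_ac)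
    also have "\<dots> \<longleftrightarrow> x * B n \<le> partial_sum a X n \<omega>" using s by simp
    finally show ?case unfolding elim Z_def using Bp by (simp add: pos_le_divide_eq)
  qed
  then show ?thesis by (intro prob_eq_AE) auto
qed

lemma moderate_deviations:
  assumes p: "p > 2" and mp: "integrable \<mu> (\<lambda>x. \<bar>x\<bar> powr p)"
    and x: "\<And>n. n \<ge> 1 \<Longrightarrow> (x n)\<^sup>2 \<le> (p - 2) * ln (real n)"
  shows "\<exists>\<epsilon>. \<epsilon> \<longlonglongrightarrow> 0 \<and> (\<forall>n\<ge>1. \<P>(\<omega> in M. Z n \<omega> \<ge> x n) = Q (x n) * (1 + \<epsilon> n))"
proof (rule relative_error_sequence[OF Q_pos])
  fix e0 :: real assume e0: "0 < e0" "e0 < 1"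
  \<comment> \<open>The upper estimate accumulates \<open>3 * e + e * e \<le> 4 * e\<close>.\<close>
  define e where "e = e0 / 4"
  have e: "0 < e" "e < 1" using e0 by (auto simp: e_def)
  obtain K where K: "K \<ge> 1" and
    w2: "\<And>n. n \<ge> 1 \<Longrightarrow> (\<lambda>i. (c n i)\<^sup>2) summable_on {..int n}" "\<And>n. n \<ge> 1 \<Longrightarrow> (\<Sum>\<^sub>\<infinity>i\<in>{..int n}. (c n i)\<^sup>2) = 1" and
    w3: "\<And>n i. n \<ge> 1 \<Longrightarrow> 0 \<le> c n i \<and> sqrt (real n) * c n i \<le> K"
    using weights by metis
  \<comment> \<open>The factor 3 anticipates the shift of the level by \<open>d\<close>, which
    changes \<open>exp (- y^2 / 2)\<close> by at most a factor \<open>exp 1 \<le> 3\<close>.\<close>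
  have K2: "3 * K powr (p - 2) > 0" using K by simp
  obtain g0 where g0: "g0 > 0" and fin: "\<forall>\<gamma>\<in>{0<..g0}. \<forall>x. \<gamma> powr (p - 2) \<le> 3 * K powr (p - 2) * exp (- x\<^sup>2 / 2) \<longrightarrow>
    (\<exists>s0<1. \<forall>c F. finite F \<longrightarrow> (\<forall>i\<in>F. 0 \<le> c i \<and> c i \<le> \<gamma>) \<longrightarrow>
      s0 \<le> (\<Sum>i\<in>F. (c i)\<^sup>2) \<longrightarrow> (\<Sum>i\<in>F. (c i)\<^sup>2) \<le> 1 \<longrightarrow> \<bar>\<P>(\<omega> in M. S c F \<omega> \<ge> x) - Q x\<bar> \<le> e * Q x)"
    using moderate_deviations_finite[OF p mp K2 e(1)] by (elim exE conjE)
  have "\<forall>\<^sub>F n in sequentially. sqrt (real n) > K / g0"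
  proof -
    have "filterlim (\<lambda>n::nat. sqrt (real n)) at_top sequentially" by real_asymp
    then show ?thesis by (simp only: filterlim_at_top_dense)
  qed
  then obtain N0 where N0: "\<And>n. n \<ge> N0 \<Longrightarrow> sqrt (real n) > K / g0" by (auto simp: eventually_sequentially)
  have main: "\<bar>\<P>(\<omega> in M. Z n \<omega> \<ge> y) - Q y\<bar> \<le> e0 * Q y"
    if n: "n \<ge> N0" "n \<ge> 1" and y: "y\<^sup>2 \<le> (p - 2) * ln (real n)" for n y
  proof -
    define \<gamma> where "\<gamma> = K / sqrt (real n)"
    have g: "\<gamma> \<in> {0<..g0}" using K n N0[OF n(1)] g0 by (auto simp: \<gamma>_def field_simps)
    \<comment> \<open>The left-hand side is \<open>K powr (p - 2) * n powr (1 - p / 2)\<close>, and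
      \<open>n powr (1 - p / 2) \<le> exp (- y^2 / 2)\<close> is exactly
      \<open>y^2 \<le> (p - 2) * ln n\<close>.\<close>
    have gp: "\<gamma> powr (p - 2) \<le> K powr (p - 2) * exp (- y\<^sup>2 / 2)"
    proof -
      have "sqrt (real n) powr (2 - p) = exp ((1 - p / 2) * ln (real n))"
        using n by (simp add: powr_def ln_sqrt field_simps)
      also have "\<dots> \<le> exp (- y\<^sup>2 / 2)" using y by (simp add: field_simps)
      finally have "K powr (p - 2) * sqrt (real n) powr (2 - p) \<le> K powr (p - 2) * exp (- y\<^sup>2 / 2)"
        by (intro mult_left_mono) auto
      moreover have "\<gamma> powr (p - 2) = K powr (p - 2) * sqrt (real n) powr (2 - p)"
        using K powr_minus_divide[of "sqrt (real n)" "p - 2"] by (simp add: \<gamma>_def powr_divide)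
      ultimately show ?thesis by simp
    qed
    \<comment> \<open>\<open>d\<close> may depend on \<open>y\<close>, since afterwards only the
      number \<open>N\<close> of retained summands grows. The first entry keeps the squares of the
      shifted levels below \<open>y^2 + 2\<close>, the second makes the change of \<open>Q\<close>
      at most \<open>e * Q y\<close>.\<close>
    define d where "d = min (1 / (3 * (1 + \<bar>y\<bar>))) (e * Q y / exp (\<bar>y\<bar> + 1))"
    have d: "0 < d" "d \<le> 1 / (3 * (1 + \<bar>y\<bar>))" "d * exp (\<bar>y\<bar> + 1) \<le> e * Q y"
      using e Q_pos[of y] by (auto simp: d_def pos_le_divide_eq[symmetric] intro!: divide_pos_pos mult_pos_pos add_pos_nonneg)
    have d1: "d * (1 + \<bar>y\<bar>) \<le> 1 / 3" using d(2) by (simp add: field_simps)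
    have "0 \<le> d * \<bar>y\<bar>" using d by simp
    with d1 have d2: "d \<le> 1 / 3" "d * \<bar>y\<bar> \<le> 1 / 3" using d(1) unfolding distrib_left by linarith+
    have near: "\<gamma> powr (p - 2) \<le> 3 * K powr (p - 2) * exp (- z\<^sup>2 / 2)" if z: "z = y - d \<or> z = y + d" for z
    proof -
      have dd: "d * d \<le> d * 1" using d2 d(1) by (intro mult_left_mono) auto
      have "d * y \<le> d * \<bar>y\<bar>" "- (d * y) \<le> d * \<bar>y\<bar>"
        using mult_left_mono[of y "\<bar>y\<bar>" d] mult_left_mono[of "- y" "\<bar>y\<bar>" d] d(1) by simp_all
      then have "z\<^sup>2 \<le> y\<^sup>2 + 2 * (d * \<bar>y\<bar>) + d * d"
        using z by (auto simp: power2_eq_square algebra_simps)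
      also have "\<dots> \<le> y\<^sup>2 + 2" using d2 dd by linarith
      finally have "exp (- y\<^sup>2 / 2) \<le> exp (1 + - z\<^sup>2 / 2)" by simp
      also have "\<dots> = exp 1 * exp (- z\<^sup>2 / 2)" by (rule exp_add)
      also have "\<dots> \<le> 3 * exp (- z\<^sup>2 / 2)" by (intro mult_right_mono exp_le) auto
      finally have "K powr (p - 2) * exp (- y\<^sup>2 / 2) \<le> K powr (p - 2) * (3 * exp (- z\<^sup>2 / 2))" by (intro mult_left_mono) auto
      with gp show ?thesis by (simp add: mult_ac)
    qed
    have get: "\<forall>\<^sub>F N in sequentially. \<bar>\<P>(\<omega> in M. S (c n) {- int N<..int n} \<omega> \<ge> z) - Q z\<bar> \<le> e * Q z"
      if z: "z = y - d \<or> z = y + d" for z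
    proof -
      obtain s0 where s0: "s0 < 1" and F: "\<forall>c F. finite F \<longrightarrow> (\<forall>i\<in>F. 0 \<le> c i \<and> c i \<le> \<gamma>) \<longrightarrow>
        s0 \<le> (\<Sum>i\<in>F. (c i)\<^sup>2) \<longrightarrow> (\<Sum>i\<in>F. (c i)\<^sup>2) \<le> 1 \<longrightarrow> \<bar>\<P>(\<omega> in M. S c F \<omega> \<ge> z) - Q z\<bar> \<le> e * Q z"
        using fin[rule_format, OF g near[OF z]] by (elim exE conjE)
      have "\<forall>\<^sub>F N in sequentially. s0 < (\<Sum>i\<in>{- int N<..int n}. (c n i)\<^sup>2)"
        using w2[OF n(2)] s0 by (intro infsum_int_approx) auto
      then show ?thesis
      proof eventually_elim
        case (elim N)
        have "(\<Sum>i\<in>{- int N<..int n}. (c n i)\<^sup>2) \<le> (\<Sum>\<^sub>\<infinity>i\<in>{..int n}. (c n i)\<^sup>2)"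
          by (rule finite_sum_le_infsum[OF w2(1)[OF n(2)]]) auto
        then have "(\<Sum>i\<in>{- int N<..int n}. (c n i)\<^sup>2) \<le> 1" using w2(2)[OF n(2)] by simp
        moreover have "0 \<le> c n i \<and> c n i \<le> \<gamma>" for i
          using w3[OF n(2), of i] n by (simp add: \<gamma>_def pos_le_divide_eq mult.commute)
        ultimately show ?case using elim F[rule_format, of "{- int N<..int n}" "c n"] by auto
      qed
    qed
    have eQ: "e * Q y > 0" using e Q_pos by simp
    have ev: "\<forall>\<^sub>F N in sequentially. \<bar>\<P>(\<omega> in M. Z n \<omega> \<ge> y) - Q y\<bar> \<le> e0 * Q y"
      using get[of "y - d", simplified] get[of "y + d", simplified] Z_sandwich[OF n(2) d(1) eQ]
    proof eventually_elim
      case (elim N)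
      have q0: "Q y \<ge> 0" using Q_pos[of y] by simp
      have Qm: "Q (y - d) \<le> (1 + e) * Q y"
      proof -
        have "- (max y 0)\<^sup>2 / 2 + max y 0 * d \<le> \<bar>y\<bar> + 1"
        proof -
          have "max y 0 * d \<le> \<bar>y\<bar> * 1" using d2 d(1) by (intro mult_mono) auto
          moreover have "0 \<le> (max y 0)\<^sup>2" by simp
          ultimately show ?thesis by linarith
        qed
        then have "d * exp (- (max y 0)\<^sup>2 / 2 + max y 0 * d) \<le> d * exp (\<bar>y\<bar> + 1)" using d by (intro mult_left_mono) auto
        then have "Q (y - d) \<le> Q y + e * Q y" using Q_diff_le[of d y] d(1,3) by linarith
        then show ?thesis by (simp add: distrib_right)
      qed
      have Qp: "Q (y + d) \<ge> (1 - e) * Q y"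
      proof -
        have "- (max (y + d) 0)\<^sup>2 / 2 + max (y + d) 0 * d \<le> \<bar>y\<bar> + 1"
        proof -
          have "max (y + d) 0 * d \<le> (\<bar>y\<bar> + 1) * 1" using d2 d(1) by (intro mult_mono) auto
          moreover have "- (max (y + d) 0)\<^sup>2 / 2 \<le> 0" by simp
          ultimately have "- (max (y + d) 0)\<^sup>2 / 2 + max (y + d) 0 * d \<le> 0 + (\<bar>y\<bar> + 1) * 1"
            by (intro add_mono)
          then show ?thesis by simp
        qed
        then have "d * exp (- (max (y + d) 0)\<^sup>2 / 2 + max (y + d) 0 * d) \<le> d * exp (\<bar>y\<bar> + 1)" using d by (intro mult_left_mono) auto
        moreover have "Q (y + d - d) = Q y" by simp
        ultimately have "Q y - e * Q y \<le> Q (y + d)" using Q_diff_le[of d "y + d"] d(1,3) by linarith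
        then show ?thesis by (simp add: left_diff_distrib)
      qed
      have "\<P>(\<omega> in M. Z n \<omega> \<ge> y) \<le> (1 + e) * Q (y - d) + e * Q y"
        using elim(1) elim(3)[rule_format, of y] by (simp add: abs_le_iff algebra_simps)
      also have "\<dots> \<le> (1 + e) * ((1 + e) * Q y) + e * Q y" using Qm e by (intro add_right_mono mult_left_mono) auto
      also have "\<dots> = (1 + (3 * e + e * e)) * Q y" by (simp add: algebra_simps)
      also have "\<dots> \<le> (1 + e0) * Q y"
      proof (intro mult_right_mono q0)
        have "e * e \<le> e" using mult_left_mono[of e 1 e] e by simp
        moreover have "e0 = 4 * e" by (simp add: e_def)
        ultimately show "1 + (3 * e + e * e) \<le> 1 + e0" using e by linarith
      qed
      finally have u: "\<P>(\<omega> in M. Z n \<omega> \<ge> y) \<le> (1 + e0) * Q y" .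
      have "(1 - e0) * Q y \<le> (1 - 3 * e) * Q y" using e0 q0 by (intro mult_right_mono) (auto simp: e_def)
      also have "\<dots> \<le> (1 - e) * ((1 - e) * Q y) - e * Q y" using q0 e by (simp add: algebra_simps)
      also have "\<dots> \<le> (1 - e) * Q (y + d) - e * Q y" using Qp e by (intro diff_right_mono mult_left_mono) auto
      also have "\<dots> \<le> \<P>(\<omega> in M. Z n \<omega> \<ge> y)"
        using elim(2) elim(3)[rule_format, of y] by (simp add: abs_le_iff algebra_simps)
      finally show ?case using u by (simp add: abs_le_iff algebra_simps)
    qed
    then show ?thesis by simp
  qed
  show "\<exists>N. \<forall>n\<ge>N. n \<ge> 1 \<longrightarrow> \<bar>\<P>(\<omega> in M. Z n \<omega> \<ge> x n) - Q (x n)\<bar> \<le> e0 * Q (x n)"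
    by (intro exI[of _ N0] allI impI main x)
qed

lemma large_deviations:
  assumes t: "t > 2" and pos: "\<And>y. G y > 0"
    and reg: "\<And>f. f > 0 \<Longrightarrow> ((\<lambda>y. G (f * y) / G y) \<longlongrightarrow> f powr (- t)) at_top"
    and x: "\<And>n. n \<ge> 1 \<Longrightarrow> x n > 0" "\<And>n. n \<ge> 1 \<Longrightarrow> 4 * exp t * (t - 2) * ln (real n) \<le> (x n)\<^sup>2"
  defines "U \<equiv> \<lambda>n. \<Sum>\<^sub>\<infinity>i\<in>{..int n}. \<P>(\<omega> in M. c n i * X i \<omega> \<ge> x n)"
  shows "\<exists>\<epsilon>. \<epsilon> \<longlonglongrightarrow> 0 \<and> (\<forall>n\<ge>1. \<P>(\<omega> in M. Z n \<omega> \<ge> x n) = U n * (1 + \<epsilon> n))"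
proof -
  obtain K where K: "K \<ge> 1" and
    w2: "\<And>n. n \<ge> 1 \<Longrightarrow> (\<lambda>i. (c n i)\<^sup>2) summable_on {..int n}" "\<And>n. n \<ge> 1 \<Longrightarrow> (\<Sum>\<^sub>\<infinity>i\<in>{..int n}. (c n i)\<^sup>2) = 1" and
    w3: "\<And>n i. n \<ge> 1 \<Longrightarrow> 0 \<le> c n i \<and> sqrt (real n) * c n i \<le> K" and
    w4: "\<And>n i. n \<ge> 1 \<Longrightarrow> i \<in> {- int n..0} \<Longrightarrow> 1 \<le> K * (sqrt (real n) * c n i)"
    using weights by metis
  have sm: "(\<lambda>i. \<P>(\<omega> in M. c n i * X i \<omega> \<ge> y)) summable_on {..int n}" if n: "n \<ge> 1" and y: "y > 0" for n y
  proof (rule summable_on_comparison_test)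
    show "(\<lambda>i. 1 / y\<^sup>2 * (c n i)\<^sup>2) summable_on {..int n}" by (intro summable_on_cmult_right w2 n)
    show "\<P>(\<omega> in M. c n i * X i \<omega> \<ge> y) \<le> 1 / y\<^sup>2 * (c n i)\<^sup>2" for i
      using prob_term_le[OF y, of "c n" i] w3[OF n, of i] by simp
  qed auto
  have Upos: "U n > 0" if n: "n \<ge> 1" for n
  proof -
    have "c n 0 \<noteq> 0" using w4[OF n, of 0] by fastforce
    then have "0 < \<P>(\<omega> in M. c n 0 * X 0 \<omega> \<ge> x n)"
      using w3[OF n, of 0] x(1)[OF n] pos by (simp add: prob_term)
    also have "\<dots> = (\<Sum>i\<in>{0}. \<P>(\<omega> in M. c n i * X i \<omega> \<ge> x n))" by simp
    also have "\<dots> \<le> U n" unfolding U_def by (intro finite_sum_le_infsum sm n x) auto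
    finally show ?thesis .
  qed
  show ?thesis
  proof (rule relative_error_sequence[OF Upos])
    fix e0 :: real assume e0: "0 < e0" "e0 < 1"
    \<comment> \<open>The upper estimate accumulates \<open>4 * e + 2 * e * e\<close>, the lower one
      at most \<open>5 * e\<close>; both are within \<open>8 * e\<close>.\<close>
    define e where "e = e0 / 8"
    have e: "0 < e" "e < 1" using e0 by (auto simp: e_def)
    obtain r where r: "r > 0" "r < 1 / 10" and r1: "(1 - r) powr (- t) \<le> 1 + e" and r2: "(1 + r) powr (- t) \<ge> 1 - e"
      using powr_scale_near_one[of e t] e by auto
    have fp: "1 - r > 0" "1 + r > 0" using r by auto
    obtain Y1 where Y1: "Y1 > 0" and v1: "\<forall>x>0. \<forall>c F. (\<forall>i\<in>F. 0 \<le> c i \<and> Y1 * c i \<le> x) \<longrightarrow>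
        V c F ((1 - r) * x) \<le> ((1 - r) powr (- t) + e) * V c F x \<and>
        ((1 - r) powr (- t) - e) * V c F x \<le> V c F ((1 - r) * x)"
      by (rule V_scale[OF pos reg[OF fp(1)] fp(1) e(1)]) (rule that)
    obtain Y2 where Y2: "Y2 > 0" and v2: "\<forall>x>0. \<forall>c F. (\<forall>i\<in>F. 0 \<le> c i \<and> Y2 * c i \<le> x) \<longrightarrow>
        V c F ((1 + r) * x) \<le> ((1 + r) powr (- t) + e) * V c F x \<and>
        ((1 + r) powr (- t) - e) * V c F x \<le> V c F ((1 + r) * x)"
      by (rule V_scale[OF pos reg[OF fp(2)] fp(2) e(1)]) (rule that)
    have "\<exists>n0\<ge>1. \<forall>n\<ge>n0. \<forall>x>0. \<forall>c F. 3 * exp t * (t - 2) * ln (real n) \<le> x\<^sup>2 \<longrightarrow>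
        spread_weights K n c F \<longrightarrow> \<bar>\<P>(\<omega> in M. S c F \<omega> \<ge> x) - V c F x\<bar> \<le> e * V c F x"
      by (intro large_deviations_finite t pos reg K e)
    then obtain n0 where n0: "n0 \<ge> 1" and fin: "\<forall>n\<ge>n0. \<forall>x>0. \<forall>c F. 3 * exp t * (t - 2) * ln (real n) \<le> x\<^sup>2 \<longrightarrow>
        spread_weights K n c F \<longrightarrow> \<bar>\<P>(\<omega> in M. S c F \<omega> \<ge> x) - V c F x\<bar> \<le> e * V c F x"
      by (elim exE conjE)
    define k where "k = 4 * exp t * (t - 2)"
    have k: "k > 0" using t by (simp add: k_def)
    define Y where "Y = max Y1 Y2"
    have "\<forall>\<^sub>F n in sequentially. k * ln (real n) > 1"
    proof -
      have "filterlim (\<lambda>n::nat. k * ln (real n)) at_top sequentially" using k by real_asymp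
      then show ?thesis by (simp only: filterlim_at_top_dense)
    qed
    moreover have "\<forall>\<^sub>F n in sequentially. sqrt (real n) > K * Y"
    proof -
      have "filterlim (\<lambda>n::nat. sqrt (real n)) at_top sequentially" by real_asymp
      then show ?thesis by (simp only: filterlim_at_top_dense)
    qed
    ultimately have "\<forall>\<^sub>F n in sequentially. k * ln (real n) > 1 \<and> sqrt (real n) > K * Y"
      by (rule eventually_conj)
    then obtain n1 where n1: "\<And>n. n \<ge> n1 \<Longrightarrow> k * ln (real n) > 1 \<and> sqrt (real n) > K * Y"
      by (auto simp: eventually_sequentially)
    have main: "\<bar>\<P>(\<omega> in M. Z n \<omega> \<ge> x n) - U n\<bar> \<le> e0 * U n" if nn: "n \<ge> max n0 n1" for n
    proof -
      have n: "n \<ge> n0" "n \<ge> n1" "n \<ge> 1" using nn n0 by auto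
      note N1 = n1[OF n(2)]
      define y where "y = x n"
      have y0: "y > 0" using x n by (simp add: y_def)
      have yk: "k * ln (real n) \<le> y\<^sup>2" using x(2)[OF n(3)] by (simp add: k_def y_def)
      have y1: "y \<ge> 1"
      proof (rule ccontr)
        assume "\<not> y \<ge> 1"
        then have "y\<^sup>2 \<le> 1" using y0 by (intro power_le_one) auto
        with yk N1 show False by simp
      qed
      have Yc: "y' * c n i \<le> y" if "0 < y'" "y' \<le> Y" for i y'
      proof -
        have "sqrt (real n) * (y' * c n i) \<le> sqrt (real n) * (Y * c n i)"
          using that w3[OF n(3), of i] by (intro mult_left_mono mult_right_mono) auto
        also have "\<dots> = Y * (sqrt (real n) * c n i)" by simp
        also have "\<dots> \<le> Y * K" using w3[OF n(3), of i] that by (intro mult_left_mono) auto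
        also have "\<dots> \<le> sqrt (real n) * 1" using N1 by (simp add: mult.commute)
        finally have "y' * c n i \<le> 1" using n(3) by (subst (asm) mult_le_cancel_left_pos) auto
        with y1 show ?thesis by simp
      qed
      have Yc1: "0 \<le> c n i \<and> Y1 * c n i \<le> y" and Yc2: "0 \<le> c n i \<and> Y2 * c n i \<le> y" for i
        using w3[OF n(3), of i] Yc[OF Y1, of i] Yc[OF Y2, of i] by (auto simp: Y_def)
      define F where "F N = {- int N<..int n}" for N
      have sw: "spread_weights K n (c n) (F N)" if "N \<ge> n" for N
        unfolding spread_weights_def
      proof (intro conjI exI[of _ "{- int n<..0}"] ballI)
        show "finite (F N)" by (simp add: F_def)
        show "0 \<le> c n i" "sqrt (real n) * c n i \<le> K" for i using w3[OF n(3), of i] by auto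
        have "(\<Sum>i\<in>F N. (c n i)\<^sup>2) \<le> (\<Sum>\<^sub>\<infinity>i\<in>{..int n}. (c n i)\<^sup>2)"
          by (rule finite_sum_le_infsum[OF w2(1)[OF n(3)]]) (auto simp: F_def)
        then show "(\<Sum>i\<in>F N. (c n i)\<^sup>2) \<le> 1" using w2(2)[OF n(3)] by simp
        show "{- int n<..0} \<subseteq> F N" using that by (auto simp: F_def)
        show "n \<le> card {- int n<..0}" by simp
        show "1 \<le> K * (sqrt (real n) * c n i)" if "i \<in> {- int n<..0}" for i using that by (intro w4 n) auto
      qed
      \<comment> \<open>This is where the multiple 4 in the hypothesis is lowered to the 3 required
        for finite sums, to make room for the factors \<open>1 - r\<close> and
        \<open>1 + r\<close>.\<close>
      have three: "3 * exp t * (t - 2) * ln (real n) \<le> (f * y)\<^sup>2" if f: "f \<ge> 9 / 10" for f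
      proof -
        have "(9 / 10)\<^sup>2 \<le> f\<^sup>2" using f by (intro power_mono) auto
        then have "3 / 4 \<le> f\<^sup>2" by (simp add: power_divide)
        then have "3 / 4 * y\<^sup>2 \<le> f\<^sup>2 * y\<^sup>2" by (intro mult_right_mono) auto
        moreover have "3 * exp t * (t - 2) * ln (real n) = 3 / 4 * (k * ln (real n))" by (simp add: k_def)
        ultimately show ?thesis using yk unfolding power_mult_distrib by linarith
      qed
      have U0: "U n > 0" by (rule Upos[OF n(3)])
      have VU: "V (c n) (F N) y \<le> U n" for N
        unfolding V_def U_def y_def by (intro finite_sum_le_infsum sm n x) (auto simp: F_def)
      have UV: "\<forall>\<^sub>F N in sequentially. (1 - e) * U n < V (c n) (F N) y"
        unfolding V_def F_def y_def
        by (rule infsum_int_approx[OF _ sm[OF n(3) x(1)[OF n(3)]]]) (use U0 e in \<open>auto simp: U_def\<close>)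
      have eU: "e * U n > 0" using U0 e by simp
      \<comment> \<open>The level is shifted by an amount proportional to \<open>y\<close>, because
        regular variation absorbs relative changes.\<close>
      have ry: "r * y > 0" using r y0 by simp
      have "\<forall>\<^sub>F N in sequentially. \<bar>\<P>(\<omega> in M. Z n \<omega> \<ge> y) - U n\<bar> \<le> e0 * U n"
        using UV Z_sandwich[OF n(3) ry eU] eventually_ge_at_top[of n]
      proof eventually_elim
        case (elim N)
        have V0: "V (c n) (F N) y \<ge> 0" by (rule V_nonneg)
        have f1: "(1 - r) * y > 0" "(1 + r) * y > 0" using r y0 by auto
        note A = fin[rule_format, OF n(1) f1(1) three sw[OF elim(3)]]
        note A' = fin[rule_format, OF n(1) f1(2) three sw[OF elim(3)]]
        have up1: "V (c n) (F N) ((1 - r) * y) \<le> (1 + 2 * e) * U n"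
        proof -
          have "V (c n) (F N) ((1 - r) * y) \<le> ((1 - r) powr (- t) + e) * V (c n) (F N) y"
            by (rule v1[rule_format, OF y0, of "F N" "c n", THEN conjunct1]) (rule Yc1)
          also have "\<dots> \<le> (1 + 2 * e) * V (c n) (F N) y" using r1 V0 by (intro mult_right_mono) auto
          also have "\<dots> \<le> (1 + 2 * e) * U n" using VU e by (intro mult_left_mono) auto
          finally show ?thesis .
        qed
        have lo1: "(1 - 2 * e) * ((1 - e) * U n) \<le> V (c n) (F N) ((1 + r) * y)"
        proof -
          have "(1 - 2 * e) * ((1 - e) * U n) \<le> (1 - 2 * e) * V (c n) (F N) y"
            using elim(1) e0 by (intro mult_left_mono) (auto simp: e_def)
          also have "\<dots> \<le> ((1 + r) powr (- t) - e) * V (c n) (F N) y" using r2 V0 by (intro mult_right_mono) auto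
          also have "\<dots> \<le> V (c n) (F N) ((1 + r) * y)"
            by (rule v2[rule_format, OF y0, of "F N" "c n", THEN conjunct2]) (rule Yc2)
          finally show ?thesis .
        qed
        have s1: "y - r * y = (1 - r) * y" "y + r * y = (1 + r) * y" by (auto simp: algebra_simps)
        have "\<P>(\<omega> in M. Z n \<omega> \<ge> y) \<le> \<P>(\<omega> in M. S (c n) (F N) \<omega> \<ge> (1 - r) * y) + e * U n"
          using elim(2)[rule_format, of y] unfolding s1 F_def by simp
        also have "\<P>(\<omega> in M. S (c n) (F N) \<omega> \<ge> (1 - r) * y) \<le> (1 + e) * V (c n) (F N) ((1 - r) * y)"
          using A r by (auto simp: abs_le_iff algebra_simps)
        also have "\<dots> \<le> (1 + e) * ((1 + 2 * e) * U n)" using up1 e by (intro mult_left_mono) auto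
        also have "(1 + e) * ((1 + 2 * e) * U n) + e * U n = (1 + (4 * e + 2 * (e * e))) * U n" by (simp add: algebra_simps)
        also have "\<dots> \<le> (1 + e0) * U n"
        proof (intro mult_right_mono)
          have "e * e \<le> e" using mult_left_mono[of e 1 e] e by simp
          moreover have "e0 = 8 * e" by (simp add: e_def)
          ultimately show "1 + (4 * e + 2 * (e * e)) \<le> 1 + e0" using e by linarith
        qed (use U0 in simp)
        finally have u: "\<P>(\<omega> in M. Z n \<omega> \<ge> y) \<le> (1 + e0) * U n" by simp
        have "(1 - e0) * U n \<le> (1 - e) * ((1 - 2 * e) * ((1 - e) * U n)) - e * U n"
        proof -
          have "1 - e0 \<le> (1 - e) * (1 - 2 * e) * (1 - e) - e"
          proof -
            have "(1 - e) * (1 - 2 * e) * (1 - e) - e = 1 - 5 * e + e * e * (5 - 2 * e)" by (simp add: algebra_simps)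
            moreover have "0 \<le> e * e * (5 - 2 * e)" using e by auto
            moreover have "e0 = 8 * e" by (simp add: e_def)
            ultimately show ?thesis using e by linarith
          qed
          from mult_right_mono[OF this, of "U n"] U0 show ?thesis by (simp add: algebra_simps)
        qed
        also have "\<dots> \<le> (1 - e) * V (c n) (F N) ((1 + r) * y) - e * U n"
          using lo1 e by (intro diff_right_mono mult_left_mono) auto
        also have "(1 - e) * V (c n) (F N) ((1 + r) * y) \<le> \<P>(\<omega> in M. S (c n) (F N) \<omega> \<ge> (1 + r) * y)"
          using A' r by (auto simp: abs_le_iff algebra_simps)
        also have "\<P>(\<omega> in M. S (c n) (F N) \<omega> \<ge> (1 + r) * y) - e * U n \<le> \<P>(\<omega> in M. Z n \<omega> \<ge> y)"
          using elim(2)[rule_format, of y] unfolding s1 F_def by simp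
        finally show ?case using u by (simp add: abs_le_iff algebra_simps)
      qed
      then show ?thesis by (simp add: y_def)
    qed
    show "\<exists>N. \<forall>n\<ge>N. n \<ge> 1 \<longrightarrow> \<bar>\<P>(\<omega> in M. Z n \<omega> \<ge> x n) - U n\<bar> \<le> e0 * U n"
      by (intro exI[of _ "max n0 n1"] allI impI main)
  qed
qed

end

text \<open>Positivity far out propagates to the left by monotonicity, so the asymptotic form of the
  tail gives positivity everywhere.\<close>

lemma regular_tail_pos:
  fixes H :: "real \<Rightarrow> real"
  assumes h: "slowly_varying h" and anti: "\<And>x y. x \<le> y \<Longrightarrow> H y \<le> H x"
    and H: "\<forall>\<^sub>F y in at_top. H y = h y / y powr t"
  shows "H y > 0"
proof -
  have hp: "\<forall>\<^sub>F y in at_top. h y > 0" using h by (simp add: slowly_varying_def)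
  have "\<forall>\<^sub>F z in at_top. H z > 0 \<and> z \<ge> y"
    using H hp eventually_gt_at_top[of 0] eventually_ge_at_top[of y]
    by eventually_elim simp
  then obtain z where "H z > 0" "y \<le> z" by (auto simp: eventually_at_top_linorder)
  then show ?thesis using anti[of y z] by simp
qed

lemma regular_tail_ratio:
  fixes H :: "real \<Rightarrow> real"
  assumes h: "slowly_varying h" and s: "s > 0" and f: "f > 0"
    and H: "\<forall>\<^sub>F y in at_top. H y = h y / y powr t"
  shows "((\<lambda>y. H (s * (f * y)) / H (s * y)) \<longlongrightarrow> f powr (- t)) at_top"
proof -
  have "((\<lambda>x. h (f * x) / h x) \<longlongrightarrow> 1) at_top" using h f by (simp add: slowly_varying_def)
  then have "((\<lambda>x. h (f * x) / h x * f powr (- t)) \<longlongrightarrow> 1 * f powr (- t)) at_top" by (intro tendsto_intros)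
  moreover have "\<forall>\<^sub>F y in at_top. H (f * y) = h (f * y) / (f * y) powr t"
  proof -
    have "filterlim (\<lambda>y. f * y) at_top at_top" using f by real_asymp
    from eventually_compose_filterlim[OF H this] show ?thesis .
  qed
  with H eventually_gt_at_top[of 0]
  have "\<forall>\<^sub>F y in at_top. h (f * y) / h y * f powr (- t) = H (f * y) / H y"
  proof eventually_elim
    case (elim y)
    then show ?case using f by (simp add: powr_mult powr_minus_divide)
  qed
  ultimately have "((\<lambda>y. H (f * y) / H y) \<longlongrightarrow> f powr (- t)) at_top" by (simp add: tendsto_cong)
  moreover have "filterlim (\<lambda>y. s * y) at_top at_top" using s by real_asymp
  ultimately have "((\<lambda>y. H (f * (s * y)) / H (s * y)) \<longlongrightarrow> f powr (- t)) at_top" by (rule filterlim_compose)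
  then show ?thesis by (simp add: mult.left_commute)
qed

theorem corollary2p5:
  fixes M :: "'a measure" and \<xi> :: "int \<Rightarrow> 'a \<Rightarrow> real"
    and l :: "real \<Rightarrow> real" and r :: real and a :: "int \<Rightarrow> real"
  assumes "prob_space M"
    and indep: "prob_space.indep_vars M (\<lambda>_. borel) \<xi> UNIV"
    and ident: "\<And>i. distr M borel (\<xi> i) = distr M borel (\<xi> 0)"
    and second_moment: "integrable M (\<lambda>\<omega>. (\<xi> 0 \<omega>)\<^sup>2)"
    and centered: "(LINT \<omega>|M. \<xi> 0 \<omega>) = 0"
    and nondegenerate: "(LINT \<omega>|M. (\<xi> 0 \<omega>)\<^sup>2) > 0"
    and r: "1 / 2 < r" "r < 1"
    and l: "slowly_varying l" "\<And>x. x > 0 \<Longrightarrow> l x > 0"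
    and a: "a = coeff_a l r" "a 0 = 1"
  shows
    "(\<forall>t h c\<^sub>1 x.
        t > 2 \<and> slowly_varying h \<and>
        (\<forall>\<^sub>F y in at_top. \<P>(\<omega> in M. \<xi> 0 \<omega> \<ge> y) = h y / y powr t) \<and>
        c\<^sub>1 > sqrt (t - 2) * exp (t / 2) * (t + 2) / 2 \<and>
        (\<forall>n\<ge>1. x n > c\<^sub>1 * sqrt (ln (real n))) \<longrightarrow>
        (\<exists>\<epsilon> :: nat \<Rightarrow> real. \<epsilon> \<longlonglongrightarrow> 0 \<and>
          (\<forall>n\<ge>1. \<P>(\<omega> in M. partial_sum a \<xi> n \<omega> \<ge> x n * sum_sd M a \<xi> n) =
             (1 + \<epsilon> n) * (\<Sum>\<^sub>\<infinity>i\<in>{..int n}.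
               \<P>(\<omega> in M. coeff_b a n i * \<xi> 0 \<omega> \<ge> x n * sum_sd M a \<xi> n))))) \<and>
     (\<forall>p x.
        p > 2 \<and> integrable M (\<lambda>\<omega>. \<bar>\<xi> 0 \<omega>\<bar> powr p) \<and>
        (\<forall>n\<ge>1. (x n)\<^sup>2 \<le> (p - 2) * ln (real n)) \<longrightarrow>
        (\<exists>\<epsilon> :: nat \<Rightarrow> real. \<epsilon> \<longlonglongrightarrow> 0 \<and>
          (\<forall>n\<ge>1. \<P>(\<omega> in M. partial_sum a \<xi> n \<omega> \<ge> x n * sum_sd M a \<xi> n) =
             (1 - std_normal_cdf (x n)) * (1 + \<epsilon> n))))"
proof -
  interpret P: prob_space M by fact
  define v where "v = (LINT \<omega>|M. (\<xi> 0 \<omega>)\<^sup>2)"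
  define s where "s = sqrt v"
  have s: "s > 0" "s\<^sup>2 = v" using nondegenerate by (simp_all add: s_def v_def)
  have xim[measurable]: "\<xi> i \<in> borel_measurable M" for i using indep by (auto simp: P.indep_vars_def)
  define X where "X i \<omega> = \<xi> i \<omega> / s" for i \<omega>
  define \<mu> where "\<mu> = distr M borel (X 0)"
  have Xm[measurable]: "X i \<in> borel_measurable M" for i unfolding X_def by measurable
  have scale: "(\<lambda>i \<omega>. s * X i \<omega>) = \<xi>" using s by (simp add: X_def fun_eq_iff)
  have xi0: "s * X 0 \<omega> = \<xi> 0 \<omega>" for \<omega> using s by (simp add: X_def)
  have "iid_std M X \<mu>"
  proof
    show "P.indep_vars (\<lambda>_. borel) X UNIV"
      unfolding X_def[abs_def] by (rule P.indep_vars_compose2[OF indep]) auto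
    show "distr M borel (X i) = \<mu>" for i
    proof -
      have "distr M borel (X j) = distr (distr M borel (\<xi> j)) borel (\<lambda>x. x / s)" for j
        by (subst distr_distr) (auto simp: X_def[abs_def] comp_def)
      then show ?thesis unfolding \<mu>_def using ident[of i] by simp
    qed
    have iM: "integrable M (\<lambda>\<omega>. (X 0 \<omega>)\<^sup>2)" unfolding X_def power_divide using second_moment by simp
    show "integrable \<mu> (\<lambda>x. x\<^sup>2)" unfolding \<mu>_def using iM by (subst integrable_distr_eq) auto
    show "(LINT x|\<mu>. x) = 0" unfolding \<mu>_def using centered by (subst integral_distr) (auto simp: X_def[abs_def])
    show "(LINT x|\<mu>. x\<^sup>2) = 1"
      unfolding \<mu>_def using s by (subst integral_distr) (auto simp: X_def power_divide v_def)
  qed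
  then interpret iid_std M X \<mu> .
  obtain C where "regular_coeffs (\<lambda>m. l m * m powr (- r)) C ((1 + r) / 2) ((r + 1 / 2) / 2) (coeff_a l r)"
    by (rule regular_coeffs_coeff_a[OF l r])
  then interpret regular_coeffs "\<lambda>m. l m * m powr (- r)" C "(1 + r) / 2" "(r + 1 / 2) / 2" a
    unfolding a(1) .
  interpret weighted_process M X \<mu> "\<lambda>m. l m * m powr (- r)" C "(1 + r) / 2" "(r + 1 / 2) / 2" a ..
  have sd: "sum_sd M a \<xi> n = s * B n" for n
    by (simp add: sum_sd_def B_def s_def v_def real_sqrt_mult)
  have Bp: "B n > 0" if "n \<ge> 1" for n using weights that by metis
  have LHS: "\<P>(\<omega> in M. partial_sum a \<xi> n \<omega> \<ge> x * sum_sd M a \<xi> n) = \<P>(\<omega> in M. Z n \<omega> \<ge> x)" if "n \<ge> 1" for n x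
    using prob_partial_sum[OF s(1) that, of x] unfolding scale sd .
  have RHS: "\<P>(\<omega> in M. coeff_b a n i * \<xi> 0 \<omega> \<ge> x * sum_sd M a \<xi> n) = \<P>(\<omega> in M. c n i * X i \<omega> \<ge> x)" if n: "n \<ge> 1" for n x i
  proof -
    have "x * (s * B n) \<le> coeff_b a n i * \<xi> 0 \<omega> \<longleftrightarrow> c n i * X 0 \<omega> \<in> {x..}" for \<omega>
      using s(1) Bp[OF n] by (simp add: c_def X_def pos_le_divide_eq mult.commute mult.left_commute)
    then have "\<P>(\<omega> in M. coeff_b a n i * \<xi> 0 \<omega> \<ge> x * sum_sd M a \<xi> n) = \<P>(\<omega> in M. X 0 \<omega> \<in> {z. c n i * z \<in> {x..}})"
      unfolding sd by simp
    \<comment> \<open>Every term on the right contains the same \<open>\<xi> 0\<close>; equality of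
      the laws exchanges it for \<open>X i\<close>, the form in which the jumps occur.\<close>
    also have "\<dots> = \<P>(\<omega> in M. X i \<omega> \<in> {z. c n i * z \<in> {x..}})"
      by (subst (1 2) prob_law) auto
    finally show ?thesis by simp
  qed
  show ?thesis
  proof (rule conjI; intro allI impI; elim conjE)
    fix t c1 :: real and h :: "real \<Rightarrow> real" and x :: "nat \<Rightarrow> real"
    assume t: "t > 2" and h: "slowly_varying h"
      and tail: "\<forall>\<^sub>F y in at_top. \<P>(\<omega> in M. \<xi> 0 \<omega> \<ge> y) = h y / y powr t"
      and c1: "c1 > sqrt (t - 2) * exp (t / 2) * (t + 2) / 2"
      and x: "\<forall>n\<ge>1. x n > c1 * sqrt (ln (real n))"
    define H where "H y = \<P>(\<omega> in M. \<xi> 0 \<omega> \<ge> y)" for y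
    have GH: "G y = H (s * y)" for y
    proof -
      have "G y = \<P>(\<omega> in M. X 0 \<omega> \<in> {y..})" unfolding G_def by (rule prob_law[symmetric]) simp
      also have "\<dots> = H (s * y)" unfolding H_def using s by (simp add: X_def pos_le_divide_eq mult.commute)
      finally show ?thesis .
    qed
    have H: "\<forall>\<^sub>F y in at_top. H y = h y / y powr t" using tail by (simp add: H_def)
    have anti: "H y \<le> H x" if "x \<le> y" for x y
      unfolding H_def using that by (intro P.finite_measure_mono) auto
    \<comment> \<open>\<open>t > 2\<close> gives \<open>(t + 2) / 2 \<ge> 2\<close>; squaring the
      resulting bound on \<open>c1\<close> produces the threshold
      \<open>4 * exp t * (t - 2) * ln n\<close>.\<close>
    have c0: "sqrt (t - 2) * exp (t / 2) * (t + 2) / 2 \<ge> 2 * (sqrt (t - 2) * exp (t / 2))"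
      using t mult_left_mono[of 4 "t + 2" "sqrt (t - 2) * exp (t / 2)"] by simp
    have c1p: "c1 > 0" "c1 \<ge> 2 * (sqrt (t - 2) * exp (t / 2))"
    proof -
      show "c1 \<ge> 2 * (sqrt (t - 2) * exp (t / 2))" using c0 c1 by linarith
      moreover have "sqrt (t - 2) * exp (t / 2) > 0" using t by simp
      ultimately show "c1 > 0" by linarith
    qed
    \<comment> \<open>For \<open>n = 1\<close> the logarithm vanishes, and positivity comes from the
      strict inequality in the hypothesis.\<close>
    have x0: "x n > 0" if n: "n \<ge> 1" for n
    proof -
      have "0 \<le> c1 * sqrt (ln (real n))" using c1p n by simp
      then show ?thesis using x n by (meson le_less_trans)
    qed
    have xk: "4 * exp t * (t - 2) * ln (real n) \<le> (x n)\<^sup>2" if n: "n \<ge> 1" for n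
    proof -
      have "(2 * (sqrt (t - 2) * exp (t / 2)) * sqrt (ln (real n)))\<^sup>2 \<le> (x n)\<^sup>2"
      proof (rule power_mono)
        have "2 * (sqrt (t - 2) * exp (t / 2)) * sqrt (ln (real n)) \<le> c1 * sqrt (ln (real n))"
          using c1p n by (intro mult_right_mono) auto
        then show "2 * (sqrt (t - 2) * exp (t / 2)) * sqrt (ln (real n)) \<le> x n" using x n by (meson le_less_trans less_imp_le)
      qed (use t n in simp)
      also have "(2 * (sqrt (t - 2) * exp (t / 2)) * sqrt (ln (real n)))\<^sup>2 = 4 * (t - 2) * (exp (t / 2))\<^sup>2 * ln (real n)"
        using t n by (simp add: power_mult_distrib)
      also have "(exp (t / 2))\<^sup>2 = exp t" by (simp add: power2_eq_square flip: exp_add)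
      finally show ?thesis by (simp add: mult_ac)
    qed
    have "\<exists>\<epsilon>. \<epsilon> \<longlonglongrightarrow> 0 \<and> (\<forall>n\<ge>1. \<P>(\<omega> in M. Z n \<omega> \<ge> x n) =
        (\<Sum>\<^sub>\<infinity>i\<in>{..int n}. \<P>(\<omega> in M. c n i * X i \<omega> \<ge> x n)) * (1 + \<epsilon> n))"
    proof (rule large_deviations[OF t])
      show "G y > 0" for y unfolding GH by (rule regular_tail_pos[OF h anti H])
      show "((\<lambda>y. G (f * y) / G y) \<longlongrightarrow> f powr (- t)) at_top" if "f > 0" for f
        unfolding GH by (rule regular_tail_ratio[OF h s(1) that H])
    qed (use x0 xk in auto)
    then obtain \<epsilon> where e: "\<epsilon> \<longlonglongrightarrow> 0" "\<forall>n\<ge>1. \<P>(\<omega> in M. Z n \<omega> \<ge> x n) =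
        (\<Sum>\<^sub>\<infinity>i\<in>{..int n}. \<P>(\<omega> in M. c n i * X i \<omega> \<ge> x n)) * (1 + \<epsilon> n)"
      by (elim exE conjE)
    show "\<exists>\<epsilon>. \<epsilon> \<longlonglongrightarrow> 0 \<and> (\<forall>n\<ge>1. \<P>(\<omega> in M. partial_sum a \<xi> n \<omega> \<ge> x n * sum_sd M a \<xi> n) =
        (1 + \<epsilon> n) * (\<Sum>\<^sub>\<infinity>i\<in>{..int n}. \<P>(\<omega> in M. coeff_b a n i * \<xi> 0 \<omega> \<ge> x n * sum_sd M a \<xi> n)))"
    proof (intro exI[of _ \<epsilon>] conjI allI impI e(1))
      fix n :: nat assume n: "1 \<le> n"
      show "\<P>(\<omega> in M. partial_sum a \<xi> n \<omega> \<ge> x n * sum_sd M a \<xi> n) =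
        (1 + \<epsilon> n) * (\<Sum>\<^sub>\<infinity>i\<in>{..int n}. \<P>(\<omega> in M. coeff_b a n i * \<xi> 0 \<omega> \<ge> x n * sum_sd M a \<xi> n))"
        unfolding LHS[OF n] RHS[OF n] e(2)[rule_format, OF n] by (rule mult.commute)
    qed
  next
    fix p :: real and x :: "nat \<Rightarrow> real"
    assume p: "p > 2" and ip: "integrable M (\<lambda>\<omega>. \<bar>\<xi> 0 \<omega>\<bar> powr p)"
      and x: "\<forall>n\<ge>1. (x n)\<^sup>2 \<le> (p - 2) * ln (real n)"
    have "integrable M (\<lambda>\<omega>. \<bar>\<xi> 0 \<omega>\<bar> powr p / s powr p)" using ip by simp
    then have "integrable M (\<lambda>\<omega>. \<bar>X 0 \<omega>\<bar> powr p)" using s(1) by (simp add: X_def abs_divide powr_divide)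
    then have "integrable \<mu> (\<lambda>x. \<bar>x\<bar> powr p)" by (subst (asm) integrable_law) auto
    from moderate_deviations[OF p this, of x] x
    obtain \<epsilon> where e: "\<epsilon> \<longlonglongrightarrow> 0" "\<forall>n\<ge>1. \<P>(\<omega> in M. Z n \<omega> \<ge> x n) = Q (x n) * (1 + \<epsilon> n)" by auto
    show "\<exists>\<epsilon>. \<epsilon> \<longlonglongrightarrow> 0 \<and> (\<forall>n\<ge>1. \<P>(\<omega> in M. partial_sum a \<xi> n \<omega> \<ge> x n * sum_sd M a \<xi> n) =
        (1 - std_normal_cdf (x n)) * (1 + \<epsilon> n))"
    proof (intro exI[of _ \<epsilon>] conjI allI impI e(1))
      fix n :: nat assume n: "1 \<le> n"
      show "\<P>(\<omega> in M. partial_sum a \<xi> n \<omega> \<ge> x n * sum_sd M a \<xi> n) = (1 - std_normal_cdf (x n)) * (1 + \<epsilon> n)"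
        unfolding LHS[OF n] Q_eq using e(2) n by blast
    qed
  qed
qed

end
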